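(* Let $P=P(0)$ be the Kirchhoff (Neumann) Laplacian on the quantum graph described in the context, and let $P(t)$ be the operator obtained by replacing the lengths $\ell_m$ of the finite edges by $\ell_m(t)=e^{-a_m(t)}\ell_m$, $K+1\le m\le K+M$, where the $a_m$ are smooth real-valued functions with $a_m(0)=0$. Suppose that $\lambda^2>0$ (with $\lambda>0$) is a simple eigenvalue of $P(0)$ and $u$ is the corresponding normalized eigenfunction. Then there exist $t_0>0$ and a smooth function $t\mapsto\lambda(t)$, $|t|\le t_0$, with $\lambda(0)=\lambda$ and $\lambda(t)\in\operatorname{Res}(P(t))$, such that \[ \operatorname{Im}\ddot\lambda=-\sum_{k=1}^K|F_k|^2,\qquad F_k:=\lambda\langle \dot a u,e^k(\lambda)\rangle+\lambda^{-1}\sum_{v}\sum_{e_m\ni v}\tfrac14\dot a_m\Big(3\,\partial_\nu u_m(v)\,\overline{e^k(\lambda,v)}-u(v)\,\partial_\nu\overline{e^k_m(\lambda,v)}\Big), \] where $\dot f:=\partial_t f|_{t=0}$.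
   Context: The graph has vertices $v_1,\dots,v_J$, $K\ge1$ infinite leads $e_1,\dots,e_K$ and $M$ finite edges $e_{K+1},\dots,e_{K+M}$. Each lead $e_k$ is identified with $[0,\infty)$ (so $\ell_k=\infty$), its unique vertex at $x=0$; each finite edge $e_m$ is identified with $[0,\ell_m]$, $\ell_m>0$, and has two distinct vertices as endpoints. $v\in e_m$ / $e_m\ni v$ means $v$ is an endpoint of $e_m$. The Hilbert space is $L^2=\bigoplus_{m=1}^{K+M}L^2([0,\ell_m])$, $u=(u_1,\dots,u_{K+M})$, with $\langle f,g\rangle=\sum_m\int f_m\bar g_m$. The operator $P$ acts by $(Pu)_m=-u_m''$ on the domain of $u$ with $u_m\in H^2([0,\ell_m])$, $u_m(v)=u_\ell(v)$ whenever $v$ is a common vertex of $e_m,e_\ell$, and $\sum_{e_m\ni v}\partial_\nu u_m(v)=0$ at every vertex, where $\partial_\nu u_m(0)=-u_m'(0)$, $\partial_\nu u_m(\ell_m)=u_m'(\ell_m)$ (outward normal derivative). For continuous $u$, $u(v)$ denotes the common value at $v$. Resonances $\operatorname{Res}(P)$ are the poles of the meromorphic continuation of $\lambda\mapsto(P-\lambda^2)^{-1}$ from $\operatorname{Im}\lambda>0$ to $\mathbb C$ as an operator $L^2_{\mathrm{comp}}\to L^2_{\mathrm{loc}}$. The generalized eigenfunctions $e^k(\lambda)$, $1\le k\le K$, of $P=P(0)$ are characterized for real $\lambda$ not in the point spectrum by $e^k(\lambda)\in\mathcal D_{\mathrm{loc}}(P)$, $(P-\lambda^2)e^k(\lambda)=0$,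 and $e^k_m(\lambda,x)=\delta_{mk}e^{-i\lambda x}+s_{mk}(\lambda)e^{i\lambda x}$ for $1\le m\le K$; the family $\lambda\mapsto e^k(\lambda)$ extends holomorphically to a neighbourhood of $\mathbb R$, which defines $e^k(\lambda)$ for all real $\lambda$. Here $\dot a_m=a_m'(0)$ for finite edges, $\dot a_m:=0$ on leads, and $\dot a u$ is the function equal to $\dot a_m u_m$ on $e_m$. *)

theory Defs
  imports "HOL-Complex_Analysis.Complex_Analysis"
begin

(* Combinatorial data of the quantum graph.  Edges are numbered 1..K+M:
   edges 1..K are the leads, edges K+1..K+M the finite edges.
   Vertices are 0..J-1.  src m = vertex at x = 0, tgt m = vertex at x = l_m
   (only meaningful for finite edges). *)
record qgraph =
  nV :: nat
  nL :: nat
  nF :: nat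
  src :: "nat \<Rightarrow> nat"
  tgt :: "nat \<Rightarrow> nat"

definition edges :: "qgraph \<Rightarrow> nat set" where
  "edges G = {1..nL G + nF G}"

definition fin_edges :: "qgraph \<Rightarrow> nat set" where
  "fin_edges G = {nL G + 1..nL G + nF G}"

definition wf_qgraph :: "qgraph \<Rightarrow> (nat \<Rightarrow> real) \<Rightarrow> bool" where
  "wf_qgraph G L \<longleftrightarrow> 1 \<le> nL G \<and> (\<forall>m\<in>edges G. src G m < nV G) \<and>
     (\<forall>m\<in>fin_edges G. tgt G m < nV G \<and> src G m \<noteq> tgt G m \<and> 0 < L m)"

definition eI :: "qgraph \<Rightarrow> (nat \<Rightarrow> real) \<Rightarrow> nat \<Rightarrow> real set" where
  "eI G L m = (if m \<le> nL G then {0..} else {0..L m})"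

definition endpt :: "qgraph \<Rightarrow> nat \<Rightarrow> nat \<Rightarrow> bool" where
  "endpt G m v \<longleftrightarrow> m \<in> edges G \<and> (src G m = v \<or> (nL G < m \<and> tgt G m = v))"

definition vval :: "qgraph \<Rightarrow> (nat \<Rightarrow> real) \<Rightarrow> (nat \<Rightarrow> real \<Rightarrow> complex) \<Rightarrow> nat \<Rightarrow> nat \<Rightarrow> complex" where
  "vval G L u m v = (if src G m = v then u m 0 else u m (L m))"

definition dnu :: "qgraph \<Rightarrow> (nat \<Rightarrow> real) \<Rightarrow> (nat \<Rightarrow> real \<Rightarrow> complex) \<Rightarrow> nat \<Rightarrow> nat \<Rightarrow> complex" where
  "dnu G L u m v = (if src G m = v then - vector_derivative (u m) (at 0 within eI G L m)
                    else vector_derivative (u m) (at (L m) within eI G L m))"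

definition L2_on :: "real set \<Rightarrow> (real \<Rightarrow> complex) \<Rightarrow> bool" where
  "L2_on I f \<longleftrightarrow> set_borel_measurable lborel I f \<and> set_integrable lborel I (\<lambda>x. (cmod (f x))\<^sup>2)"

(* f \<in> H^2(I), I = [0,b] or [0,\<infinity>), with weak second derivative g:
   f is C^1 on I with derivative f', f' is the indefinite integral of g, and f, f', g \<in> L^2(I) *)
definition H2_on :: "real set \<Rightarrow> (real \<Rightarrow> complex) \<Rightarrow> (real \<Rightarrow> complex) \<Rightarrow> bool" where
  "H2_on I f g \<longleftrightarrow> (\<exists>f'. (\<forall>x\<in>I. (f has_vector_derivative f' x) (at x within I)) \<and>
      (\<forall>x\<in>I. f' x = f' 0 + (LINT y:{0..x}|lborel. g y)) \<and>
      L2_on I f \<and> L2_on I f' \<and> L2_on I g)"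

definition H2loc_on :: "real set \<Rightarrow> (real \<Rightarrow> complex) \<Rightarrow> (real \<Rightarrow> complex) \<Rightarrow> bool" where
  "H2loc_on I f g \<longleftrightarrow> (\<forall>R\<ge>0. H2_on (I \<inter> {0..R}) f g)"

definition vertex_conds :: "qgraph \<Rightarrow> (nat \<Rightarrow> real) \<Rightarrow> (nat \<Rightarrow> real \<Rightarrow> complex) \<Rightarrow> bool" where
  "vertex_conds G L u \<longleftrightarrow>
     (\<forall>m m' v. endpt G m v \<and> endpt G m' v \<longrightarrow> vval G L u m v = vval G L u m' v) \<and>
     (\<forall>v<nV G. (\<Sum>m\<in>{m\<in>edges G. endpt G m v}. dnu G L u m v) = 0)"

(* functions on the graph are represented by u :: edge \<Rightarrow> coordinate \<Rightarrow> value,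
   normalised to vanish off the edges *)
definition supp_ok :: "qgraph \<Rightarrow> (nat \<Rightarrow> real) \<Rightarrow> (nat \<Rightarrow> real \<Rightarrow> complex) \<Rightarrow> bool" where
  "supp_ok G L u \<longleftrightarrow> (\<forall>m. m \<notin> edges G \<longrightarrow> u m = (\<lambda>x. 0)) \<and>
                      (\<forall>m\<in>edges G. \<forall>x. x \<notin> eI G L m \<longrightarrow> u m x = 0)"

definition solves :: "qgraph \<Rightarrow> (nat \<Rightarrow> real) \<Rightarrow> complex \<Rightarrow> (nat \<Rightarrow> real \<Rightarrow> complex)
                      \<Rightarrow> (nat \<Rightarrow> real \<Rightarrow> complex) \<Rightarrow> bool" where
  "solves G L z u f \<longleftrightarrow> supp_ok G L u \<and> vertex_conds G L u \<and>
     (\<forall>m\<in>edges G. \<exists>g. H2_on (eI G L m) (u m) g \<and>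
        (AE x in lborel. x \<in> eI G L m \<longrightarrow> - g x - z * u m x = f m x))"

definition solves_loc :: "qgraph \<Rightarrow> (nat \<Rightarrow> real) \<Rightarrow> complex \<Rightarrow> (nat \<Rightarrow> real \<Rightarrow> complex)
                      \<Rightarrow> (nat \<Rightarrow> real \<Rightarrow> complex) \<Rightarrow> bool" where
  "solves_loc G L z u f \<longleftrightarrow> supp_ok G L u \<and> vertex_conds G L u \<and>
     (\<forall>m\<in>edges G. \<exists>g. H2loc_on (eI G L m) (u m) g \<and>
        (AE x in lborel. x \<in> eI G L m \<longrightarrow> - g x - z * u m x = f m x))"

definition zero_fun :: "nat \<Rightarrow> real \<Rightarrow> complex" where
  "zero_fun = (\<lambda>m x. 0)"

definition ip :: "qgraph \<Rightarrow> (nat \<Rightarrow> real) \<Rightarrow> (nat \<Rightarrow> real \<Rightarrow> complex) \<Rightarrow> (nat \<Rightarrow> real \<Rightarrow> complex) \<Rightarrow> complex" where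
  "ip G L u g = (\<Sum>m\<in>edges G. LINT x:eI G L m|lborel. u m x * cnj (g m x))"

definition eigfun :: "qgraph \<Rightarrow> (nat \<Rightarrow> real) \<Rightarrow> complex \<Rightarrow> (nat \<Rightarrow> real \<Rightarrow> complex) \<Rightarrow> bool" where
  "eigfun G L z u \<longleftrightarrow> solves G L z u zero_fun \<and> u \<noteq> zero_fun"

definition simple_eigenvalue :: "qgraph \<Rightarrow> (nat \<Rightarrow> real) \<Rightarrow> complex \<Rightarrow> bool" where
  "simple_eigenvalue G L z \<longleftrightarrow> (\<exists>u. eigfun G L z u \<and>
      (\<forall>w. solves G L z w zero_fun \<longrightarrow> (\<exists>c. w = (\<lambda>m x. c * u m x))))"

definition L2comp :: "qgraph \<Rightarrow> (nat \<Rightarrow> real) \<Rightarrow> (nat \<Rightarrow> real \<Rightarrow> complex) \<Rightarrow> bool" where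
  "L2comp G L f \<longleftrightarrow> supp_ok G L f \<and> (\<forall>m\<in>edges G. L2_on (eI G L m) (f m)) \<and>
     (\<exists>R. \<forall>m\<in>edges G. m \<le> nL G \<longrightarrow> (\<forall>x>R. f m x = 0))"

(* Resonances: poles of the meromorphic continuation of \<lambda> \<mapsto> (P - \<lambda>^2)^{-1} : L^2_comp \<rightarrow> L^2_loc
   from Im \<lambda> > 0, detected through its matrix elements <(P - \<lambda>^2)^{-1} f, g>, f,g \<in> L^2_comp *)
definition Res :: "qgraph \<Rightarrow> (nat \<Rightarrow> real) \<Rightarrow> complex set" where
  "Res G L = {\<mu>. \<exists>f g F. L2comp G L f \<and> L2comp G L g \<and> F meromorphic_on UNIV \<and>
      (\<forall>z. 0 < Im z \<longrightarrow> (\<forall>u. solves G L (z\<^sup>2) u f \<longrightarrow> F z = ip G L u g)) \<and>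
      is_pole F \<mu>}"

definition gen_eigfuns :: "qgraph \<Rightarrow> (nat \<Rightarrow> real) \<Rightarrow> (complex \<Rightarrow> nat \<Rightarrow> nat \<Rightarrow> real \<Rightarrow> complex) \<Rightarrow> bool" where
  "gen_eigfuns G L E \<longleftrightarrow>
     (\<forall>lam::real. (\<nexists>w. eigfun G L (complex_of_real (lam\<^sup>2)) w) \<longrightarrow>
        (\<forall>k\<in>{1..nL G}. solves_loc G L (complex_of_real (lam\<^sup>2)) (E (complex_of_real lam) k) zero_fun \<and>
           (\<forall>m\<in>{1..nL G}. \<exists>s. \<forall>x\<ge>0. E (complex_of_real lam) k m x =
              (if m = k then exp (- \<i> * lam * x) else 0) + s * exp (\<i> * lam * x)))) \<and>
     (\<exists>U. open U \<and> \<real> \<subseteq> U \<and> (\<forall>k m x. (\<lambda>z. E z k m x) holomorphic_on U))"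

fun vderivs :: "nat \<Rightarrow> (real \<Rightarrow> 'a::real_normed_vector) \<Rightarrow> real \<Rightarrow> 'a" where
  "vderivs 0 f = f"
| "vderivs (Suc n) f = (\<lambda>t. vector_derivative (vderivs n f) (at t))"

definition smooth_on :: "real set \<Rightarrow> (real \<Rightarrow> 'a::real_normed_vector) \<Rightarrow> bool" where
  "smooth_on S f \<longleftrightarrow> (\<forall>n. \<forall>t\<in>S. vderivs n f differentiable (at t))"

definition adot :: "qgraph \<Rightarrow> (nat \<Rightarrow> real \<Rightarrow> real) \<Rightarrow> nat \<Rightarrow> real" where
  "adot G a m = (if m \<in> fin_edges G then vector_derivative (a m) (at 0) else 0)"

definition Fcoef :: "qgraph \<Rightarrow> (nat \<Rightarrow> real) \<Rightarrow> (nat \<Rightarrow> real \<Rightarrow> real) \<Rightarrow> real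
     \<Rightarrow> (nat \<Rightarrow> real \<Rightarrow> complex) \<Rightarrow> (complex \<Rightarrow> nat \<Rightarrow> nat \<Rightarrow> real \<Rightarrow> complex) \<Rightarrow> nat \<Rightarrow> complex" where
  "Fcoef G L a lam u E k =
     (let e = E (complex_of_real lam) k in
      complex_of_real lam *
        ip G L (\<lambda>m x. complex_of_real (adot G a m) * u m x) e
      + complex_of_real (1 / lam) *
        (\<Sum>v<nV G. \<Sum>m\<in>{m\<in>edges G. endpt G m v}.
           complex_of_real (adot G a m / 4) *
             (3 * dnu G L u m v * cnj (vval G L e m v) - vval G L u m v * cnj (dnu G L e m v))))"

end

theory Submission
  imports Defs "Jordan_Normal_Form.Determinant"
begin

text \<open>On every edge a solution of \<open>-u'' = z\<^sup>2 u\<close> is a combination of \<open>e\<^sup>i\<^sup>z\<^sup>x\<close> and \<open>e\<^sup>-\<^sup>i\<^sup>z\<^sup>x\<close>, so the outgoing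
  solutions are the kernel of a matrix that is entire in \<open>z\<close> and smooth in \<open>t\<close>.  Pairing the
  \<open>z\<close>-derivative of this system with the eigenfunction (Green's formula) shows that a simple
  eigenvalue is a simple zero of its determinant, and the implicit function theorem gives the branch
  \<open>\<lambda>(t)\<close>, with outgoing states that are differentiable at \<open>t = 0\<close>.  A Green identity between the
  resolvent and the outgoing state rules out that all matrix elements of the resolvent are regular at
  \<open>\<lambda>(t)\<close>, so \<open>\<lambda>(t)\<close> is a resonance.

  The flux identity \<open>2 Im \<lambda>(t) \<integral>|u(t)|\<^sup>2 = - \<Sum>|c\<^sub>k(t)|\<^sup>2\<close>, where \<open>c\<^sub>k(t)\<close> are the amplitudes on the leads
  and the integral extends over the finite edges, gives the second derivative of \<open>Im \<lambda>\<close> at \<open>0\<close> as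
  \<open>- \<Sum>|c\<^sub>k'(0)|\<^sup>2\<close>.  Pairing the state, rescaled to the original lengths, with \<open>cnj e\<^sup>k\<close> and
  differentiating at \<open>t = 0\<close> gives \<open>F\<^sub>k = i \<Sum>\<^sub>m c\<^sub>m'(0) cnj s\<^sub>m\<^sub>k\<close>; the term containing \<open>\<lambda>'(0)\<close> drops out
  because \<open>e\<^sup>k\<close> is orthogonal to \<open>u\<close>.  The scattering matrix \<open>s\<close> is symmetric and unitary.\<close>

section \<open>Determinants over finite index sets\<close>

text \<open>Keeping the vertex values as unknowns makes the system square, with exponentials and
  constants as entries. Its matrix is singular all along the branch. Replacing one column, at an
  index where the eigenvector is nonzero, by the \<open>z\<close>-derivative of the system gives a
  matrix that is invertible near \<open>t = 0\<close>; it yields both the derivative of the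
  determinant and, by Cramer's rule, an outgoing state with that component frozen.

  Only first derivatives of the state are used: the amplitudes enter the flux identity
  quadratically, and in the Green identity for the rescaled state every term is a factor vanishing
  at \<open>t = 0\<close> times a merely continuous one, so no integral is differentiated. The
  boundary terms of \<open>F\<^sub>k\<close> come from the rescaling: it preserves continuity but
  multiplies derivatives by a factor depending on the edge, so the Kirchhoff law fails to first
  order.

  At \<open>\<lambda>\<close> itself \<open>e\<^sup>k\<close> is known only by continuation, so its
  properties are limits from nearby frequencies.\<close>

notation vec_index (infixl "$v" 100)

text \<open>The matrix library indexes by naturals, whereas the secular system has structured
  indices. Rows and columns share one enumeration, so the determinant does not depend on the
  choice.\<close>

definition idx :: "'i set \<Rightarrow> nat \<Rightarrow> 'i" where
  "idx I = (SOME e. bij_betw e {0..<card I} I)"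

lemma bij_betw_idx: "finite I \<Longrightarrow> bij_betw (idx I) {0..<card I} I"
  unfolding idx_def using ex_bij_betw_nat_finite by (rule someI_ex)

definition dmat :: "'i set \<Rightarrow> ('i \<Rightarrow> 'i \<Rightarrow> complex) \<Rightarrow> complex Matrix.mat" where
  "dmat I M = Matrix.mat (card I) (card I) (\<lambda>(i, j). M (idx I i) (idx I j))"

definition ddet :: "'i set \<Rightarrow> ('i \<Rightarrow> 'i \<Rightarrow> complex) \<Rightarrow> complex" where
  "ddet I M = Determinant.det (dmat I M)"

lemma ddet_leibniz:
  "ddet I M = (\<Sum>p | p permutes {0..<card I}.
     signof p * (\<Prod>i = 0..<card I. M (idx I i) (idx I (p i))))"
  unfolding ddet_def Determinant.det_def dmat_def
  by (auto intro!: sum.cong prod.cong simp: permutes_in_image[of _ "{0..<card I}", simplified])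

text \<open>The Leibniz formula is a polynomial in the entries. The class \<open>C\<close> is later
  taken to be the holomorphic functions, the meromorphic functions, and \<open>TZ\<close>.\<close>

lemma ddet_closed:
  assumes const: "\<And>c. (\<lambda>x. c) \<in> C"
    and add: "\<And>f g. f \<in> C \<Longrightarrow> g \<in> C \<Longrightarrow> (\<lambda>x. f x + g x) \<in> C"
    and mult: "\<And>f g. f \<in> C \<Longrightarrow> g \<in> C \<Longrightarrow> (\<lambda>x. f x * g x) \<in> C"
    and fin: "finite I"
    and M: "\<And>i j. i \<in> I \<Longrightarrow> j \<in> I \<Longrightarrow> (\<lambda>x. M x i j) \<in> C"
  shows "(\<lambda>x. ddet I (M x)) \<in> C"
proof -
  have sum: "(\<lambda>x. \<Sum>p\<in>S. f p x) \<in> C" if "finite S" "\<And>p. p \<in> S \<Longrightarrow> f p \<in> C"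
    for S and f :: "(nat \<Rightarrow> nat) \<Rightarrow> 'a \<Rightarrow> complex"
    using that by (induction S rule: finite_induct) (auto intro: const add)
  have prod: "(\<lambda>x. \<Prod>p\<in>S. f p x) \<in> C" if "finite S" "\<And>p. p \<in> S \<Longrightarrow> f p \<in> C"
    for S and f :: "nat \<Rightarrow> 'a \<Rightarrow> complex"
    using that by (induction S rule: finite_induct) (auto intro: const mult)
  have im: "idx I i \<in> I" if "i < card I" for i
    using bij_betw_idx[OF fin] that by (auto simp: bij_betw_def)
  show ?thesis unfolding ddet_leibniz
  proof (intro sum mult const prod)
    show "finite {p. p permutes {0..<card I}}"
      by (simp add: finite_permutations)
    fix p i assume p: "p \<in> {p. p permutes {0..<card I}}" and i: "i \<in> {0..<card I}"
    then have "p i < card I"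
      using permutes_in_image[of p "{0..<card I}" i] by auto
    then show "(\<lambda>x. M x (idx I i) (idx I (p i))) \<in> C"
      using i by (auto intro!: M im)
  qed simp
qed

lemma dmat_mult_vec:
  assumes "finite I" "i < card I"
  shows "(dmat I M *\<^sub>v Matrix.vec (card I) (\<lambda>j. x (idx I j))) $v i = (\<Sum>j\<in>I. M (idx I i) j * x j)"
proof -
  have "(dmat I M *\<^sub>v Matrix.vec (card I) (\<lambda>j. x (idx I j))) $v i
      = (\<Sum>j = 0..<card I. M (idx I i) (idx I j) * x (idx I j))"
    using assms by (auto simp: dmat_def scalar_prod_def intro!: sum.cong)
  also have "\<dots> = (\<Sum>j\<in>I. M (idx I i) j * x j)"
    by (rule sum.reindex_bij_betw[OF bij_betw_idx[OF assms(1)]])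
  finally show ?thesis .
qed

lemma ddet_eq_0_iff:
  assumes fin: "finite I"
  shows "ddet I M = 0 \<longleftrightarrow> (\<exists>x. (\<exists>i\<in>I. x i \<noteq> 0) \<and> (\<forall>i\<in>I. (\<Sum>j\<in>I. M i j * x j) = 0))"
proof -
  let ?n = "card I"
  note bij = bij_betw_idx[OF fin]
  have A: "dmat I M \<in> carrier_mat ?n ?n" by (simp add: dmat_def)
  have im: "idx I i \<in> I" if "i < ?n" for i
    using bij that by (auto simp: bij_betw_def)
  have pre: "\<exists>k<?n. i = idx I k" if "i \<in> I" for i
    using bij that by (force simp: bij_betw_def)
  show ?thesis unfolding ddet_def det_0_iff_vec_prod_zero_field[OF A]
  proof
    assume "\<exists>v. v \<in> carrier_vec ?n \<and> v \<noteq> 0\<^sub>v ?n \<and> dmat I M *\<^sub>v v = 0\<^sub>v ?n"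
    then obtain v where v: "v \<in> carrier_vec ?n" "v \<noteq> 0\<^sub>v ?n" "dmat I M *\<^sub>v v = 0\<^sub>v ?n" by blast
    define x where "x i = v $v (the_inv_into {0..<?n} (idx I) i)" for i
    have x: "x (idx I k) = v $v k" if "k < ?n" for k
      unfolding x_def using the_inv_into_f_f[of "idx I" "{0..<?n}" k] bij that
      by (auto simp: bij_betw_def)
    have vx: "v = Matrix.vec ?n (\<lambda>j. x (idx I j))"
      using v(1) x by (intro eq_vecI) auto
    obtain k where k: "k < ?n" "v $v k \<noteq> 0"
      using v(1,2) by (metis carrier_vecD eq_vecI index_zero_vec(1) index_zero_vec(2))
    have "(\<Sum>j\<in>I. M i j * x j) = 0" if i: "i \<in> I" for i
    proof -
      obtain r where r: "r < ?n" "i = idx I r" using pre[OF i] by blast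
      show ?thesis using dmat_mult_vec[OF fin r(1), of M x] v(3) r unfolding vx[symmetric] by simp
    qed
    then show "\<exists>x. (\<exists>i\<in>I. x i \<noteq> 0) \<and> (\<forall>i\<in>I. (\<Sum>j\<in>I. M i j * x j) = 0)"
      using k x[OF k(1)] im[OF k(1)]
      by (intro exI[of _ x] conjI bexI[of _ "idx I k"]) auto
  next
    assume "\<exists>x. (\<exists>i\<in>I. x i \<noteq> 0) \<and> (\<forall>i\<in>I. (\<Sum>j\<in>I. M i j * x j) = 0)"
    then obtain x i where x: "i \<in> I" "x i \<noteq> 0" "\<And>i. i \<in> I \<Longrightarrow> (\<Sum>j\<in>I. M i j * x j) = 0" by blast
    obtain k where k: "k < ?n" "i = idx I k" using pre[OF x(1)] by blast
    let ?v = "Matrix.vec ?n (\<lambda>j. x (idx I j))"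
    have "dmat I M *\<^sub>v ?v = 0\<^sub>v ?n"
    proof (rule eq_vecI)
      fix r assume "r < dim_vec (0\<^sub>v ?n :: complex Matrix.vec)"
      then show "(dmat I M *\<^sub>v ?v) $v r = 0\<^sub>v ?n $v r"
        using dmat_mult_vec[OF fin, of r M x] x(3)[OF im, of r] by simp
    qed (simp add: dmat_def)
    moreover have "?v \<noteq> 0\<^sub>v ?n"
    proof
      assume "?v = 0\<^sub>v ?n"
      then have "?v $v k = 0" using k by simp
      then show False using k x(2) by simp
    qed
    ultimately show "\<exists>v. v \<in> carrier_vec ?n \<and> v \<noteq> 0\<^sub>v ?n \<and> dmat I M *\<^sub>v v = 0\<^sub>v ?n"
      by (intro exI[of _ ?v]) auto
  qed
qed

lemma ddet_cong:
  assumes "finite I" "\<And>i j. i \<in> I \<Longrightarrow> j \<in> I \<Longrightarrow> M i j = M' i j"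
  shows "ddet I M = ddet I M'"
proof -
  have "idx I i \<in> I" if "i < card I" for i
    using bij_betw_idx[OF assms(1)] that by (auto simp: bij_betw_def)
  then have "dmat I M = dmat I M'" unfolding dmat_def by (intro eq_matI) (auto intro: assms)
  then show ?thesis by (simp add: ddet_def)
qed

definition repl_col :: "('i \<Rightarrow> 'i \<Rightarrow> complex) \<Rightarrow> 'i \<Rightarrow> ('i \<Rightarrow> complex) \<Rightarrow> 'i \<Rightarrow> 'i \<Rightarrow> complex" where
  "repl_col M k b = (\<lambda>i j. if j = k then b i else M i j)"

text \<open>Stated without division, so that it also covers singular matrices: this is how the
  secular determinant is differentiated at its zero and how a component is shown to vanish along the
  branch.\<close>

lemma ddet_cramer:
  assumes fin: "finite I" and k: "k \<in> I"
    and eq: "\<And>i. i \<in> I \<Longrightarrow> (\<Sum>j\<in>I. M i j * x j) = b i"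
  shows "x k * ddet I M = ddet I (repl_col M k b)"
proof -
  let ?n = "card I" and ?v = "Matrix.vec (card I) (\<lambda>j. x (idx I j))"
  note bij = bij_betw_idx[OF fin]
  have A: "dmat I M \<in> carrier_mat ?n ?n" by (simp add: dmat_def)
  have im: "idx I i \<in> I" if "i < ?n" for i
    using bij that by (auto simp: bij_betw_def)
  obtain r where r: "r < ?n" "k = idx I r" using bij k by (force simp: bij_betw_def)
  have "replace_col (dmat I M) (dmat I M *\<^sub>v ?v) r = dmat I (repl_col M k b)"
  proof (rule eq_matI)
    fix i j assume "i < dim_row (dmat I (repl_col M k b))" "j < dim_col (dmat I (repl_col M k b))"
    then have ij: "i < ?n" "j < ?n" by (auto simp: dmat_def)
    have "j = r \<longleftrightarrow> idx I j = k"
      using bij ij r by (auto simp: bij_betw_def inj_on_def)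
    moreover have "(dmat I M *\<^sub>v ?v) $v i = b (idx I i)"
      using dmat_mult_vec[OF fin ij(1)] eq[OF im[OF ij(1)]] by simp
    ultimately show "replace_col (dmat I M) (dmat I M *\<^sub>v ?v) r $$ (i, j) = dmat I (repl_col M k b) $$ (i, j)"
      using ij by (auto simp: replace_col_def repl_col_def dmat_def)
  qed (auto simp: replace_col_def dmat_def)
  then show ?thesis
    using cramer_lemma_mat[OF A, of ?v r] r by (simp add: ddet_def)
qed

lemma ddet_solve:
  assumes fin: "finite I" and nz: "ddet I M \<noteq> 0"
  shows "\<exists>x. \<forall>i\<in>I. (\<Sum>j\<in>I. M i j * x j) = b i"
proof -
  let ?n = "card I"
  note bij = bij_betw_idx[OF fin]
  have A: "dmat I M \<in> carrier_mat ?n ?n" by (simp add: dmat_def)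
  define w where "w = (1 / ddet I M) \<cdot>\<^sub>v (adj_mat (dmat I M) *\<^sub>v Matrix.vec ?n (\<lambda>i. b (idx I i)))"
  have adj: "adj_mat (dmat I M) \<in> carrier_mat ?n ?n"
    "dmat I M * adj_mat (dmat I M) = ddet I M \<cdot>\<^sub>m 1\<^sub>m ?n"
    using adj_mat[OF A] by (auto simp: ddet_def)
  have wd: "w \<in> carrier_vec ?n" using adj(1) by (auto simp: w_def)
  have "dmat I M *\<^sub>v w = (1 / ddet I M) \<cdot>\<^sub>v ((dmat I M * adj_mat (dmat I M)) *\<^sub>v Matrix.vec ?n (\<lambda>i. b (idx I i)))"
    unfolding w_def using A adj(1)
    by (subst mult_mat_vec[of _ ?n ?n]) (auto simp: assoc_mult_mat_vec[of _ ?n ?n _ ?n])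
  also have "\<dots> = Matrix.vec ?n (\<lambda>i. b (idx I i))"
    unfolding adj(2) using nz by (intro eq_vecI) auto
  finally have sol: "dmat I M *\<^sub>v w = Matrix.vec ?n (\<lambda>i. b (idx I i))" .
  define x where "x i = w $v (the_inv_into {0..<?n} (idx I) i)" for i
  have x: "x (idx I k) = w $v k" if "k < ?n" for k
    unfolding x_def using the_inv_into_f_f[of "idx I" "{0..<?n}" k] bij that
    by (auto simp: bij_betw_def)
  have wx: "w = Matrix.vec ?n (\<lambda>j. x (idx I j))"
    using wd x by (intro eq_vecI) auto
  have "(\<Sum>j\<in>I. M i j * x j) = b i" if i: "i \<in> I" for i
  proof -
    obtain r where r: "r < ?n" "i = idx I r" using bij i by (force simp: bij_betw_def)
    show ?thesis using dmat_mult_vec[OF fin r(1), of M x] sol r unfolding wx[symmetric] by simp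
  qed
  then show ?thesis by blast
qed

lemma tendsto_ddet:
  assumes fin: "finite I" and M: "\<And>i j. i \<in> I \<Longrightarrow> j \<in> I \<Longrightarrow> ((\<lambda>x. M x i j) \<longlongrightarrow> M' i j) F"
  shows "((\<lambda>x. ddet I (M x)) \<longlongrightarrow> ddet I M') F"
  unfolding ddet_leibniz
proof (intro tendsto_intros M)
  fix p i assume p: "p \<in> {p. p permutes {0..<card I}}" and i: "i \<in> {0..<card I}"
  have im: "idx I i \<in> I" if "i < card I" for i
    using bij_betw_idx[OF fin] that by (auto simp: bij_betw_def)
  show "idx I i \<in> I" "idx I (p i) \<in> I"
    using p i permutes_in_image[of p "{0..<card I}" i] by (auto intro!: im)
qed

section \<open>Vertex conditions as linear conditions on boundary data\<close>

definition cont_bd :: "qgraph \<Rightarrow> (nat \<Rightarrow> complex) \<Rightarrow> (nat \<Rightarrow> complex) \<Rightarrow> bool" where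
  "cont_bd G p0 pl \<longleftrightarrow>
     (\<exists>U. (\<forall>m\<in>edges G. p0 m = U (src G m)) \<and> (\<forall>m\<in>fin_edges G. pl m = U (tgt G m)))"

text \<open>The data are derivatives in the direction of increasing \<open>x\<close>. The outward
  derivative at \<open>x = 0\<close> has the opposite sign, which moves the initial ends to the
  right-hand side.\<close>

definition kirch_bd :: "qgraph \<Rightarrow> (nat \<Rightarrow> complex) \<Rightarrow> (nat \<Rightarrow> complex) \<Rightarrow> bool" where
  "kirch_bd G p0 pl \<longleftrightarrow>
     (\<forall>v<nV G. (\<Sum>m | m \<in> fin_edges G \<and> tgt G m = v. pl m) = (\<Sum>m | m \<in> edges G \<and> src G m = v. p0 m))"

lemma finite_edges [simp]: "finite (edges G)" "finite (fin_edges G)"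
  by (auto simp: edges_def fin_edges_def)

lemma edges_split: "edges G = {1..nL G} \<union> fin_edges G" "{1..nL G} \<inter> fin_edges G = {}"
  by (auto simp: edges_def fin_edges_def)

lemma fin_edges_subset: "m \<in> fin_edges G \<Longrightarrow> m \<in> edges G"
  by (auto simp: edges_split)

lemma lead_notin_fin: "m \<le> nL G \<Longrightarrow> m \<notin> fin_edges G"
  by (auto simp: fin_edges_def)

lemma lead_in_edges: "m \<in> {1..nL G} \<Longrightarrow> m \<in> edges G"
  by (auto simp: edges_def)

lemma sum_edges_split: "(\<Sum>m\<in>edges G. f m) = (\<Sum>m=1..nL G. f m) + (\<Sum>m\<in>fin_edges G. f m)"
  unfolding edges_split(1)[of G] by (rule sum.union_disjoint) (auto simp: fin_edges_def)

lemma wf_qgraphD: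
  assumes "wf_qgraph G L"
  shows "m \<in> edges G \<Longrightarrow> src G m < nV G" "m \<in> fin_edges G \<Longrightarrow> tgt G m < nV G"
    "m \<in> fin_edges G \<Longrightarrow> src G m \<noteq> tgt G m" "m \<in> fin_edges G \<Longrightarrow> 0 < L m"
  using assms by (auto simp: wf_qgraph_def)

text \<open>Summation by parts over the vertices: every Green identity for the graph reduces to this.\<close>

lemma green_bd:
  assumes wf: "wf_qgraph G L" and k: "kirch_bd G p0 pl" and c: "cont_bd G q0 ql"
  shows "(\<Sum>m\<in>fin_edges G. pl m * ql m - p0 m * q0 m) = (\<Sum>m=1..nL G. p0 m * q0 m)"
proof -
  obtain U where U: "\<And>m. m \<in> edges G \<Longrightarrow> q0 m = U (src G m)" "\<And>m. m \<in> fin_edges G \<Longrightarrow> ql m = U (tgt G m)"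
    using c by (auto simp: cont_bd_def)
  have "(\<Sum>m\<in>fin_edges G. pl m * ql m) = (\<Sum>m\<in>fin_edges G. pl m * U (tgt G m))"
    using U by simp
  also have "\<dots> = (\<Sum>v<nV G. \<Sum>m | m \<in> fin_edges G \<and> tgt G m = v. pl m * U (tgt G m))"
    by (rule sum.group[symmetric]) (auto dest: wf_qgraphD[OF wf])
  also have "\<dots> = (\<Sum>v<nV G. (\<Sum>m | m \<in> fin_edges G \<and> tgt G m = v. pl m) * U v)"
    by (simp add: sum_distrib_right)
  also have "\<dots> = (\<Sum>v<nV G. (\<Sum>m | m \<in> edges G \<and> src G m = v. p0 m) * U v)"
    using k by (simp add: kirch_bd_def)
  also have "\<dots> = (\<Sum>v<nV G. \<Sum>m | m \<in> edges G \<and> src G m = v. p0 m * U (src G m))"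
    by (simp add: sum_distrib_right)
  also have "\<dots> = (\<Sum>m\<in>edges G. p0 m * U (src G m))"
    by (rule sum.group) (auto dest: wf_qgraphD[OF wf])
  also have "\<dots> = (\<Sum>m\<in>edges G. p0 m * q0 m)"
    using U by simp
  finally show ?thesis by (simp add: sum_subtractf sum_edges_split)
qed

lemma cont_bd_cnj: "cont_bd G p0 pl \<Longrightarrow> cont_bd G (\<lambda>m. cnj (p0 m)) (\<lambda>m. cnj (pl m))"
  unfolding cont_bd_def by (elim exE, rule_tac x="\<lambda>v. cnj (U v)" in exI) auto

lemma kirch_bd_cnj: "kirch_bd G p0 pl \<Longrightarrow> kirch_bd G (\<lambda>m. cnj (p0 m)) (\<lambda>m. cnj (pl m))"
  unfolding kirch_bd_def by (simp flip: cnj_sum)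

lemma kirch_bd_scale: "kirch_bd G p0 pl \<Longrightarrow> kirch_bd G (\<lambda>m. c * p0 m) (\<lambda>m. c * pl m)"
  unfolding kirch_bd_def by (simp flip: sum_distrib_left)

lemma kirch_bd_add:
  "kirch_bd G p0 pl \<Longrightarrow> kirch_bd G q0 ql \<Longrightarrow> kirch_bd G (\<lambda>m. p0 m + q0 m) (\<lambda>m. pl m + ql m)"
  unfolding kirch_bd_def by (simp add: sum.distrib)

lemma kirch_bd_scale_iff: "c \<noteq> 0 \<Longrightarrow> kirch_bd G (\<lambda>m. c * p0 m) (\<lambda>m. c * pl m) \<longleftrightarrow> kirch_bd G p0 pl"
  unfolding kirch_bd_def by (simp flip: sum_distrib_left)

lemma cont_bd_cong:
  assumes "\<And>m. m \<in> edges G \<Longrightarrow> p0 m = q0 m" "\<And>m. m \<in> fin_edges G \<Longrightarrow> pl m = ql m"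
  shows "cont_bd G p0 pl \<longleftrightarrow> cont_bd G q0 ql"
  using assms by (simp add: cont_bd_def)

lemma kirch_bd_cong:
  assumes "\<And>m. m \<in> edges G \<Longrightarrow> p0 m = q0 m" "\<And>m. m \<in> fin_edges G \<Longrightarrow> pl m = ql m"
  shows "kirch_bd G p0 pl \<longleftrightarrow> kirch_bd G q0 ql"
  using assms by (simp add: kirch_bd_def cong: conj_cong)

text \<open>Since the two ends of a finite edge are distinct vertices, each edge occurs at most once
  at a vertex, and the case distinctions in \<open>vval\<close> and \<open>dnu\<close> pick the
  correct end.\<close>

lemma vertex_conds_iff:
  assumes wf: "wf_qgraph G L"
  shows "vertex_conds G L u \<longleftrightarrow>
    cont_bd G (\<lambda>m. u m 0) (\<lambda>m. u m (L m)) \<and>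
    kirch_bd G (\<lambda>m. vector_derivative (u m) (at 0 within eI G L m))
      (\<lambda>m. vector_derivative (u m) (at (L m) within eI G L m))"
proof -
  have cont: "(\<forall>m m' v. endpt G m v \<and> endpt G m' v \<longrightarrow> vval G L u m v = vval G L u m' v) \<longleftrightarrow>
    cont_bd G (\<lambda>m. u m 0) (\<lambda>m. u m (L m))" (is "?l \<longleftrightarrow> ?r")
  proof
    assume l: ?l
    define U where "U v = vval G L u (SOME m. endpt G m v) v" for v
    have U: "vval G L u m v = U v" if "endpt G m v" for m v
      unfolding U_def using l someI[of "\<lambda>m. endpt G m v", OF that] that by blast
    have "u m 0 = U (src G m)" if "m \<in> edges G" for m
      using U[of m "src G m"] that by (simp add: endpt_def vval_def)
    moreover have "u m (L m) = U (tgt G m)" if "m \<in> fin_edges G" for m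
      using U[of m "tgt G m"] that wf_qgraphD(3)[OF wf that] fin_edges_subset[OF that]
      by (auto simp: endpt_def vval_def fin_edges_def)
    ultimately show ?r unfolding cont_bd_def by blast
  next
    assume ?r
    then obtain U where U: "\<And>m. m \<in> edges G \<Longrightarrow> u m 0 = U (src G m)" "\<And>m. m \<in> fin_edges G \<Longrightarrow> u m (L m) = U (tgt G m)"
      by (auto simp: cont_bd_def)
    have "vval G L u m v = U v" if "endpt G m v" for m v
      using that U[of m] by (auto simp: endpt_def vval_def fin_edges_def edges_def)
    then show ?l by simp
  qed
  have "(\<Sum>m\<in>{m\<in>edges G. endpt G m v}. dnu G L u m v) =
     (\<Sum>m | m \<in> fin_edges G \<and> tgt G m = v. vector_derivative (u m) (at (L m) within eI G L m)) -
     (\<Sum>m | m \<in> edges G \<and> src G m = v. vector_derivative (u m) (at 0 within eI G L m))" for v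
  proof -
    have "{m\<in>edges G. endpt G m v} = {m. m \<in> fin_edges G \<and> tgt G m = v} \<union> {m. m \<in> edges G \<and> src G m = v}"
      by (auto simp: endpt_def fin_edges_def edges_def)
    moreover have "{m. m \<in> fin_edges G \<and> tgt G m = v} \<inter> {m. m \<in> edges G \<and> src G m = v} = {}"
      using wf_qgraphD(3)[OF wf] by auto
    moreover have "dnu G L u m v = vector_derivative (u m) (at (L m) within eI G L m)"
      if "m \<in> fin_edges G \<and> tgt G m = v" for m
      using wf_qgraphD(3)[OF wf] that by (auto simp: dnu_def)
    ultimately show ?thesis
      by (simp add: sum.union_disjoint) (simp add: dnu_def sum_negf)
  qed
  then show ?thesis
    unfolding vertex_conds_def cont by (simp add: kirch_bd_def)
qed

section \<open>Exponential waves on an edge and the secular matrix\<close>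

definition ew :: "complex \<Rightarrow> complex \<Rightarrow> complex \<Rightarrow> real \<Rightarrow> complex" where
  "ew z \<alpha> \<beta> x = \<alpha> * exp (\<i> * z * of_real x) + \<beta> * exp (- (\<i> * z * of_real x))"

lemma ew_0 [simp]: "ew z \<alpha> \<beta> 0 = \<alpha> + \<beta>"
  by (simp add: ew_def)

lemma ew_zero [simp]: "ew z 0 0 x = 0"
  by (simp add: ew_def)

text \<open>Differentiation multiplies by \<open>\<i> * z\<close> and flips the sign of \<beta>, so
  all derivatives of waves are again expressed through \<open>ew\<close>.\<close>

lemma ew_deriv [derivative_intros]:
  "(ew z \<alpha> \<beta> has_vector_derivative \<i> * z * ew z \<alpha> (-\<beta>) x) (at x within S)"
proof -
  have *: "((\<lambda>x. \<alpha> * exp (\<i> * z * x) + \<beta> * exp (- (\<i> * z * x))) has_field_derivative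
      \<i> * z * ew z \<alpha> (-\<beta>) x) (at (of_real x))"
    unfolding ew_def by (auto intro!: derivative_eq_intros simp: algebra_simps)
  have "((\<lambda>x. \<alpha> * exp (\<i> * z * of_real x) + \<beta> * exp (- (\<i> * z * of_real x))) has_vector_derivative
      \<i> * z * ew z \<alpha> (-\<beta>) x) (at x within S)"
    by (rule has_vector_derivative_real_field) (rule has_field_derivative_at_within[OF *])
  then show ?thesis unfolding ew_def[abs_def] by simp
qed

lemma ew_uminus: "ew z (-\<alpha>) (-\<beta>) x = - ew z \<alpha> \<beta> x"
  by (simp add: ew_def)

lemma ew_scale: "ew z (c * \<alpha>) (c * \<beta>) x = c * ew z \<alpha> \<beta> x"
  by (simp add: ew_def algebra_simps)

lemma ew_diff: "ew z (\<alpha> - \<alpha>') (\<beta> - \<beta>') x = ew z \<alpha> \<beta> x - ew z \<alpha>' \<beta>' x"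
  by (simp add: ew_def algebra_simps)

lemma ew_cnj: "cnj (ew z \<alpha> \<beta> x) = ew (cnj z) (cnj \<beta>) (cnj \<alpha>) x"
  by (simp add: ew_def exp_cnj)

lemma ew_mult_freq: "ew (z * of_real r) \<alpha> \<beta> x = ew z \<alpha> \<beta> (r * x)"
  by (simp add: ew_def algebra_simps)

lemma continuous_on_ew [continuous_intros]: 
  "continuous_on S f \<Longrightarrow> continuous_on S g \<Longrightarrow> continuous_on S h \<Longrightarrow> continuous_on S k \<Longrightarrow>
    continuous_on S (\<lambda>x. ew (f x) (g x) (h x) (k x))"
  unfolding ew_def by (intro continuous_intros)

lemma isCont_ew [continuous_intros]:
  "isCont f t \<Longrightarrow> isCont g t \<Longrightarrow> isCont h t \<Longrightarrow> isCont k t \<Longrightarrow>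
    isCont (\<lambda>x. ew (f x) (g x) (h x) (k x)) t"
  unfolding ew_def by (intro continuous_intros)

text \<open>The vertex conditions for the waves \<open>ew z\<close>, with the common factor
  \<open>\<i> * z\<close> of all derivatives divided out. For nonzero \<open>z\<close> they are
  equivalent to \<open>vertex_conds\<close> (\<open>vertex_conds_bc\<close>).\<close>

definition bc :: "qgraph \<Rightarrow> (nat \<Rightarrow> real) \<Rightarrow> complex \<Rightarrow> (nat \<Rightarrow> complex) \<Rightarrow> (nat \<Rightarrow> complex) \<Rightarrow> bool" where
  "bc G L z \<alpha> \<beta> \<longleftrightarrow> cont_bd G (\<lambda>m. \<alpha> m + \<beta> m) (\<lambda>m. ew z (\<alpha> m) (\<beta> m) (L m)) \<and>
     kirch_bd G (\<lambda>m. \<alpha> m - \<beta> m) (\<lambda>m. ew z (\<alpha> m) (- \<beta> m) (L m))"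

text \<open>The coefficient of \<open>e\<^sup>i\<^sup>z\<^sup>x\<close> on an edge, the coefficient of \<open>e\<^sup>-\<^sup>i\<^sup>z\<^sup>x\<close> on a
  finite edge, and the value at a vertex; outgoing functions have no further unknowns.  The same
  type indexes the equations: matching at the initial and terminal vertex of an edge, and the
  Kirchhoff condition.\<close>

datatype ix = IA nat | IB nat | IV nat

text \<open>An isolated vertex would contribute a zero row and a zero column and make the
  determinant vanish identically; its own conditions are trivial.\<close>

definition used_vertices :: "qgraph \<Rightarrow> nat set" where
  "used_vertices G = src G ` edges G \<union> tgt G ` fin_edges G"

definition ixs :: "qgraph \<Rightarrow> ix set" where
  "ixs G = IA ` edges G \<union> IB ` fin_edges G \<union> IV ` used_vertices G"

lemma finite_used_vertices [simp]: "finite (used_vertices G)"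
  by (simp add: used_vertices_def)

lemma finite_ixs [simp]: "finite (ixs G)"
  by (simp add: ixs_def)

lemma ixs_simps [simp]:
  "IA m \<in> ixs G \<longleftrightarrow> m \<in> edges G" "IB m \<in> ixs G \<longleftrightarrow> m \<in> fin_edges G" "IV v \<in> ixs G \<longleftrightarrow> v \<in> used_vertices G"
  by (auto simp: ixs_def)

lemma sum_ixs:
  "(\<Sum>j\<in>ixs G. f j) = (\<Sum>m\<in>edges G. f (IA m)) + (\<Sum>m\<in>fin_edges G. f (IB m)) + (\<Sum>v\<in>used_vertices G. f (IV v))"
proof -
  have "(\<Sum>j\<in>ixs G. f j) = (\<Sum>j\<in>IA ` edges G. f j) + (\<Sum>j\<in>IB ` fin_edges G. f j) + (\<Sum>j\<in>IV ` used_vertices G. f j)"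
    unfolding ixs_def by (subst sum.union_disjoint | force)+
  then show ?thesis by (simp add: sum.reindex inj_on_def)
qed

text \<open>A row \<open>IV v\<close> is the sum over terminal ends minus the sum over initial ends.
  The test \<open>n \<in> fin_edges G\<close> guards against the arbitrary values of
  \<open>tgt\<close> on leads; \<open>IB\<close> columns only exist for finite edges.\<close>

fun gm :: "qgraph \<Rightarrow> (nat \<Rightarrow> real) \<Rightarrow> complex \<Rightarrow> ix \<Rightarrow> ix \<Rightarrow> complex" where
  "gm G L z (IA m) (IA n) = (if n = m then 1 else 0)"
| "gm G L z (IA m) (IB n) = (if n = m then 1 else 0)"
| "gm G L z (IA m) (IV v) = (if v = src G m then -1 else 0)"
| "gm G L z (IB m) (IA n) = (if n = m then exp (\<i> * z * of_real (L m)) else 0)"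
| "gm G L z (IB m) (IB n) = (if n = m then exp (- (\<i> * z * of_real (L m))) else 0)"
| "gm G L z (IB m) (IV v) = (if v = tgt G m then -1 else 0)"
| "gm G L z (IV v) (IA n) = (if n \<in> fin_edges G \<and> tgt G n = v then exp (\<i> * z * of_real (L n)) else 0)
     + (if src G n = v then -1 else 0)"
| "gm G L z (IV v) (IB n) = (if tgt G n = v then - exp (- (\<i> * z * of_real (L n))) else 0)
     + (if src G n = v then 1 else 0)"
| "gm G L z (IV v) (IV v') = 0"

lemma if_mult_0: "(if P then a else 0) * b = (if P then a * b else 0)" for a b :: complex
  by simp

lemma gm_sum_IA:
  assumes "m \<in> edges G"
  shows "(\<Sum>j\<in>ixs G. gm G L z (IA m) j * X j)
    = X (IA m) + (if m \<in> fin_edges G then X (IB m) else 0) - X (IV (src G m))"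
  using assms by (simp add: sum_ixs if_mult_0 sum.delta used_vertices_def)

lemma gm_sum_IB:
  assumes "m \<in> fin_edges G"
  shows "(\<Sum>j\<in>ixs G. gm G L z (IB m) j * X j) = ew z (X (IA m)) (X (IB m)) (L m) - X (IV (tgt G m))"
  using assms fin_edges_subset[OF assms]
  by (simp add: sum_ixs if_mult_0 sum.delta used_vertices_def) (simp add: ew_def algebra_simps)

lemma gm_sum_IV:
  "(\<Sum>j\<in>ixs G. gm G L z (IV v) j * X j)
    = (\<Sum>m | m \<in> fin_edges G \<and> tgt G m = v. ew z (X (IA m)) (- X (IB m)) (L m))
      - (\<Sum>m | m \<in> edges G \<and> src G m = v. X (IA m) - (if m \<in> fin_edges G then X (IB m) else 0))"
proof -
  have fe: "edges G \<inter> {m. m \<in> fin_edges G \<and> P m} = {m. m \<in> fin_edges G \<and> P m}" for P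
    using fin_edges_subset by auto
  have fe': "fin_edges G \<inter> {m. P m} = {m. m \<in> fin_edges G \<and> P m}" for P by auto
  have fe'': "edges G \<inter> {m. P m} = {m. m \<in> edges G \<and> P m}" for P by auto
  have A: "(\<Sum>m\<in>edges G. gm G L z (IV v) (IA m) * X (IA m)) =
     (\<Sum>m | m \<in> fin_edges G \<and> tgt G m = v. exp (\<i> * z * of_real (L m)) * X (IA m)) -
     (\<Sum>m | m \<in> edges G \<and> src G m = v. X (IA m))"
    by (simp add: distrib_right sum.distrib if_mult_0 sum.If_cases fe fe'' sum_negf)
  have B: "(\<Sum>m\<in>fin_edges G. gm G L z (IV v) (IB m) * X (IB m)) =
     (\<Sum>m | m \<in> fin_edges G \<and> tgt G m = v. - (exp (- (\<i> * z * of_real (L m))) * X (IB m))) +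
     (\<Sum>m | m \<in> fin_edges G \<and> src G m = v. X (IB m))"
    by (simp add: distrib_right sum.distrib if_mult_0 sum.If_cases fe')
  have C: "(\<Sum>m | m \<in> edges G \<and> src G m = v. if m \<in> fin_edges G then X (IB m) else 0)
    = (\<Sum>m | m \<in> fin_edges G \<and> src G m = v. X (IB m))"
    by (rule sum.mono_neutral_cong_right) (auto dest: fin_edges_subset)
  show ?thesis
    unfolding sum_ixs A B sum_subtractf C
    by (simp add: ew_def sum.distrib sum_subtractf sum_negf algebra_simps)
qed

text \<open>It is applied to \<alpha> as well: if both coefficient families satisfy it, the function
  vanishes on the leads.\<close>

definition outgoing :: "qgraph \<Rightarrow> (nat \<Rightarrow> complex) \<Rightarrow> bool" where
  "outgoing G \<beta> \<longleftrightarrow> (\<forall>m\<in>{1..nL G}. \<beta> m = 0)"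

definition cB :: "qgraph \<Rightarrow> (ix \<Rightarrow> complex) \<Rightarrow> nat \<Rightarrow> complex" where
  "cB G X m = (if m \<in> fin_edges G then X (IB m) else 0)"

lemma outgoing_cB [simp]: "outgoing G (cB G X)"
  by (auto simp: outgoing_def cB_def fin_edges_def)

text \<open>The inhomogeneity for which an outgoing wave compensates given boundary data:
  \<open>d0\<close>, \<open>dL\<close> are the values at the two ends, \<open>e0\<close>,
  \<open>eL\<close> the derivatives divided by \<open>\<i> * z\<close>.\<close>

definition bd_rhs :: "qgraph \<Rightarrow> (nat \<Rightarrow> complex) \<Rightarrow> (nat \<Rightarrow> complex) \<Rightarrow> (nat \<Rightarrow> complex) \<Rightarrow> (nat \<Rightarrow> complex) \<Rightarrow> ix \<Rightarrow> complex" where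
  "bd_rhs G d0 dL e0 eL i = (case i of IA m \<Rightarrow> - d0 m | IB m \<Rightarrow> - dL m
     | IV v \<Rightarrow> (\<Sum>m | m \<in> edges G \<and> src G m = v. e0 m) - (\<Sum>m | m \<in> fin_edges G \<and> tgt G m = v. eL m))"

lemma add_eq_if_diff_eq_uminus: "a - c = - d \<Longrightarrow> d + a = c" for a :: complex
  by (simp add: diff_eq_eq)

lemma gm_solution_bd:
  assumes "\<And>i. i \<in> ixs G \<Longrightarrow> (\<Sum>j\<in>ixs G. gm G L z i j * X j) = bd_rhs G d0 dL e0 eL i"
  shows "cont_bd G (\<lambda>m. d0 m + (X (IA m) + cB G X m)) (\<lambda>m. dL m + ew z (X (IA m)) (cB G X m) (L m))"
    and "kirch_bd G (\<lambda>m. e0 m + (X (IA m) - cB G X m)) (\<lambda>m. eL m + ew z (X (IA m)) (- cB G X m) (L m))"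
proof -
  have "d0 m + (X (IA m) + cB G X m) = X (IV (src G m))" if "m \<in> edges G" for m
  proof -
    have "X (IA m) + cB G X m - X (IV (src G m)) = - d0 m"
      using assms[of "IA m"] gm_sum_IA[OF that, of L z X] that by (simp add: cB_def bd_rhs_def)
    then show ?thesis by (rule add_eq_if_diff_eq_uminus)
  qed
  moreover have "dL m + ew z (X (IA m)) (cB G X m) (L m) = X (IV (tgt G m))" if "m \<in> fin_edges G" for m
  proof -
    have "ew z (X (IA m)) (cB G X m) (L m) - X (IV (tgt G m)) = - dL m"
      using assms[of "IB m"] gm_sum_IB[OF that, of L z X] that by (simp add: cB_def bd_rhs_def)
    then show ?thesis by (rule add_eq_if_diff_eq_uminus)
  qed
  ultimately show "cont_bd G (\<lambda>m. d0 m + (X (IA m) + cB G X m)) (\<lambda>m. dL m + ew z (X (IA m)) (cB G X m) (L m))"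
    unfolding cont_bd_def by (intro exI[of _ "\<lambda>v. X (IV v)"]) auto
  show "kirch_bd G (\<lambda>m. e0 m + (X (IA m) - cB G X m)) (\<lambda>m. eL m + ew z (X (IA m)) (- cB G X m) (L m))"
    unfolding kirch_bd_def
  proof (intro allI impI)
    fix v assume "v < nV G"
    show "(\<Sum>m | m \<in> fin_edges G \<and> tgt G m = v. eL m + ew z (X (IA m)) (- cB G X m) (L m))
        = (\<Sum>m | m \<in> edges G \<and> src G m = v. e0 m + (X (IA m) - cB G X m))"
    proof (cases "v \<in> used_vertices G")
      case True
      then have "(\<Sum>m | m \<in> fin_edges G \<and> tgt G m = v. ew z (X (IA m)) (- cB G X m) (L m))
        - (\<Sum>m | m \<in> edges G \<and> src G m = v. X (IA m) - cB G X m)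
        = (\<Sum>m | m \<in> edges G \<and> src G m = v. e0 m) - (\<Sum>m | m \<in> fin_edges G \<and> tgt G m = v. eL m)"
        using assms[of "IV v"] gm_sum_IV[of G L z v X] by (simp add: cB_def bd_rhs_def)
      then show ?thesis by (simp only: sum.distrib) (simp add: algebra_simps)
    next
      case False
      then have "{m. m \<in> fin_edges G \<and> tgt G m = v} = {}" "{m. m \<in> edges G \<and> src G m = v} = {}"
        by (auto simp: used_vertices_def)
      then show ?thesis by (simp only: sum.empty)
    qed
  qed
qed

lemma bd_gm_solution:
  assumes wf: "wf_qgraph G L" and out: "outgoing G \<beta>"
    and c: "cont_bd G (\<lambda>m. d0 m + (\<alpha> m + \<beta> m)) (\<lambda>m. dL m + ew z (\<alpha> m) (\<beta> m) (L m))"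
    and k: "kirch_bd G (\<lambda>m. e0 m + (\<alpha> m - \<beta> m)) (\<lambda>m. eL m + ew z (\<alpha> m) (- \<beta> m) (L m))"
  shows "\<exists>X. (\<forall>i\<in>ixs G. (\<Sum>j\<in>ixs G. gm G L z i j * X j) = bd_rhs G d0 dL e0 eL i) \<and>
    (\<forall>m. X (IA m) = \<alpha> m) \<and> (\<forall>m. X (IB m) = \<beta> m)"
proof -
  obtain U where U: "\<And>m. m \<in> edges G \<Longrightarrow> d0 m + (\<alpha> m + \<beta> m) = U (src G m)"
     "\<And>m. m \<in> fin_edges G \<Longrightarrow> dL m + ew z (\<alpha> m) (\<beta> m) (L m) = U (tgt G m)"
    using c by (auto simp: cont_bd_def)
  define X where "X i = (case i of IA m \<Rightarrow> \<alpha> m | IB m \<Rightarrow> \<beta> m | IV v \<Rightarrow> U v)" for i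
  have X: "X (IA m) = \<alpha> m" "X (IB m) = \<beta> m" "X (IV m) = U m" for m by (simp_all add: X_def)
  have \<beta>: "\<beta> m = 0" if "m \<in> edges G" "m \<notin> fin_edges G" for m
    using that out by (auto simp: outgoing_def edges_split)
  have "(\<Sum>j\<in>ixs G. gm G L z i j * X j) = bd_rhs G d0 dL e0 eL i" if i: "i \<in> ixs G" for i
  proof (cases i)
    case (IA m)
    then have m: "m \<in> edges G" using i by simp
    show ?thesis unfolding IA gm_sum_IA[OF m] X using U(1)[OF m] \<beta>[OF m]
      by (cases "m \<in> fin_edges G") (simp_all add: bd_rhs_def flip: U(1)[OF m])
  next
    case (IB m)
    then have m: "m \<in> fin_edges G" using i by simp
    show ?thesis unfolding IB gm_sum_IB[OF m] X by (simp add: bd_rhs_def flip: U(2)[OF m])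
  next
    case (IV v)
    then have "v < nV G" using i wf_qgraphD[OF wf] by (auto simp: used_vertices_def)
    then have "(\<Sum>m | m \<in> fin_edges G \<and> tgt G m = v. eL m + ew z (\<alpha> m) (- \<beta> m) (L m))
        = (\<Sum>m | m \<in> edges G \<and> src G m = v. e0 m + (\<alpha> m - \<beta> m))"
      using k by (simp add: kirch_bd_def)
    moreover have "(\<Sum>m | m \<in> edges G \<and> src G m = v. \<alpha> m - (if m \<in> fin_edges G then \<beta> m else 0))
      = (\<Sum>m | m \<in> edges G \<and> src G m = v. \<alpha> m - \<beta> m)"
      by (intro sum.cong) (auto simp: \<beta>)
    ultimately show ?thesis unfolding IV gm_sum_IV X
      by (simp only: sum.distrib) (simp add: bd_rhs_def algebra_simps)
  qed
  then show ?thesis using X by blast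
qed

lemma bd_rhs_0: "bd_rhs G (\<lambda>_. 0) (\<lambda>_. 0) (\<lambda>_. 0) (\<lambda>_. 0) i = 0"
  by (auto simp: bd_rhs_def split: ix.split)

lemma gm_kernel_bc:
  assumes "\<And>i. i \<in> ixs G \<Longrightarrow> (\<Sum>j\<in>ixs G. gm G L z i j * X j) = 0"
  shows "bc G L z (\<lambda>m. X (IA m)) (cB G X)"
  using gm_solution_bd[of G L z X "\<lambda>_. 0" "\<lambda>_. 0" "\<lambda>_. 0" "\<lambda>_. 0"] assms by (simp add: bd_rhs_0 bc_def)

lemma bc_gm_kernel:
  assumes "wf_qgraph G L" "bc G L z \<alpha> \<beta>" "outgoing G \<beta>"
  shows "\<exists>X. (\<forall>i\<in>ixs G. (\<Sum>j\<in>ixs G. gm G L z i j * X j) = 0) \<and>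
    (\<forall>m. X (IA m) = \<alpha> m) \<and> (\<forall>m. X (IB m) = \<beta> m)"
  using bd_gm_solution[of G L \<beta> "\<lambda>_. 0" \<alpha> "\<lambda>_. 0" z "\<lambda>_. 0" "\<lambda>_. 0"] assms by (simp add: bd_rhs_0 bc_def)

text \<open>Every used vertex is an end of some edge, so the matching rows determine its value from
  the amplitudes. Hence nontriviality of a kernel vector can be tested on the amplitudes
  alone.\<close>

lemma gm_kernel_zero:
  assumes X: "\<And>i. i \<in> ixs G \<Longrightarrow> (\<Sum>j\<in>ixs G. gm G L z i j * X j) = 0"
    and A0: "\<And>m. m \<in> edges G \<Longrightarrow> X (IA m) = 0" and B0: "\<And>m. m \<in> fin_edges G \<Longrightarrow> X (IB m) = 0"
    and i: "i \<in> ixs G"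
  shows "X i = 0"
proof -
  have "X (IV v) = 0" if v: "v \<in> used_vertices G" for v
  proof -
    consider m where "m \<in> edges G" "v = src G m" | m where "m \<in> fin_edges G" "v = tgt G m"
      using v by (auto simp: used_vertices_def)
    then show ?thesis
    proof cases
      case 1
      then show ?thesis using X[of "IA m"] gm_sum_IA[of m G L z X] A0[of m] B0[of m]
        by (simp split: if_splits)
    next
      case 2
      then show ?thesis using X[of "IB m"] gm_sum_IB[of m G L z X] A0[of m] B0[of m]
          fin_edges_subset[of m G] by simp
    qed
  qed
  then show ?thesis using i A0 B0 by (cases i) auto
qed

lemma gm_det_eq_0_iff:
  assumes wf: "wf_qgraph G L"
  shows "ddet (ixs G) (gm G L z) = 0 \<longleftrightarrow>
    (\<exists>\<alpha> \<beta>. bc G L z \<alpha> \<beta> \<and> outgoing G \<beta> \<and> (\<exists>m\<in>edges G. \<alpha> m \<noteq> 0 \<or> \<beta> m \<noteq> 0))"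
  unfolding ddet_eq_0_iff[OF finite_ixs]
proof
  assume "\<exists>X. (\<exists>i\<in>ixs G. X i \<noteq> 0) \<and> (\<forall>i\<in>ixs G. (\<Sum>j\<in>ixs G. gm G L z i j * X j) = 0)"
  then obtain X i where X: "i \<in> ixs G" "X i \<noteq> 0" "\<And>i. i \<in> ixs G \<Longrightarrow> (\<Sum>j\<in>ixs G. gm G L z i j * X j) = 0"
    by blast
  have "\<exists>m\<in>edges G. X (IA m) \<noteq> 0 \<or> cB G X m \<noteq> 0"
  proof (rule ccontr)
    assume "\<not> ?thesis"
    then have 0: "X (IA m) = 0" "cB G X m = 0" if "m \<in> edges G" for m using that by auto
    have B0: "X (IB m) = 0" if "m \<in> fin_edges G" for m
      using 0(2)[OF fin_edges_subset[OF that]] that by (simp add: cB_def)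
    show False using gm_kernel_zero[OF X(3) 0(1) B0 X(1)] X(2) by simp
  qed
  then show "\<exists>\<alpha> \<beta>. bc G L z \<alpha> \<beta> \<and> outgoing G \<beta> \<and> (\<exists>m\<in>edges G. \<alpha> m \<noteq> 0 \<or> \<beta> m \<noteq> 0)"
    using gm_kernel_bc[OF X(3)] outgoing_cB by blast
next
  assume "\<exists>\<alpha> \<beta>. bc G L z \<alpha> \<beta> \<and> outgoing G \<beta> \<and> (\<exists>m\<in>edges G. \<alpha> m \<noteq> 0 \<or> \<beta> m \<noteq> 0)"
  then obtain \<alpha> \<beta> m where *: "bc G L z \<alpha> \<beta>" "outgoing G \<beta>" "m \<in> edges G" "\<alpha> m \<noteq> 0 \<or> \<beta> m \<noteq> 0" by blast
  obtain X where X: "\<And>i. i \<in> ixs G \<Longrightarrow> (\<Sum>j\<in>ixs G. gm G L z i j * X j) = 0"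
    "\<And>m. X (IA m) = \<alpha> m" "\<And>m. X (IB m) = \<beta> m"
    using bc_gm_kernel[OF wf *(1,2)] by blast
  have "\<exists>i\<in>ixs G. X i \<noteq> 0"
  proof (cases "\<alpha> m = 0")
    case True
    then have "m \<in> fin_edges G" using * by (auto simp: outgoing_def edges_split)
    then show ?thesis using True * X(3)[of m] by (intro bexI[of _ "IB m"]) auto
  next
    case False
    then show ?thesis using * X(2)[of m] by (intro bexI[of _ "IA m"]) auto
  qed
  then show "\<exists>X. (\<exists>i\<in>ixs G. X i \<noteq> 0) \<and> (\<forall>i\<in>ixs G. (\<Sum>j\<in>ixs G. gm G L z i j * X j) = 0)"
    using X(1) by blast
qed

section \<open>Solutions on an edge\<close>

text \<open>\<open>(v' + \<i> * z * v) * exp (- \<i> * z * x)\<close> and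
  \<open>(v' - \<i> * z * v) * exp (\<i> * z * x)\<close> have zero derivative. Their constant
  values determine \<open>v\<close> and \<open>v'\<close> because \<open>z\<close> is
  nonzero.\<close>

lemma ode_exponential_form:
  fixes v v' :: "real \<Rightarrow> complex"
  assumes "convex S" and z: "z \<noteq> 0"
    and v: "\<And>x. x \<in> S \<Longrightarrow> (v has_vector_derivative v' x) (at x within S)"
    and v': "\<And>x. x \<in> S \<Longrightarrow> (v' has_vector_derivative - (z\<^sup>2 * v x)) (at x within S)"
  obtains \<alpha> \<beta> where "\<And>x. x \<in> S \<Longrightarrow> v x = ew z \<alpha> \<beta> x" "\<And>x. x \<in> S \<Longrightarrow> v' x = \<i> * z * ew z \<alpha> (-\<beta>) x"
proof -
  have ex: "((\<lambda>x. exp (c * of_real x)) has_vector_derivative c * exp (c * of_real x)) (at x within S)" for c :: complex and x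
    by (rule has_vector_derivative_real_field) (auto intro!: derivative_eq_intros)
  have "((\<lambda>x. (v' x + \<i> * z * v x) * exp (- (\<i> * z) * of_real x)) has_vector_derivative 0) (at x within S)"
    if "x \<in> S" for x
    by (rule has_vector_derivative_eq_rhs, rule has_vector_derivative_mult
        [OF has_vector_derivative_add[OF v'[OF that] has_vector_derivative_mult_right[OF v[OF that]]] ex])
       (simp add: algebra_simps power2_eq_square)
  from has_vector_derivative_zero_constant[OF \<open>convex S\<close> this] obtain c
    where c: "\<And>x. x \<in> S \<Longrightarrow> (v' x + \<i> * z * v x) * exp (- (\<i> * z) * of_real x) = c" by blast
  have "((\<lambda>x. (v' x + - (\<i> * z) * v x) * exp (\<i> * z * of_real x)) has_vector_derivative 0) (at x within S)"
    if "x \<in> S" for x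
    by (rule has_vector_derivative_eq_rhs, rule has_vector_derivative_mult
        [OF has_vector_derivative_add[OF v'[OF that] has_vector_derivative_mult_right[OF v[OF that]]] ex])
       (simp add: algebra_simps power2_eq_square)
  from has_vector_derivative_zero_constant[OF \<open>convex S\<close> this] obtain d
    where d: "\<And>x. x \<in> S \<Longrightarrow> (v' x + - (\<i> * z) * v x) * exp (\<i> * z * of_real x) = d" by blast
  have cancel: "exp (- (\<i> * z * of_real x)) * exp (\<i> * z * of_real x) = 1" for x :: real
    by (simp flip: exp_add)
  show ?thesis
  proof (rule that[of "c / (2 * \<i> * z)" "- d / (2 * \<i> * z)"])
    fix x assume x: "x \<in> S"
    have c': "c * exp (\<i> * z * of_real x) = v' x + \<i> * z * v x"
      unfolding c[OF x, symmetric] using cancel[of x] by (simp add: mult.assoc)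
    have d': "d * exp (- (\<i> * z * of_real x)) = v' x - \<i> * z * v x"
      unfolding d[OF x, symmetric] using cancel[of x] by (simp add: ac_simps)
    have "ew z (c / (2 * \<i> * z)) (- d / (2 * \<i> * z)) x =
      (c * exp (\<i> * z * of_real x) - d * exp (- (\<i> * z * of_real x))) / (2 * \<i> * z)"
      by (simp add: ew_def diff_divide_distrib)
    also have "\<dots> = v x" unfolding c' d' using z by (simp add: field_simps)
    finally show "v x = ew z (c / (2 * \<i> * z)) (- d / (2 * \<i> * z)) x" by simp
    have "\<i> * z * ew z (c / (2 * \<i> * z)) (- (- d / (2 * \<i> * z))) x =
      (c * exp (\<i> * z * of_real x) + d * exp (- (\<i> * z * of_real x))) / 2"
      using z by (simp add: ew_def field_simps)
    also have "\<dots> = v' x" unfolding c' d' by simp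
    finally show "v' x = \<i> * z * ew z (c / (2 * \<i> * z)) (- (- d / (2 * \<i> * z))) x" by simp
  qed
qed

lemma at_within_Ici_eq_Icc: "0 \<le> x \<Longrightarrow> x < b \<Longrightarrow> at x within {0..} = at x within {0..b::real}"
  by (rule at_within_nhd[of _ "{..<b}"]) auto

text \<open>Elliptic regularity in one dimension: the weak second derivative agrees almost
  everywhere with a continuous function, so its indefinite integral \<open>f'\<close> is
  differentiable in the classical sense.\<close>

lemma H2_on_second_derivative:
  fixes f g h :: "real \<Rightarrow> complex"
  assumes I: "I = {0..} \<or> I = {0..b}"
    and H2: "H2_on I f g" and AE: "AE x in lborel. x \<in> I \<longrightarrow> - g x - \<kappa> * f x = h x"
    and h: "continuous_on I h"
  obtains f' where "\<And>x. x \<in> I \<Longrightarrow> (f has_vector_derivative f' x) (at x within I)"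
    "\<And>x. x \<in> I \<Longrightarrow> (f' has_vector_derivative (- (\<kappa> * f x) - h x)) (at x within I)"
    "L2_on I f" "L2_on I f'"
proof -
  obtain f' where f': "\<And>x. x \<in> I \<Longrightarrow> (f has_vector_derivative f' x) (at x within I)"
    "\<And>x. x \<in> I \<Longrightarrow> f' x = f' 0 + (LINT y:{0..x}|lborel. g y)" "L2_on I f" "L2_on I f'" "L2_on I g"
    using H2 unfolding H2_on_def by blast
  define k where "k x = - (\<kappa> * f x) - h x" for x
  have "continuous_on I f"
    using f'(1) by (meson continuous_on_eq_continuous_within has_vector_derivative_continuous)
  then have k: "continuous_on I k" unfolding k_def using h by (intro continuous_intros)
  have int: "f' x = f' 0 + integral {0..x} k" if x: "x \<in> I" for x
  proof -
    have sub: "{0..x} \<subseteq> I" using x I by auto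
    have ck: "continuous_on {0..x} k" using k sub continuous_on_subset by blast
    have "(LINT y:{0..x}|lborel. g y) = (LINT y:{0..x}|lborel. k y)"
      unfolding set_lebesgue_integral_def
    proof (rule integral_cong_AE)
      have "(\<lambda>y. indicator I y *\<^sub>R g y) \<in> borel_measurable lborel"
        using f'(5) unfolding L2_on_def set_borel_measurable_def by blast
      then have "(\<lambda>y. indicator {0..x} y *\<^sub>R (indicator I y *\<^sub>R g y)) \<in> borel_measurable lborel"
        by (rule borel_measurable_scaleR[rotated]) simp
      also have "(\<lambda>y. indicator {0..x} y *\<^sub>R (indicator I y *\<^sub>R g y)) = (\<lambda>y. indicator {0..x} y *\<^sub>R g y)"
        using sub by (intro ext) (auto simp: indicator_def)
      finally show "(\<lambda>y. indicator {0..x} y *\<^sub>R g y) \<in> borel_measurable lborel" .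
      show "(\<lambda>y. indicator {0..x} y *\<^sub>R k y) \<in> borel_measurable lborel"
        using borel_integrable_atLeastAtMost'[OF ck] by (auto simp: set_integrable_def)
      show "AE y in lborel. indicator {0..x} y *\<^sub>R g y = indicator {0..x} y *\<^sub>R k y"
        using AE
      proof (rule AE_mp, intro AE_I2 impI)
        fix y assume *: "y \<in> I \<longrightarrow> - g y - \<kappa> * f y = h y"
        have "g y = k y" if "y \<in> {0..x}"
        proof -
          have "h y = - g y - \<kappa> * f y" using * sub that by auto
          then show ?thesis by (simp add: k_def)
        qed
        then show "indicator {0..x} y *\<^sub>R g y = indicator {0..x} y *\<^sub>R k y"
          by (cases "y \<in> {0..x}") auto
      qed
    qed
    also have "\<dots> = integral {0..x} k"
      by (rule set_borel_integral_eq_integral) (rule borel_integrable_atLeastAtMost'[OF ck])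
    finally show ?thesis using f'(2)[OF x] by simp
  qed
  have f'': "(f' has_vector_derivative k x) (at x within I)" if x: "x \<in> I" for x
  proof -
    obtain c where c: "x \<in> {0..c}" "{0..c} \<subseteq> I" "at x within I = at x within {0..c}"
    proof (cases "I = {0..}")
      case True
      then show ?thesis using x at_within_Ici_eq_Icc[of x "x + 1"] by (intro that[of "x + 1"]) auto
    next
      case False
      then show ?thesis using x I by (intro that[of b]) auto
    qed
    have "((\<lambda>x. f' 0 + integral {0..x} k) has_vector_derivative 0 + k x) (at x within {0..c})"
      by (intro has_vector_derivative_add has_vector_derivative_const
          integral_has_vector_derivative continuous_on_subset[OF k]) (use c in auto)
    then have *: "((\<lambda>x. f' 0 + integral {0..x} k) has_vector_derivative k x) (at x within I)"
      using c by simp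
    show ?thesis
      by (rule has_vector_derivative_transform[OF x _ *]) (use int in auto)
  qed
  show ?thesis by (rule that[OF f'(1) f''[unfolded k_def] f'(3,4)])
qed

text \<open>\<open>-d^2/dx^2 - z^2\<close> acts on waves of frequency \<nu> as multiplication by
  \<open>\<nu>^2 - z^2\<close>. Thus \<open>ew \<nu> P Q\<close> is a particular solution, and the
  remainder solves the homogeneous equation.\<close>

lemma edge_solution_form:
  assumes I: "I = {0..} \<or> I = {0..b}" and z: "z \<noteq> 0" and nz: "\<nu>\<^sup>2 \<noteq> z\<^sup>2"
    and H2: "H2_on I u g" and AE: "AE x in lborel. x \<in> I \<longrightarrow> - g x - z\<^sup>2 * u x = h x"
    and h: "\<And>x. x \<in> I \<Longrightarrow> h x = ew \<nu> p q x"
  defines "P \<equiv> p / (\<nu>\<^sup>2 - z\<^sup>2)" and "Q \<equiv> q / (\<nu>\<^sup>2 - z\<^sup>2)"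
  obtains \<alpha> \<beta> where "\<forall>x\<in>I. u x = ew \<nu> P Q x + ew z \<alpha> \<beta> x"
    "L2_on I u" "L2_on I (\<lambda>x. \<i> * \<nu> * ew \<nu> P (-Q) x + \<i> * z * ew z \<alpha> (-\<beta>) x)"
proof -
  have ch: "continuous_on I (ew \<nu> p q)" by (intro continuous_intros)
  have AE': "AE x in lborel. x \<in> I \<longrightarrow> - g x - z\<^sup>2 * u x = ew \<nu> p q x"
    using AE h by (auto elim!: eventually_mono)
  obtain u' where u': "\<And>x. x \<in> I \<Longrightarrow> (u has_vector_derivative u' x) (at x within I)"
    "\<And>x. x \<in> I \<Longrightarrow> (u' has_vector_derivative (- (z\<^sup>2 * u x) - ew \<nu> p q x)) (at x within I)"
    "L2_on I u" "L2_on I u'"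
    using H2_on_second_derivative[OF I H2 AE' ch] by metis
  define v where "v x = u x - ew \<nu> P Q x" for x
  define v' where "v' x = u' x - \<i> * \<nu> * ew \<nu> P (-Q) x" for x
  have PQ: "ew \<nu> p q x = (\<nu>\<^sup>2 - z\<^sup>2) * ew \<nu> P Q x" for x
    unfolding ew_scale[symmetric] using nz by (simp add: P_def Q_def)
  have cvx: "convex I" using I by auto
  have v1: "(v has_vector_derivative v' x) (at x within I)" if "x \<in> I" for x
    unfolding v_def[abs_def] v'_def by (intro derivative_intros u' that)
  have v2: "(v' has_vector_derivative - (z\<^sup>2 * v x)) (at x within I)" if "x \<in> I" for x
  proof -
    have "(v' has_vector_derivative (- (z\<^sup>2 * u x) - ew \<nu> p q x) - \<i> * \<nu> * (\<i> * \<nu> * ew \<nu> P (- (- Q)) x)) (at x within I)"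
      unfolding v'_def[abs_def] by (intro derivative_intros u' that)
    then show ?thesis
      by (rule has_vector_derivative_eq_rhs) (simp add: v_def PQ algebra_simps power2_eq_square)
  qed
  obtain \<alpha> \<beta> where ab: "\<And>x. x \<in> I \<Longrightarrow> v x = ew z \<alpha> \<beta> x" "\<And>x. x \<in> I \<Longrightarrow> v' x = \<i> * z * ew z \<alpha> (-\<beta>) x"
    using ode_exponential_form[OF cvx z v1 v2] by metis
  have e: "u' x = \<i> * \<nu> * ew \<nu> P (-Q) x + \<i> * z * ew z \<alpha> (-\<beta>) x" if "x \<in> I" for x
    using ab(2)[OF that] by (simp add: v'_def algebra_simps)
  have "L2_on I (\<lambda>x. \<i> * \<nu> * ew \<nu> P (-Q) x + \<i> * z * ew z \<alpha> (-\<beta>) x) \<longleftrightarrow> L2_on I u'"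
    unfolding L2_on_def set_borel_measurable_def set_integrable_def
    by (intro arg_cong2[of _ _ _ _ "(\<and>)"] arg_cong2[of _ _ _ _ "(\<in>)"] arg_cong2[of _ _ _ _ integrable] refl ext)
       (auto simp: indicator_def e)
  then show ?thesis
    using u'(3,4) ab(1) by (intro that[of \<alpha> \<beta>]) (auto simp: v_def algebra_simps)
qed

lemma L2_on_add_scaled:
  assumes f: "L2_on I f" and g: "L2_on I g" and I: "I \<in> sets lborel"
  shows "L2_on I (\<lambda>x. f x + c * g x)"
proof -
  have meas: "set_borel_measurable lborel I (\<lambda>x. f x + c * g x)"
  proof -
    have "(\<lambda>x. indicator I x *\<^sub>R f x + c * (indicator I x *\<^sub>R g x)) \<in> borel_measurable lborel"
      using f g unfolding L2_on_def set_borel_measurable_def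
      by (intro borel_measurable_add borel_measurable_times borel_measurable_const) blast+
    then show ?thesis by (simp add: set_borel_measurable_def scaleR_add_right)
  qed
  have "set_integrable lborel I (\<lambda>x. 2 * (cmod (f x))\<^sup>2 + 2 * (cmod c)\<^sup>2 * (cmod (g x))\<^sup>2)"
    using f g by (intro set_integral_add set_integrable_mult_right) (auto simp: L2_on_def)
  then have "set_integrable lborel I (\<lambda>x. (cmod (f x + c * g x))\<^sup>2)"
  proof (rule set_integrable_bound)
    have "(\<lambda>x. (cmod (indicator I x *\<^sub>R (f x + c * g x)))\<^sup>2) \<in> borel_measurable lborel"
      using meas unfolding set_borel_measurable_def
      by (rule measurable_compose[where N = borel and g = "\<lambda>y. (cmod y)\<^sup>2"]) simp
    also have "(\<lambda>x. (cmod (indicator I x *\<^sub>R (f x + c * g x)))\<^sup>2) = (\<lambda>x. indicator I x *\<^sub>R (cmod (f x + c * g x))\<^sup>2)"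
      by (auto simp: indicator_def)
    finally show "set_borel_measurable lborel I (\<lambda>x. (cmod (f x + c * g x))\<^sup>2)"
      by (simp add: set_borel_measurable_def)
    show "AE x in lborel. x \<in> I \<longrightarrow> norm ((cmod (f x + c * g x))\<^sup>2) \<le> norm (2 * (cmod (f x))\<^sup>2 + 2 * (cmod c)\<^sup>2 * (cmod (g x))\<^sup>2)"
    proof (intro AE_I2 impI)
      fix x
      have "(cmod (f x + c * g x))\<^sup>2 \<le> (cmod (f x) + cmod c * cmod (g x))\<^sup>2"
        using norm_triangle_ineq[of "f x" "c * g x"] by (intro power_mono) (auto simp: norm_mult)
      also have "\<dots> \<le> 2 * (cmod (f x))\<^sup>2 + 2 * (cmod c * cmod (g x))\<^sup>2"
        using sum_squares_bound[of "cmod (f x)" "cmod c * cmod (g x)"]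
        by (simp add: power2_eq_square algebra_simps)
      finally show "norm ((cmod (f x + c * g x))\<^sup>2) \<le> norm (2 * (cmod (f x))\<^sup>2 + 2 * (cmod c)\<^sup>2 * (cmod (g x))\<^sup>2)"
        by (simp add: power_mult_distrib)
    qed
  qed
  with meas show ?thesis by (simp add: L2_on_def)
qed

text \<open>The integral of the squared modulus over an initial interval of length \<open>n\<close>
  is at least \<open>n * c^2\<close>, for every \<open>n\<close>.\<close>

lemma L2_on_half_line_bounded_below:
  assumes h: "L2_on {0..} h" and c: "\<And>x. 0 \<le> x \<Longrightarrow> c \<le> cmod (h x)" and "0 \<le> c"
  shows "c = 0"
proof (rule ccontr)
  assume "c \<noteq> 0"
  then have c0: "0 < c\<^sup>2" by simp
  have int: "set_integrable lborel {0..} (\<lambda>x. (cmod (h x))\<^sup>2)" using h by (simp add: L2_on_def)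
  define B where "B = (LINT x:{0..}|lborel. (cmod (h x))\<^sup>2)"
  obtain n :: nat where n: "B < real n * c\<^sup>2" using reals_Archimedean3[OF c0] by blast
  have "real n * c\<^sup>2 = (LINT x:{0..real n}|lborel. c\<^sup>2)"
    by (simp add: set_lebesgue_integral_def)
  also have "\<dots> = (LINT x:{0..}|lborel. indicator {0..real n} x * c\<^sup>2)"
    unfolding set_lebesgue_integral_def
    by (intro Bochner_Integration.integral_cong) (auto simp: indicator_def)
  also have "\<dots> \<le> B" unfolding B_def
  proof (rule set_integral_mono[OF _ int])
    have "integrable lborel (\<lambda>x. indicator {0..real n} x *\<^sub>R c\<^sup>2)"
      by (intro integrable_scaleR_left integrable_real_indicator) auto
    then show "set_integrable lborel {0..} (\<lambda>x. indicator {0..real n} x * c\<^sup>2)"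
      unfolding set_integrable_def
      by (rule Bochner_Integration.integrable_cong[THEN iffD1, rotated 2]) (auto simp: indicator_def)
    fix x :: real assume "x \<in> {0..}"
    then have "c\<^sup>2 \<le> (cmod (h x))\<^sup>2" using c[of x] \<open>0 \<le> c\<close> by (intro power_mono) auto
    then show "indicator {0..real n} x * c\<^sup>2 \<le> (cmod (h x))\<^sup>2" by (auto simp: indicator_def)
  qed
  finally show False using n by simp
qed

text \<open>The combinations \<open>u' - \<i> * z * u\<close> and \<open>u' + \<i> * z * u\<close>
  isolate one exponential each and are square integrable. For \<open>Im z \<ge> 0\<close> the
  incoming exponential has modulus at least 1 on the half-line; on the real axis the outgoing one
  has modulus 1 too.\<close>

lemma L2_lead_coefficients:
  assumes z: "z \<noteq> 0" "0 \<le> Im z"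
    and u: "L2_on {0..} (ew z \<alpha> \<beta>)" "L2_on {0..} (\<lambda>x. \<i> * z * ew z \<alpha> (-\<beta>) x)"
  shows "\<beta> = 0" "Im z = 0 \<Longrightarrow> \<alpha> = 0"
proof -
  have nrm: "cmod (exp (\<i> * z * of_real x)) = exp (- (Im z * x))" "cmod (exp (- (\<i> * z * of_real x))) = exp (Im z * x)" for x
    by (simp_all add: norm_exp_eq_Re)
  have "cmod (2 * \<i> * z * \<beta>) = 0"
  proof (rule L2_on_half_line_bounded_below)
    show "L2_on {0..} (\<lambda>x. \<i> * z * ew z \<alpha> (-\<beta>) x + (- \<i> * z) * ew z \<alpha> \<beta> x)"
      by (rule L2_on_add_scaled[OF u(2,1)]) simp
    fix x :: real assume "0 \<le> x"
    have "\<i> * z * ew z \<alpha> (-\<beta>) x + (- \<i> * z) * ew z \<alpha> \<beta> x = - (2 * \<i> * z * \<beta>) * exp (- (\<i> * z * of_real x))"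
      by (simp add: ew_def algebra_simps)
    moreover have "1 \<le> exp (Im z * x)" using z \<open>0 \<le> x\<close> by simp
    moreover from this have "cmod (2 * \<i> * z * \<beta>) * 1 \<le> cmod (2 * \<i> * z * \<beta>) * exp (Im z * x)"
      by (intro mult_left_mono) auto
    ultimately show "cmod (2 * \<i> * z * \<beta>) \<le> cmod (\<i> * z * ew z \<alpha> (-\<beta>) x + (- \<i> * z) * ew z \<alpha> \<beta> x)"
      by (simp only: norm_mult norm_minus_cancel nrm mult_1_right)
  qed simp
  then show "\<beta> = 0" using z by simp
  assume Im: "Im z = 0"
  have "cmod (2 * \<i> * z * \<alpha>) = 0"
  proof (rule L2_on_half_line_bounded_below)
    show "L2_on {0..} (\<lambda>x. \<i> * z * ew z \<alpha> (-\<beta>) x + (\<i> * z) * ew z \<alpha> \<beta> x)"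
      by (rule L2_on_add_scaled[OF u(2,1)]) simp
    fix x :: real assume "0 \<le> x"
    have "\<i> * z * ew z \<alpha> (-\<beta>) x + (\<i> * z) * ew z \<alpha> \<beta> x = (2 * \<i> * z * \<alpha>) * exp (\<i> * z * of_real x)"
      by (simp add: ew_def algebra_simps)
    then show "cmod (2 * \<i> * z * \<alpha>) \<le> cmod (\<i> * z * ew z \<alpha> (-\<beta>) x + (\<i> * z) * ew z \<alpha> \<beta> x)"
      using Im by (simp add: norm_mult nrm)
  qed simp
  then show "\<alpha> = 0" using z by simp
qed

lemma eI_cases: "eI G L m = {0..} \<or> eI G L m = {0..L m}"
  by (simp add: eI_def)

lemma eI_fin: "m \<in> fin_edges G \<Longrightarrow> eI G L m = {0..L m}"
  by (simp add: eI_def fin_edges_def)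

lemma eI_lead: "m \<in> {1..nL G} \<Longrightarrow> eI G L m = {0..}"
  by (simp add: eI_def)

lemma vector_derivative_within_eI:
  assumes wf: "wf_qgraph G L" and m: "m \<in> edges G" and x: "x = 0 \<or> m \<in> fin_edges G \<and> x = L m"
    and d: "\<And>y. y \<in> eI G L m \<Longrightarrow> f y = h y" and h: "(h has_vector_derivative d) (at x within eI G L m)"
  shows "vector_derivative f (at x within eI G L m) = d"
proof (rule vector_derivative_within)
  have "x islimpt eI G L m"
  proof (cases "m \<in> fin_edges G")
    case True
    then show ?thesis using wf_qgraphD(4)[OF wf True] x by (auto simp: eI_fin)
  next
    case False
    then have "eI G L m = {0..}" "x = 0" using m x by (auto simp: edges_split eI_def)
    moreover have "(0::real) islimpt {0..1}" by simp
    ultimately show ?thesis using islimpt_subset[of 0 "{0..1::real}" "{0..}"] by auto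
  qed
  then show "at x within eI G L m \<noteq> bot" by (simp add: trivial_limit_within)
  have "x \<in> eI G L m" using x wf_qgraphD(4)[OF wf, of m] m by (auto simp: eI_def edges_def fin_edges_def)
  then show "(f has_vector_derivative d) (at x within eI G L m)"
    using h d by (auto intro: has_vector_derivative_transform)
qed

lemma vertex_conds_ew_iff:
  assumes wf: "wf_qgraph G L"
    and u: "\<And>m x. m \<in> edges G \<Longrightarrow> x \<in> eI G L m \<Longrightarrow> u m x = ew \<nu> (P m) (Q m) x + ew z (\<alpha> m) (\<beta> m) x"
  shows "vertex_conds G L u \<longleftrightarrow>
    cont_bd G (\<lambda>m. P m + Q m + (\<alpha> m + \<beta> m)) (\<lambda>m. ew \<nu> (P m) (Q m) (L m) + ew z (\<alpha> m) (\<beta> m) (L m)) \<and>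
    kirch_bd G (\<lambda>m. \<i> * \<nu> * (P m - Q m) + \<i> * z * (\<alpha> m - \<beta> m))
      (\<lambda>m. \<i> * \<nu> * ew \<nu> (P m) (- Q m) (L m) + \<i> * z * ew z (\<alpha> m) (- \<beta> m) (L m))"
proof -
  have 0: "0 \<in> eI G L m" if "m \<in> edges G" for m
    using that wf_qgraphD(4)[OF wf, of m] by (auto simp: eI_def edges_def fin_edges_def)
  have Lm: "L m \<in> eI G L m" if "m \<in> fin_edges G" for m
    using that wf_qgraphD(4)[OF wf, of m] by (auto simp: eI_fin)
  have d: "((\<lambda>x. ew \<nu> (P m) (Q m) x + ew z (\<alpha> m) (\<beta> m) x) has_vector_derivative
      (\<i> * \<nu> * ew \<nu> (P m) (- Q m) x + \<i> * z * ew z (\<alpha> m) (- \<beta> m) x)) (at x within S)" for m x S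
    by (intro derivative_intros)
  have d0: "vector_derivative (u m) (at 0 within eI G L m) = \<i> * \<nu> * (P m - Q m) + \<i> * z * (\<alpha> m - \<beta> m)"
    if "m \<in> edges G" for m
    using vector_derivative_within_eI[OF wf that, OF _ _ d[of m 0], of "u m"] u[OF that] by simp
  have dL: "vector_derivative (u m) (at (L m) within eI G L m) =
      \<i> * \<nu> * ew \<nu> (P m) (- Q m) (L m) + \<i> * z * ew z (\<alpha> m) (- \<beta> m) (L m)"
    if "m \<in> fin_edges G" for m
    using vector_derivative_within_eI[OF wf fin_edges_subset[OF that], OF _ _ d[of m "L m"], of "u m"]
      u[OF fin_edges_subset[OF that]] that by simp
  show ?thesis unfolding vertex_conds_iff[OF wf]
    by (intro arg_cong2[of _ _ _ _ "(\<and>)"] cont_bd_cong kirch_bd_cong)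
       (simp_all add: d0 dL u[OF _ 0] u[OF fin_edges_subset Lm])
qed

lemma vertex_conds_bc:
  assumes wf: "wf_qgraph G L" and z: "z \<noteq> 0"
    and u: "\<And>m x. m \<in> edges G \<Longrightarrow> x \<in> eI G L m \<Longrightarrow> u m x = ew z (\<alpha> m) (\<beta> m) x"
  shows "vertex_conds G L u \<longleftrightarrow> bc G L z \<alpha> \<beta>"
proof -
  have "vertex_conds G L u \<longleftrightarrow> cont_bd G (\<lambda>m. \<alpha> m + \<beta> m) (\<lambda>m. ew z (\<alpha> m) (\<beta> m) (L m)) \<and>
    kirch_bd G (\<lambda>m. \<i> * z * (\<alpha> m - \<beta> m)) (\<lambda>m. \<i> * z * ew z (\<alpha> m) (- \<beta> m) (L m))"
    using vertex_conds_ew_iff[OF wf, of u 0 "\<lambda>_. 0" "\<lambda>_. 0" z \<alpha> \<beta>] u by simp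
  also have "\<dots> \<longleftrightarrow> bc G L z \<alpha> \<beta>"
    unfolding bc_def using z by (subst kirch_bd_scale_iff) auto
  finally show ?thesis .
qed

lemma solves_coefficients:
  assumes wf: "wf_qgraph G L" and z: "z \<noteq> 0" "0 \<le> Im z" and nz: "\<nu>\<^sup>2 \<noteq> z\<^sup>2"
    and sol: "solves G L (z\<^sup>2) u f"
    and f: "\<And>m x. m \<in> edges G \<Longrightarrow> x \<in> eI G L m \<Longrightarrow> f m x = ew \<nu> (p m) (q m) x"
    and pq: "\<And>m. m \<in> {1..nL G} \<Longrightarrow> p m = 0 \<and> q m = 0"
  obtains \<alpha> \<beta> where "outgoing G \<beta>" "Im z = 0 \<longrightarrow> outgoing G \<alpha>"
    "\<forall>m\<in>edges G. \<forall>x\<in>eI G L m.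
       u m x = ew \<nu> (p m / (\<nu>\<^sup>2 - z\<^sup>2)) (q m / (\<nu>\<^sup>2 - z\<^sup>2)) x + ew z (\<alpha> m) (\<beta> m) x"
proof -
  let ?P = "\<lambda>m. p m / (\<nu>\<^sup>2 - z\<^sup>2)" and ?Q = "\<lambda>m. q m / (\<nu>\<^sup>2 - z\<^sup>2)"
  have "\<exists>\<alpha> \<beta>. (\<forall>x\<in>eI G L m. u m x = ew \<nu> (?P m) (?Q m) x + ew z \<alpha> \<beta> x) \<and>
     (m \<in> {1..nL G} \<longrightarrow> \<beta> = 0 \<and> (Im z = 0 \<longrightarrow> \<alpha> = 0))" if m: "m \<in> edges G" for m
  proof -
    obtain g where g: "H2_on (eI G L m) (u m) g"
      "AE x in lborel. x \<in> eI G L m \<longrightarrow> - g x - z\<^sup>2 * u m x = f m x"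
      using sol m by (auto simp: solves_def)
    obtain \<alpha> \<beta> where ab: "\<forall>x\<in>eI G L m. u m x = ew \<nu> (?P m) (?Q m) x + ew z \<alpha> \<beta> x"
      "L2_on (eI G L m) (u m)"
      "L2_on (eI G L m) (\<lambda>x. \<i> * \<nu> * ew \<nu> (?P m) (-?Q m) x + \<i> * z * ew z \<alpha> (-\<beta>) x)"
      by (rule edge_solution_form[OF eI_cases z(1) nz g f[OF m]]) blast
    have "\<beta> = 0 \<and> (Im z = 0 \<longrightarrow> \<alpha> = 0)" if ml: "m \<in> {1..nL G}"
    proof -
      have P0: "?P m = 0" "?Q m = 0" using pq[OF ml] by auto
      have "L2_on {0..} (u m) \<longleftrightarrow> L2_on {0..} (ew z \<alpha> \<beta>)"
        unfolding L2_on_def set_borel_measurable_def set_integrable_def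
        by (intro arg_cong2[of _ _ _ _ "(\<and>)"] arg_cong2[of _ _ _ _ "(\<in>)"] arg_cong2[of _ _ _ _ integrable] refl ext)
           (use ab(1) ml P0 in \<open>auto simp: indicator_def eI_lead\<close>)
      then show ?thesis
        using ab(2,3) ml P0 L2_lead_coefficients[OF z, of \<alpha> \<beta>] by (auto simp: eI_lead)
    qed
    then show ?thesis using ab(1) by blast
  qed
  then obtain \<alpha> \<beta> where "\<And>m. m \<in> edges G \<Longrightarrow>
     (\<forall>x\<in>eI G L m. u m x = ew \<nu> (?P m) (?Q m) x + ew z (\<alpha> m) (\<beta> m) x) \<and>
     (m \<in> {1..nL G} \<longrightarrow> \<beta> m = 0 \<and> (Im z = 0 \<longrightarrow> \<alpha> m = 0))" by metis
  then show ?thesis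
    unfolding outgoing_def using lead_in_edges that[of \<beta> \<alpha>, unfolded outgoing_def] by blast
qed

lemma homogeneous_solves_coefficients:
  assumes wf: "wf_qgraph G L" and z: "z \<noteq> 0" "0 \<le> Im z"
    and sol: "solves G L (z\<^sup>2) u zero_fun"
  obtains \<alpha> \<beta> where "outgoing G \<beta>" "Im z = 0 \<longrightarrow> outgoing G \<alpha>" "bc G L z \<alpha> \<beta>"
    "\<forall>m\<in>edges G. \<forall>x\<in>eI G L m. u m x = ew z (\<alpha> m) (\<beta> m) x"
proof -
  \<comment> \<open>A dummy source frequency: the source is zero, and \<open>2 * z\<close> merely
    meets the requirement that its square differ from that of \<open>z\<close>.\<close>
  have nz: "(2 * z)\<^sup>2 \<noteq> z\<^sup>2" using z by (simp add: power2_eq_square)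
  show ?thesis
  proof (rule solves_coefficients[OF wf z nz sol, of "\<lambda>_. 0" "\<lambda>_. 0"])
    fix \<alpha> \<beta>
    assume ab: "outgoing G \<beta>" "Im z = 0 \<longrightarrow> outgoing G \<alpha>"
      "\<forall>m\<in>edges G. \<forall>x\<in>eI G L m. u m x = ew (2 * z) (0 / ((2 * z)\<^sup>2 - z\<^sup>2)) (0 / ((2 * z)\<^sup>2 - z\<^sup>2)) x + ew z (\<alpha> m) (\<beta> m) x"
    then have u: "\<forall>m\<in>edges G. \<forall>x\<in>eI G L m. u m x = ew z (\<alpha> m) (\<beta> m) x" by simp
    then have "bc G L z \<alpha> \<beta>"
      using vertex_conds_bc[OF wf z(1), of u \<alpha> \<beta>] sol by (simp add: solves_def)
    then show thesis using that ab(1,2) u by blast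
  qed (simp_all add: zero_fun_def)
qed

lemma L2_on_continuous:
  assumes "continuous_on {a..b} h"
  shows "L2_on {a..b} h"
proof -
  have "set_integrable lborel {a..b} h" "set_integrable lborel {a..b} (\<lambda>x. (cmod (h x))\<^sup>2)"
    by (intro borel_integrable_atLeastAtMost' continuous_intros assms)+
  then show ?thesis
    by (auto simp: L2_on_def set_borel_measurable_def set_integrable_def)
qed

lemma H2_on_ew:
  assumes u: "\<And>x. x \<in> {0..b} \<Longrightarrow> u x = ew z \<alpha> \<beta> x"
  shows "H2_on {0..b} u (\<lambda>x. - (z\<^sup>2 * ew z \<alpha> \<beta> x))"
  unfolding H2_on_def
proof (intro exI[of _ "\<lambda>x. \<i> * z * ew z \<alpha> (-\<beta>) x"] conjI ballI)
  show "(u has_vector_derivative \<i> * z * ew z \<alpha> (-\<beta>) x) (at x within {0..b})" if "x \<in> {0..b}" for x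
    by (rule has_vector_derivative_transform[OF that _ ew_deriv]) (use u in auto)
  have "continuous_on {0..b} u \<longleftrightarrow> continuous_on {0..b} (ew z \<alpha> \<beta>)"
    using u by (intro continuous_on_cong) auto
  then show "L2_on {0..b} u" by (intro L2_on_continuous) (auto intro!: continuous_intros)
  show "L2_on {0..b} (\<lambda>x. \<i> * z * ew z \<alpha> (-\<beta>) x)" "L2_on {0..b} (\<lambda>x. - (z\<^sup>2 * ew z \<alpha> \<beta> x))"
    by (intro L2_on_continuous continuous_intros)+
  fix x assume x: "x \<in> {0..b}"
  have "((\<lambda>x. - (z\<^sup>2 * ew z \<alpha> \<beta> x)) has_integral \<i> * z * ew z \<alpha> (-\<beta>) x - \<i> * z * ew z \<alpha> (-\<beta>) 0) {0..x}"
  proof (rule fundamental_theorem_of_calculus)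
    show "0 \<le> x" using x by simp
    fix y
    have "((\<lambda>y. \<i> * z * ew z \<alpha> (-\<beta>) y) has_vector_derivative \<i> * z * (\<i> * z * ew z \<alpha> (-(-\<beta>)) y)) (at y within {0..x})"
      by (intro derivative_intros)
    then show "((\<lambda>y. \<i> * z * ew z \<alpha> (-\<beta>) y) has_vector_derivative - (z\<^sup>2 * ew z \<alpha> \<beta> y)) (at y within {0..x})"
      by (rule has_vector_derivative_eq_rhs) (simp add: power2_eq_square algebra_simps)
  qed
  then have "integral {0..x} (\<lambda>x. - (z\<^sup>2 * ew z \<alpha> \<beta> x)) = \<i> * z * ew z \<alpha> (-\<beta>) x - \<i> * z * ew z \<alpha> (-\<beta>) 0"
    by (rule integral_unique)
  moreover have "(LINT y:{0..x}|lborel. - (z\<^sup>2 * ew z \<alpha> \<beta> y)) = integral {0..x} (\<lambda>x. - (z\<^sup>2 * ew z \<alpha> \<beta> x))"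
    by (intro set_borel_integral_eq_integral borel_integrable_atLeastAtMost' continuous_intros)
  ultimately show "\<i> * z * ew z \<alpha> (-\<beta>) x = \<i> * z * ew z \<alpha> (-\<beta>) 0 + (LINT y:{0..x}|lborel. - (z\<^sup>2 * ew z \<alpha> \<beta> y))"
    by simp
qed

definition gf :: "qgraph \<Rightarrow> (nat \<Rightarrow> real) \<Rightarrow> complex \<Rightarrow> (nat \<Rightarrow> complex) \<Rightarrow> (nat \<Rightarrow> complex) \<Rightarrow> nat \<Rightarrow> real \<Rightarrow> complex" where
  "gf G L z \<alpha> \<beta> m x = (if m \<in> edges G \<and> x \<in> eI G L m then ew z (\<alpha> m) (\<beta> m) x else 0)"

lemma supp_ok_gf: "supp_ok G L (gf G L z \<alpha> \<beta>)"
  by (auto simp: supp_ok_def gf_def)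

lemma coefficients_solves:
  assumes wf: "wf_qgraph G L" and z: "z \<noteq> 0"
    and out: "outgoing G \<alpha>" "outgoing G \<beta>" and bc: "bc G L z \<alpha> \<beta>"
  shows "solves G L (z\<^sup>2) (gf G L z \<alpha> \<beta>) zero_fun"
  unfolding solves_def
proof (intro conjI ballI supp_ok_gf)
  show "vertex_conds G L (gf G L z \<alpha> \<beta>)"
    using bc by (subst vertex_conds_bc[OF wf z]) (auto simp: gf_def)
  fix m assume m: "m \<in> edges G"
  show "\<exists>g. H2_on (eI G L m) (gf G L z \<alpha> \<beta> m) g \<and>
    (AE x in lborel. x \<in> eI G L m \<longrightarrow> - g x - z\<^sup>2 * gf G L z \<alpha> \<beta> m x = zero_fun m x)"
  proof (cases "m \<in> fin_edges G")
    case True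
    then show ?thesis using m
      by (intro exI[of _ "\<lambda>x. - (z\<^sup>2 * ew z (\<alpha> m) (\<beta> m) x)"] conjI)
         (auto simp: eI_fin zero_fun_def gf_def intro!: H2_on_ew)
  next
    case False
    then have "m \<in> {1..nL G}" using m by (simp add: edges_split)
    then have "gf G L z \<alpha> \<beta> m = (\<lambda>_. 0)" using out by (auto simp: gf_def outgoing_def)
    then show ?thesis
      by (intro exI[of _ "\<lambda>x. 0"] conjI)
         (auto simp: zero_fun_def H2_on_def L2_on_def set_borel_measurable_def set_integrable_def
           set_lebesgue_integral_def intro!: exI[of _ "\<lambda>x. 0"])
  qed
qed

lemma solves_loc_coefficients:
  assumes wf: "wf_qgraph G L" and z: "z \<noteq> 0"
    and sol: "solves_loc G L (z\<^sup>2) u zero_fun"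
    and lead: "\<And>m x. m \<in> {1..nL G} \<Longrightarrow> 0 \<le> x \<Longrightarrow> u m x = ew z (s m) (r m) x"
  obtains \<alpha> \<beta> where "bc G L z \<alpha> \<beta>" "\<forall>m\<in>{1..nL G}. \<alpha> m = s m \<and> \<beta> m = r m"
    "\<forall>m\<in>edges G. \<forall>x\<in>eI G L m. u m x = ew z (\<alpha> m) (\<beta> m) x"
proof -
  have nz: "(2 * z)\<^sup>2 \<noteq> z\<^sup>2" using z by (simp add: power2_eq_square)
  have "\<exists>\<alpha> \<beta>. (m \<in> {1..nL G} \<longrightarrow> \<alpha> = s m \<and> \<beta> = r m) \<and> (\<forall>x\<in>eI G L m. u m x = ew z \<alpha> \<beta> x)"
    if m: "m \<in> edges G" for m
  proof (cases "m \<in> fin_edges G")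
    case True
    obtain g where g: "H2loc_on (eI G L m) (u m) g"
      "AE x in lborel. x \<in> eI G L m \<longrightarrow> - g x - z\<^sup>2 * u m x = zero_fun m x"
      using sol m unfolding solves_loc_def by blast
    have "H2_on (eI G L m \<inter> {0..L m}) (u m) g"
      using g(1) wf_qgraphD(4)[OF wf True] by (auto simp: H2loc_on_def)
    then have H: "H2_on {0..L m} (u m) g" by (simp add: eI_fin[OF True])
    have h: "zero_fun m x = ew (2 * z) 0 0 x" for x by (simp add: zero_fun_def)
    obtain \<alpha> \<beta> where "\<forall>x\<in>{0..L m}. u m x = ew (2 * z) (0 / ((2 * z)\<^sup>2 - z\<^sup>2)) (0 / ((2 * z)\<^sup>2 - z\<^sup>2)) x + ew z \<alpha> \<beta> x"
      by (rule edge_solution_form[OF disjI2[OF refl] z nz H g(2)[unfolded eI_fin[OF True]] h])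
    then show ?thesis using True by (auto simp: eI_fin[OF True] fin_edges_def)
  next
    case False
    then have "m \<in> {1..nL G}" using m by (simp add: edges_split)
    then show ?thesis using lead by (auto simp: eI_lead)
  qed
  then obtain \<alpha> \<beta> where ab: "\<And>m. m \<in> edges G \<Longrightarrow> (m \<in> {1..nL G} \<longrightarrow> \<alpha> m = s m \<and> \<beta> m = r m) \<and>
      (\<forall>x\<in>eI G L m. u m x = ew z (\<alpha> m) (\<beta> m) x)" by metis
  moreover have "bc G L z \<alpha> \<beta>"
    using vertex_conds_bc[OF wf z, of u \<alpha> \<beta>] ab sol by (simp add: solves_loc_def)
  ultimately show ?thesis using lead_in_edges that[of \<alpha> \<beta>] by blast
qed

section \<open>Green identities\<close>

text \<open>Only finite edges are integrated, so after cancellation at the vertices the fluxes into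
  the leads remain. The pairing is bilinear; sesquilinear versions arise by inserting conjugated
  functions via \<open>bc_cnj\<close>.\<close>

lemma green_finite_edges:
  fixes p q p' q' p'' q'' :: "nat \<Rightarrow> real \<Rightarrow> complex"
  assumes wf: "wf_qgraph G L"
    and p: "\<And>m x. m \<in> fin_edges G \<Longrightarrow> x \<in> {0..L m} \<Longrightarrow> (p m has_vector_derivative p' m x) (at x within {0..L m})"
    and p': "\<And>m x. m \<in> fin_edges G \<Longrightarrow> x \<in> {0..L m} \<Longrightarrow> (p' m has_vector_derivative p'' m x) (at x within {0..L m})"
    and q: "\<And>m x. m \<in> fin_edges G \<Longrightarrow> x \<in> {0..L m} \<Longrightarrow> (q m has_vector_derivative q' m x) (at x within {0..L m})"
    and q': "\<And>m x. m \<in> fin_edges G \<Longrightarrow> x \<in> {0..L m} \<Longrightarrow> (q' m has_vector_derivative q'' m x) (at x within {0..L m})"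
    and cp: "cont_bd G (\<lambda>m. p m 0) (\<lambda>m. p m (L m))" and kp: "kirch_bd G (\<lambda>m. p' m 0) (\<lambda>m. p' m (L m))"
    and cq: "cont_bd G (\<lambda>m. q m 0) (\<lambda>m. q m (L m))" and kq: "kirch_bd G (\<lambda>m. q' m 0) (\<lambda>m. q' m (L m))"
  shows "(\<Sum>m\<in>fin_edges G. integral {0..L m} (\<lambda>x. p'' m x * q m x - p m x * q'' m x))
    = (\<Sum>m=1..nL G. p' m 0 * q m 0 - p m 0 * q' m 0)"
proof -
  have "integral {0..L m} (\<lambda>x. p'' m x * q m x - p m x * q'' m x)
     = (p' m (L m) * q m (L m) - p' m 0 * q m 0) - (q' m (L m) * p m (L m) - q' m 0 * p m 0)"
    if m: "m \<in> fin_edges G" for m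
  proof -
    have "((\<lambda>x. p'' m x * q m x - p m x * q'' m x) has_integral
      (p' m (L m) * q m (L m) - p m (L m) * q' m (L m)) - (p' m 0 * q m 0 - p m 0 * q' m 0)) {0..L m}"
    proof (rule fundamental_theorem_of_calculus)
      show "0 \<le> L m" using wf_qgraphD(4)[OF wf m] by simp
      fix x assume x: "x \<in> {0..L m}"
      have "((\<lambda>x. p' m x * q m x - p m x * q' m x) has_vector_derivative
         (p' m x * q' m x + p'' m x * q m x) - (p m x * q'' m x + p' m x * q' m x)) (at x within {0..L m})"
        by (intro has_vector_derivative_diff has_vector_derivative_mult p p' q q' m x)
      then show "((\<lambda>x. p' m x * q m x - p m x * q' m x) has_vector_derivative
         p'' m x * q m x - p m x * q'' m x) (at x within {0..L m})"
        by (rule has_vector_derivative_eq_rhs) simp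
    qed
    then show ?thesis by (simp add: integral_unique algebra_simps)
  qed
  then have "(\<Sum>m\<in>fin_edges G. integral {0..L m} (\<lambda>x. p'' m x * q m x - p m x * q'' m x))
     = (\<Sum>m\<in>fin_edges G. p' m (L m) * q m (L m) - p' m 0 * q m 0)
       - (\<Sum>m\<in>fin_edges G. q' m (L m) * p m (L m) - q' m 0 * p m 0)"
    by (simp add: sum_subtractf)
  also have "\<dots> = (\<Sum>m=1..nL G. p' m 0 * q m 0) - (\<Sum>m=1..nL G. q' m 0 * p m 0)"
    using green_bd[OF wf kp cq] green_bd[OF wf kq cp] by simp
  finally show ?thesis by (simp add: sum_subtractf mult.commute)
qed

lemma ew_deriv2: "((\<lambda>x. \<i> * z * ew z \<alpha> (-\<beta>) x) has_vector_derivative - (z\<^sup>2) * ew z \<alpha> \<beta> x) (at x within S)"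
proof -
  have "((\<lambda>y. \<i> * z * ew z \<alpha> (-\<beta>) y) has_vector_derivative \<i> * z * (\<i> * z * ew z \<alpha> (-(-\<beta>)) x)) (at x within S)"
    by (intro derivative_intros)
  then show ?thesis
    by (rule has_vector_derivative_eq_rhs) (simp add: power2_eq_square algebra_simps)
qed

lemma bcD:
  assumes "bc G L z \<alpha> \<beta>"
  shows "cont_bd G (\<lambda>m. ew z (\<alpha> m) (\<beta> m) 0) (\<lambda>m. ew z (\<alpha> m) (\<beta> m) (L m))"
    "kirch_bd G (\<lambda>m. \<i> * z * ew z (\<alpha> m) (- \<beta> m) 0) (\<lambda>m. \<i> * z * ew z (\<alpha> m) (- \<beta> m) (L m))"
  using assms kirch_bd_scale[of G "\<lambda>m. \<alpha> m - \<beta> m" _ "\<i> * z"] by (auto simp: bc_def)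

text \<open>Conjugation turns \<open>exp (\<i> * z * x)\<close> into an incoming wave of frequency
  \<open>cnj z\<close>, so the two coefficient families change places.\<close>

lemma bc_cnj: "bc G L z \<alpha> \<beta> \<Longrightarrow> bc G L (cnj z) (\<lambda>m. cnj (\<beta> m)) (\<lambda>m. cnj (\<alpha> m))"
  unfolding bc_def
proof (elim conjE, intro conjI)
  assume c: "cont_bd G (\<lambda>m. \<alpha> m + \<beta> m) (\<lambda>m. ew z (\<alpha> m) (\<beta> m) (L m))"
    and k: "kirch_bd G (\<lambda>m. \<alpha> m - \<beta> m) (\<lambda>m. ew z (\<alpha> m) (- \<beta> m) (L m))"
  show "cont_bd G (\<lambda>m. cnj (\<beta> m) + cnj (\<alpha> m)) (\<lambda>m. ew (cnj z) (cnj (\<beta> m)) (cnj (\<alpha> m)) (L m))"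
    using cont_bd_cnj[OF c] by (simp add: ew_cnj add.commute)
  show "kirch_bd G (\<lambda>m. cnj (\<beta> m) - cnj (\<alpha> m)) (\<lambda>m. ew (cnj z) (cnj (\<beta> m)) (- cnj (\<alpha> m)) (L m))"
    using kirch_bd_cnj[OF kirch_bd_scale[OF k, of "-1"]] by (simp add: ew_cnj flip: ew_uminus)
qed

text \<open>The factor \<open>z2^2 - z1^2\<close> stays on the left: distinct frequencies then give
  orthogonality, and equal frequencies give relations between the lead amplitudes.\<close>

lemma green_bc:
  assumes wf: "wf_qgraph G L" and p: "bc G L z1 a b" and q: "bc G L z2 c d"
  shows "(z2\<^sup>2 - z1\<^sup>2) * (\<Sum>m\<in>fin_edges G. integral {0..L m} (\<lambda>x. ew z1 (a m) (b m) x * ew z2 (c m) (d m) x))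
    = (\<Sum>m=1..nL G. \<i> * z1 * (a m - b m) * (c m + d m) - \<i> * z2 * (a m + b m) * (c m - d m))"
proof -
  have "(\<Sum>m\<in>fin_edges G. integral {0..L m} (\<lambda>x. (- (z1\<^sup>2) * ew z1 (a m) (b m) x) * ew z2 (c m) (d m) x
       - ew z1 (a m) (b m) x * (- (z2\<^sup>2) * ew z2 (c m) (d m) x)))
    = (\<Sum>m=1..nL G. (\<i> * z1 * ew z1 (a m) (- b m) 0) * ew z2 (c m) (d m) 0
       - ew z1 (a m) (b m) 0 * (\<i> * z2 * ew z2 (c m) (- d m) 0))"
    by (rule green_finite_edges[OF wf ew_deriv ew_deriv2 ew_deriv ew_deriv2 bcD[OF p] bcD[OF q]])
  moreover have "(\<lambda>x. (- (z1\<^sup>2) * ew z1 (a m) (b m) x) * ew z2 (c m) (d m) x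
       - ew z1 (a m) (b m) x * (- (z2\<^sup>2) * ew z2 (c m) (d m) x)) =
     (\<lambda>x. (z2\<^sup>2 - z1\<^sup>2) * (ew z1 (a m) (b m) x * ew z2 (c m) (d m) x))" for m
    by (simp add: algebra_simps)
  ultimately show ?thesis
    by (simp only: integral_mult_right flip: sum_distrib_left) (simp add: ac_simps)
qed

section \<open>Energy and flux of outgoing states\<close>

lemma integral_of_real_continuous:
  fixes h :: "real \<Rightarrow> real"
  assumes "continuous_on {a..b} h"
  shows "integral {a..b} (\<lambda>x. complex_of_real (h x)) = of_real (integral {a..b} h)"
  using integral_linear[OF integrable_continuous_interval[OF assms] bounded_linear_of_real]
  by (simp add: o_def)

definition mass :: "qgraph \<Rightarrow> (nat \<Rightarrow> real) \<Rightarrow> complex \<Rightarrow> (nat \<Rightarrow> complex) \<Rightarrow> (nat \<Rightarrow> complex) \<Rightarrow> real" where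
  "mass G L z \<alpha> \<beta> = (\<Sum>m\<in>fin_edges G. integral {0..L m} (\<lambda>x. (cmod (ew z (\<alpha> m) (\<beta> m) x))\<^sup>2))"

lemma mass_nonneg: "0 \<le> mass G L z \<alpha> \<beta>"
  unfolding mass_def by (intro sum_nonneg integral_nonneg integrable_continuous_interval continuous_intros) auto

text \<open>The energy identity \<open>\<integral>|u'|\<^sup>2 - z\<^sup>2\<integral>|u|\<^sup>2 = iz\<Sum>|\<alpha>\<^sub>k|\<^sup>2\<close>, multiplied by
  \<open>cnj z / |z|\<^sup>2\<close>; \<open>|u'| = |z| |ew z \<alpha> (-\<beta>)|\<close>.\<close>

lemma energy_identity:
  assumes wf: "wf_qgraph G L" and z: "z \<noteq> 0" and bc: "bc G L z \<alpha> \<beta>" and out: "outgoing G \<beta>"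
  shows "cnj z * mass G L z \<alpha> (\<lambda>m. - \<beta> m) - z * mass G L z \<alpha> \<beta> = \<i> * (\<Sum>m=1..nL G. (cmod (\<alpha> m))\<^sup>2)"
proof -
  let ?h = "\<lambda>m. ew z (\<alpha> m) (\<beta> m)" and ?k = "\<lambda>m. ew z (\<alpha> m) (- \<beta> m)"
  have cont: "continuous_on S (\<lambda>x. (cmod (ew z c d x))\<^sup>2)" for S c d
    by (intro continuous_intros)
  have int: "integral {0..L m} (\<lambda>x. - (z\<^sup>2) * ?h m x * cnj (?h m x) + (\<i> * z * ?k m x) * cnj (\<i> * z * ?k m x)) =
     - (z\<^sup>2) * of_real (integral {0..L m} (\<lambda>x. (cmod (?h m x))\<^sup>2)) +
     z * cnj z * of_real (integral {0..L m} (\<lambda>x. (cmod (?k m x))\<^sup>2))" for m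
  proof -
    have "(\<lambda>x. - (z\<^sup>2) * ?h m x * cnj (?h m x) + (\<i> * z * ?k m x) * cnj (\<i> * z * ?k m x)) =
       (\<lambda>x. - (z\<^sup>2) * of_real ((cmod (?h m x))\<^sup>2) + z * cnj z * of_real ((cmod (?k m x))\<^sup>2))"
      by (intro ext) (simp add: complex_norm_square algebra_simps del: of_real_power)
    then show ?thesis
      unfolding integral_of_real_continuous[OF cont, symmetric]
      by (simp only:) (subst integral_add; (intro integrable_continuous_interval continuous_intros)?; simp)
  qed
  have "(\<Sum>m\<in>fin_edges G. integral {0..L m} (\<lambda>x. - (z\<^sup>2) * ?h m x * cnj (?h m x) + (\<i> * z * ?k m x) * cnj (\<i> * z * ?k m x)))
    = (\<Sum>m\<in>fin_edges G. (\<i> * z * ?k m (L m)) * cnj (?h m (L m)) - (\<i> * z * ?k m 0) * cnj (?h m 0))"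
  proof (rule sum.cong[OF refl], rule integral_unique, rule fundamental_theorem_of_calculus)
    fix m x assume m: "m \<in> fin_edges G"
    show "0 \<le> L m" using wf_qgraphD(4)[OF wf m] by simp
    have cd: "((\<lambda>x. cnj (?h m x)) has_vector_derivative cnj (\<i> * z * ?k m x)) (at x within {0..L m})"
      by (rule has_vector_derivative_cnj) (rule ew_deriv)
    have "((\<lambda>x. (\<i> * z * ?k m x) * cnj (?h m x)) has_vector_derivative
       (\<i> * z * ?k m x) * cnj (\<i> * z * ?k m x) + (- (z\<^sup>2) * ?h m x) * cnj (?h m x)) (at x within {0..L m})"
      by (intro has_vector_derivative_mult ew_deriv2 cd)
    then show "((\<lambda>x. (\<i> * z * ?k m x) * cnj (?h m x)) has_vector_derivative
       - (z\<^sup>2) * ?h m x * cnj (?h m x) + (\<i> * z * ?k m x) * cnj (\<i> * z * ?k m x)) (at x within {0..L m})"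
      by (rule has_vector_derivative_eq_rhs) simp
  qed
  also have "\<dots> = (\<Sum>m=1..nL G. (\<i> * z * ?k m 0) * cnj (?h m 0))"
    by (rule green_bd[OF wf bcD(2)[OF bc] cont_bd_cnj[OF bcD(1)[OF bc]]])
  also have "\<dots> = (\<Sum>m=1..nL G. \<i> * z * (cmod (\<alpha> m))\<^sup>2)"
    using out by (intro sum.cong) (auto simp: outgoing_def complex_norm_square simp del: of_real_power)
  finally have "z * (cnj z * mass G L z \<alpha> (\<lambda>m. - \<beta> m) - z * mass G L z \<alpha> \<beta>) = z * (\<i> * (\<Sum>m=1..nL G. (cmod (\<alpha> m))\<^sup>2))"
    unfolding int mass_def
    by (simp add: sum_distrib_left sum_distrib_right sum.distrib sum_negf algebra_simps power2_eq_square sum_subtractf)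
  then show ?thesis using z by simp
qed

text \<open>Imaginary and real part of the energy identity. The real part is \<open>Re z\<close>
  times the difference of the two masses, so they coincide off the imaginary axis.\<close>

lemma flux_identity:
  assumes "wf_qgraph G L" "z \<noteq> 0" "bc G L z \<alpha> \<beta>" "outgoing G \<beta>"
  shows "(\<Sum>m=1..nL G. (cmod (\<alpha> m))\<^sup>2) = - Im z * (mass G L z \<alpha> (\<lambda>m. - \<beta> m) + mass G L z \<alpha> \<beta>)"
    "Re z \<noteq> 0 \<Longrightarrow> (\<Sum>m=1..nL G. (cmod (\<alpha> m))\<^sup>2) = - 2 * Im z * mass G L z \<alpha> \<beta>"
proof -
  have *: "cnj z * mass G L z \<alpha> (\<lambda>m. - \<beta> m) - z * mass G L z \<alpha> \<beta> = \<i> * of_real (\<Sum>m=1..nL G. (cmod (\<alpha> m))\<^sup>2)"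
    using energy_identity[OF assms] by simp
  show 1: "(\<Sum>m=1..nL G. (cmod (\<alpha> m))\<^sup>2) = - Im z * (mass G L z \<alpha> (\<lambda>m. - \<beta> m) + mass G L z \<alpha> \<beta>)"
    using arg_cong[OF *, of Im] by (simp add: algebra_simps)
  assume "Re z \<noteq> 0"
  then have "mass G L z \<alpha> (\<lambda>m. - \<beta> m) = mass G L z \<alpha> \<beta>"
    using arg_cong[OF *, of Re] by simp
  then show "(\<Sum>m=1..nL G. (cmod (\<alpha> m))\<^sup>2) = - 2 * Im z * mass G L z \<alpha> \<beta>"
    using 1 by simp
qed

lemma mass_eq_0:
  assumes wf: "wf_qgraph G L" and 0: "mass G L z \<alpha> \<beta> = 0" and m: "m \<in> fin_edges G" and x: "x \<in> {0..L m}"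
  shows "ew z (\<alpha> m) (\<beta> m) x = 0"
proof -
  have cont: "continuous_on {0..L m} (\<lambda>x. (cmod (ew z (\<alpha> m) (\<beta> m) x))\<^sup>2)" for m
    by (intro continuous_intros)
  have "integral {0..L m} (\<lambda>x. (cmod (ew z (\<alpha> m) (\<beta> m) x))\<^sup>2) = 0"
    using 0 m unfolding mass_def
    by (subst (asm) sum_nonneg_eq_0_iff) (auto intro!: integral_nonneg integrable_continuous_interval cont)
  then have "\<forall>x\<in>{0..L m}. (cmod (ew z (\<alpha> m) (\<beta> m) x))\<^sup>2 = 0"
    using integral_eq_0_iff[OF cont wf_qgraphD(4)[OF wf m]] by simp
  then show ?thesis using x by simp
qed

text \<open>The upper half-plane has no outgoing states: in the flux identity a sum of squares
  equals a nonpositive number, so the lead amplitudes and both masses vanish.\<close>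

lemma gm_det_nonzero_upper:
  assumes wf: "wf_qgraph G L" and z: "0 < Im z"
  shows "ddet (ixs G) (gm G L z) \<noteq> 0"
proof
  assume "ddet (ixs G) (gm G L z) = 0"
  then obtain \<alpha> \<beta> m where ab: "bc G L z \<alpha> \<beta>" "outgoing G \<beta>" "m \<in> edges G" "\<alpha> m \<noteq> 0 \<or> \<beta> m \<noteq> 0"
    unfolding gm_det_eq_0_iff[OF wf] by blast
  have z0: "z \<noteq> 0" using z by auto
  let ?A = "mass G L z \<alpha> (\<lambda>m. - \<beta> m)" and ?B = "mass G L z \<alpha> \<beta>" and ?C = "\<Sum>m=1..nL G. (cmod (\<alpha> m))\<^sup>2"
  have C: "?C = - Im z * (?A + ?B)" "0 \<le> ?C" "0 \<le> ?A" "0 \<le> ?B"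
    by (rule flux_identity[OF wf z0 ab(1,2)]) (auto intro: sum_nonneg mass_nonneg)
  have "?A + ?B \<le> 0" using C z by (simp add: mult_le_0_iff zero_le_mult_iff)
  then have AB: "?A = 0" "?B = 0" using C by auto
  then have "?C = 0" using C by simp
  then have lead: "\<alpha> m = 0" if "m \<in> {1..nL G}" for m
    using that by (subst (asm) sum_nonneg_eq_0_iff) auto
  \<comment> \<open>At \<open>x = 0\<close> the two masses give
    \<open>\<alpha> m - \<beta> m = 0\<close> and \<open>\<alpha> m + \<beta> m = 0\<close>.\<close>
  have fin: "\<alpha> m = 0 \<and> \<beta> m = 0" if "m \<in> fin_edges G" for m
    using mass_eq_0[OF wf AB(1) that, of 0] mass_eq_0[OF wf AB(2) that, of 0] wf_qgraphD(4)[OF wf that]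
    by (auto simp: add_eq_0_iff)
  show False using ab(2-4) lead fin by (auto simp: edges_split outgoing_def)
qed

text \<open>At a real frequency no energy escapes, so an outgoing state vanishes on the leads and is
  a genuine eigenfunction if it is nontrivial.\<close>

lemma outgoing_real_frequency:
  assumes "wf_qgraph G L" "z \<noteq> 0" "Im z = 0" "bc G L z \<alpha> \<beta>" "outgoing G \<beta>"
  shows "outgoing G \<alpha>"
proof -
  have "(\<Sum>m=1..nL G. (cmod (\<alpha> m))\<^sup>2) = 0"
    using flux_identity(1)[OF assms(1,2,4,5)] assms(3) by simp
  then show ?thesis by (subst (asm) sum_nonneg_eq_0_iff) (auto simp: outgoing_def)
qed

section \<open>Outgoing states produce resonances\<close>

text \<open>The boundary data of the particular solution \<open>ew \<nu> P Q\<close>. The factor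
  \<open>\<nu> / z\<close> appears because \<open>bd_rhs\<close> expects derivatives divided by
  \<open>\<i> * z\<close>.\<close>

definition src_rhs :: "qgraph \<Rightarrow> (nat \<Rightarrow> real) \<Rightarrow> complex \<Rightarrow> (nat \<Rightarrow> complex) \<Rightarrow> (nat \<Rightarrow> complex) \<Rightarrow> complex \<Rightarrow> ix \<Rightarrow> complex" where
  "src_rhs G L \<nu> p q z = bd_rhs G
     (\<lambda>m. p m / (\<nu>\<^sup>2 - z\<^sup>2) + q m / (\<nu>\<^sup>2 - z\<^sup>2))
     (\<lambda>m. ew \<nu> (p m / (\<nu>\<^sup>2 - z\<^sup>2)) (q m / (\<nu>\<^sup>2 - z\<^sup>2)) (L m))
     (\<lambda>m. \<nu> / z * (p m / (\<nu>\<^sup>2 - z\<^sup>2) - q m / (\<nu>\<^sup>2 - z\<^sup>2)))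
     (\<lambda>m. \<nu> / z * ew \<nu> (p m / (\<nu>\<^sup>2 - z\<^sup>2)) (- (q m / (\<nu>\<^sup>2 - z\<^sup>2))) (L m))"

text \<open>Cramer's rule for the coefficients of \<open>(P - z\<^sup>2)\<^sup>-\<^sup>1 f\<close>, where \<open>f = ew \<nu> p q\<close> on the finite
  edges and \<open>f = 0\<close> on the leads; it makes sense for all but discretely many \<open>z\<close>.\<close>

definition res_coeff :: "qgraph \<Rightarrow> (nat \<Rightarrow> real) \<Rightarrow> complex \<Rightarrow> (nat \<Rightarrow> complex) \<Rightarrow> (nat \<Rightarrow> complex) \<Rightarrow> complex \<Rightarrow> ix \<Rightarrow> complex" where
  "res_coeff G L \<nu> p q z i =
     ddet (ixs G) (repl_col (gm G L z) i (src_rhs G L \<nu> p q z)) / ddet (ixs G) (gm G L z)"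

lemma kirch_bd_divide:
  assumes z: "z \<noteq> 0"
  shows "kirch_bd G (\<lambda>m. \<i> * \<nu> * x m + \<i> * z * y m) (\<lambda>m. \<i> * \<nu> * x' m + \<i> * z * y' m) \<longleftrightarrow>
    kirch_bd G (\<lambda>m. \<nu> / z * x m + y m) (\<lambda>m. \<nu> / z * x' m + y' m)"
proof -
  have *: "\<i> * \<nu> * a + \<i> * z * b = (\<i> * z) * (\<nu> / z * a + b)" for a b using z by (simp add: field_simps)
  show ?thesis unfolding * by (rule kirch_bd_scale_iff) (simp add: z)
qed

text \<open>In \<open>Res\<close> a candidate continuation has to match every solution in the upper
  half-plane, so uniqueness is the form required: each solution has the Cramer coefficients because
  the determinant is nonzero there.\<close>

lemma res_coeff_unique:
  assumes wf: "wf_qgraph G L" and z: "0 < Im z" and nz: "\<nu>\<^sup>2 \<noteq> z\<^sup>2"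
    and pq: "outgoing G p" "outgoing G q"
    and sol: "solves G L (z\<^sup>2) u (gf G L \<nu> p q)"
  shows "\<forall>m\<in>edges G. \<forall>x\<in>eI G L m. u m x = ew \<nu> (p m / (\<nu>\<^sup>2 - z\<^sup>2)) (q m / (\<nu>\<^sup>2 - z\<^sup>2)) x
    + ew z (res_coeff G L \<nu> p q z (IA m)) (cB G (res_coeff G L \<nu> p q z) m) x"
proof -
  have z0: "z \<noteq> 0" using z by auto
  show ?thesis
  proof (rule solves_coefficients[OF wf z0 less_imp_le[OF z] nz sol, of p q])
    show "gf G L \<nu> p q m x = ew \<nu> (p m) (q m) x" if "m \<in> edges G" "x \<in> eI G L m" for m x
      using that by (simp add: gf_def)
    show "p m = 0 \<and> q m = 0" if "m \<in> {1..nL G}" for m using pq that by (simp add: outgoing_def)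
    fix \<alpha> \<beta>
    assume ab: "outgoing G \<beta>" and u: "\<forall>m\<in>edges G. \<forall>x\<in>eI G L m. u m x = ew \<nu> (p m / (\<nu>\<^sup>2 - z\<^sup>2)) (q m / (\<nu>\<^sup>2 - z\<^sup>2)) x + ew z (\<alpha> m) (\<beta> m) x"
    have "vertex_conds G L u" using sol by (simp add: solves_def)
    then have bd: "cont_bd G (\<lambda>m. p m / (\<nu>\<^sup>2 - z\<^sup>2) + q m / (\<nu>\<^sup>2 - z\<^sup>2) + (\<alpha> m + \<beta> m))
        (\<lambda>m. ew \<nu> (p m / (\<nu>\<^sup>2 - z\<^sup>2)) (q m / (\<nu>\<^sup>2 - z\<^sup>2)) (L m) + ew z (\<alpha> m) (\<beta> m) (L m))"
      "kirch_bd G (\<lambda>m. \<nu> / z * (p m / (\<nu>\<^sup>2 - z\<^sup>2) - q m / (\<nu>\<^sup>2 - z\<^sup>2)) + (\<alpha> m - \<beta> m))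
        (\<lambda>m. \<nu> / z * ew \<nu> (p m / (\<nu>\<^sup>2 - z\<^sup>2)) (- (q m / (\<nu>\<^sup>2 - z\<^sup>2))) (L m) + ew z (\<alpha> m) (- \<beta> m) (L m))"
      using vertex_conds_ew_iff[OF wf, of u \<nu> "\<lambda>m. p m / (\<nu>\<^sup>2 - z\<^sup>2)" "\<lambda>m. q m / (\<nu>\<^sup>2 - z\<^sup>2)" z \<alpha> \<beta>] u
      unfolding kirch_bd_divide[OF z0] by blast+
    obtain Y where Y: "\<And>i. i \<in> ixs G \<Longrightarrow> (\<Sum>j\<in>ixs G. gm G L z i j * Y j) = src_rhs G L \<nu> p q z i"
      "\<And>m. Y (IA m) = \<alpha> m" "\<And>m. Y (IB m) = \<beta> m"
      using bd_gm_solution[OF wf ab bd] unfolding src_rhs_def by blast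
    have Yr: "Y i = res_coeff G L \<nu> p q z i" if "i \<in> ixs G" for i
      using ddet_cramer[OF finite_ixs that Y(1)] gm_det_nonzero_upper[OF wf z]
      by (simp add: res_coeff_def field_simps)
    have "\<alpha> m = res_coeff G L \<nu> p q z (IA m)" if "m \<in> edges G" for m
      using Y(2)[of m] Yr[of "IA m"] that by simp
    moreover have "\<beta> m = cB G (res_coeff G L \<nu> p q z) m" if "m \<in> edges G" for m
      using Y(3)[of m] Yr[of "IB m"] that ab by (auto simp: cB_def outgoing_def edges_split)
    ultimately show ?thesis using u by simp
  qed
qed

text \<open>The continued resolvent satisfies the vertex conditions wherever the determinant is
  nonzero, in the lower half-plane as well. This allows Green's formula near a resonance.\<close>

lemma res_coeff_bd:
  fixes p q :: "nat \<Rightarrow> complex" and \<nu> :: complex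
  assumes nz: "ddet (ixs G) (gm G L z) \<noteq> 0"
  defines "X \<equiv> res_coeff G L \<nu> p q z"
  shows "cont_bd G (\<lambda>m. p m / (\<nu>\<^sup>2 - z\<^sup>2) + q m / (\<nu>\<^sup>2 - z\<^sup>2) + (X (IA m) + cB G X m))
        (\<lambda>m. ew \<nu> (p m / (\<nu>\<^sup>2 - z\<^sup>2)) (q m / (\<nu>\<^sup>2 - z\<^sup>2)) (L m) + ew z (X (IA m)) (cB G X m) (L m))"
      "kirch_bd G (\<lambda>m. \<nu> / z * (p m / (\<nu>\<^sup>2 - z\<^sup>2) - q m / (\<nu>\<^sup>2 - z\<^sup>2)) + (X (IA m) - cB G X m))
        (\<lambda>m. \<nu> / z * ew \<nu> (p m / (\<nu>\<^sup>2 - z\<^sup>2)) (- (q m / (\<nu>\<^sup>2 - z\<^sup>2))) (L m) + ew z (X (IA m)) (- cB G X m) (L m))"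
proof -
  obtain Y where Y: "\<And>i. i \<in> ixs G \<Longrightarrow> (\<Sum>j\<in>ixs G. gm G L z i j * Y j) = src_rhs G L \<nu> p q z i"
    using ddet_solve[OF finite_ixs nz, of "src_rhs G L \<nu> p q z"] by blast
  have XY: "X i = Y i" if "i \<in> ixs G" for i
    using ddet_cramer[OF finite_ixs that Y] nz by (simp add: X_def res_coeff_def field_simps)
  have eq: "(\<Sum>j\<in>ixs G. gm G L z i j * X j) = src_rhs G L \<nu> p q z i" if "i \<in> ixs G" for i
    using Y[OF that] XY by simp
  note * = gm_solution_bd[OF eq[unfolded src_rhs_def]]
  show "cont_bd G (\<lambda>m. p m / (\<nu>\<^sup>2 - z\<^sup>2) + q m / (\<nu>\<^sup>2 - z\<^sup>2) + (X (IA m) + cB G X m))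
        (\<lambda>m. ew \<nu> (p m / (\<nu>\<^sup>2 - z\<^sup>2)) (q m / (\<nu>\<^sup>2 - z\<^sup>2)) (L m) + ew z (X (IA m)) (cB G X m) (L m))"
    by (rule *(1))
  show "kirch_bd G (\<lambda>m. \<nu> / z * (p m / (\<nu>\<^sup>2 - z\<^sup>2) - q m / (\<nu>\<^sup>2 - z\<^sup>2)) + (X (IA m) - cB G X m))
        (\<lambda>m. \<nu> / z * ew \<nu> (p m / (\<nu>\<^sup>2 - z\<^sup>2)) (- (q m / (\<nu>\<^sup>2 - z\<^sup>2))) (L m) + ew z (X (IA m)) (- cB G X m) (L m))"
    by (rule *(2))
qed

section \<open>Meromorphy of the resolvent coefficients\<close>

lemma if_const_pred: "(P \<Longrightarrow> Q f) \<Longrightarrow> (\<not> P \<Longrightarrow> Q g) \<Longrightarrow> Q (\<lambda>z. if P then f z else g z)"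
  by (cases P) simp_all

lemma gm_holomorphic: "(\<lambda>z. gm G L z i j) holomorphic_on A"
  by (cases i; cases j)
     (auto intro!: holomorphic_intros if_const_pred[where Q = "\<lambda>h. h holomorphic_on A"] simp del: if_split)

lemma ddet_holomorphic:
  assumes "finite I" "\<And>i j. i \<in> I \<Longrightarrow> j \<in> I \<Longrightarrow> (\<lambda>z. M z i j) holomorphic_on A"
  shows "(\<lambda>z. ddet I (M z)) holomorphic_on A"
  using ddet_closed[of "{f. f holomorphic_on A}" I M] assms by (auto intro!: holomorphic_intros)

lemma ddet_meromorphic:
  assumes "finite I" "\<And>i j. i \<in> I \<Longrightarrow> j \<in> I \<Longrightarrow> (\<lambda>z. M z i j) meromorphic_on A"
  shows "(\<lambda>z. ddet I (M z)) meromorphic_on A"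
  using ddet_closed[of "{f. f meromorphic_on A}" I M] assms by (auto intro!: meromorphic_intros)

lemma entire_meromorphic: "f holomorphic_on UNIV \<Longrightarrow> f meromorphic_on UNIV"
  by (simp add: analytic_on_imp_meromorphic_on analytic_on_open)

lemma gm_meromorphic: "(\<lambda>z. gm G L z i j) meromorphic_on UNIV"
  by (rule entire_meromorphic[OF gm_holomorphic])

lemma res_coeff_meromorphic: "(\<lambda>z. res_coeff G L \<nu> p q z i) meromorphic_on UNIV"
proof -
  have "(\<lambda>z. src_rhs G L \<nu> p q z k) meromorphic_on UNIV" for k
    by (cases k) (auto simp: src_rhs_def bd_rhs_def ew_def intro!: meromorphic_intros)
  then show ?thesis unfolding res_coeff_def repl_col_def
    by (intro meromorphic_on_divide ddet_meromorphic finite_ixs) (auto intro: gm_meromorphic if_const_pred[where Q = "\<lambda>h. h meromorphic_on UNIV"])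
qed

lemma exp_integral_holomorphic:
  fixes h :: "real \<Rightarrow> complex"
  assumes "continuous_on {0..b} h"
  shows "(\<lambda>z. integral {0..b} (\<lambda>x. exp (c * z * of_real x) * h x)) holomorphic_on UNIV"
proof -
  have "(\<lambda>z. integral (cbox 0 b) (\<lambda>x. exp (c * z * of_real x) * h x)) holomorphic_on UNIV"
  proof (rule leibniz_rule_holomorphic)
    show "((\<lambda>z. exp (c * z * of_real x) * h x) has_field_derivative c * of_real x * exp (c * z * of_real x) * h x) (at z within UNIV)" for z x
      by (auto intro!: derivative_eq_intros)
    show "(\<lambda>x. exp (c * z * of_real x) * h x) integrable_on cbox 0 b" for z
      unfolding cbox_interval using assms by (intro integrable_continuous_interval continuous_intros)
    show "continuous_on (UNIV \<times> cbox 0 b) (\<lambda>(z, x). c * of_real x * exp (c * z * of_real x) * h x)"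
      unfolding case_prod_beta using assms
      by (intro continuous_intros continuous_on_compose2[OF assms]) auto
  qed auto
  then show ?thesis by simp
qed

text \<open>The continued resolvent applied to the source is paired with an outgoing state at \<mu>.
  As both are outgoing, the lead terms carry the factor \<open>\<mu> - z\<close>; thus everything on
  the left has a factor vanishing at \<open>z = \<mu>\<close>, while the right is constant in
  \<open>z\<close>.\<close>

lemma green_resolvent:
  assumes wf: "wf_qgraph G L" and z: "z \<noteq> 0" and nz: "\<nu>\<^sup>2 \<noteq> z\<^sup>2" and det: "ddet (ixs G) (gm G L z) \<noteq> 0"
    and pq: "outgoing G p" "outgoing G q"
    and bc: "bc G L \<mu> a b" and out: "outgoing G b"
  defines "X \<equiv> res_coeff G L \<nu> p q z"
  shows "(\<mu>\<^sup>2 - z\<^sup>2) * (\<Sum>m\<in>fin_edges G. integral {0..L m} (\<lambda>x.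
        (ew \<nu> (p m / (\<nu>\<^sup>2 - z\<^sup>2)) (q m / (\<nu>\<^sup>2 - z\<^sup>2)) x + ew z (X (IA m)) (X (IB m)) x) * ew \<mu> (a m) (b m) x))
      + \<i> * (\<mu> - z) * (\<Sum>m=1..nL G. X (IA m) * a m)
    = (\<Sum>m\<in>fin_edges G. integral {0..L m} (\<lambda>x. ew \<nu> (p m) (q m) x * ew \<mu> (a m) (b m) x))"
proof -
  let ?P = "\<lambda>m. p m / (\<nu>\<^sup>2 - z\<^sup>2)" and ?Q = "\<lambda>m. q m / (\<nu>\<^sup>2 - z\<^sup>2)"
  let ?u = "\<lambda>m x. ew \<nu> (?P m) (?Q m) x + ew z (X (IA m)) (cB G X m) x"
  let ?u' = "\<lambda>m x. \<i> * \<nu> * ew \<nu> (?P m) (- ?Q m) x + \<i> * z * ew z (X (IA m)) (- cB G X m) x"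
  let ?u'' = "\<lambda>m x. - (\<nu>\<^sup>2) * ew \<nu> (?P m) (?Q m) x + - (z\<^sup>2) * ew z (X (IA m)) (cB G X m) x"
  let ?w = "\<lambda>m. ew \<mu> (a m) (b m)"
  have "(\<Sum>m\<in>fin_edges G. integral {0..L m} (\<lambda>x. ?u'' m x * ?w m x - ?u m x * (- (\<mu>\<^sup>2) * ?w m x)))
    = (\<Sum>m=1..nL G. ?u' m 0 * ?w m 0 - ?u m 0 * (\<i> * \<mu> * ew \<mu> (a m) (- b m) 0))"
  proof (rule green_finite_edges[OF wf _ _ ew_deriv ew_deriv2 _ _ bcD[OF bc]])
    show "(?u m has_vector_derivative ?u' m x) (at x within {0..L m})" for m x
      by (intro has_vector_derivative_add ew_deriv)
    show "(?u' m has_vector_derivative ?u'' m x) (at x within {0..L m})" for m x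
      by (intro has_vector_derivative_add ew_deriv2)
    show "cont_bd G (\<lambda>m. ?u m 0) (\<lambda>m. ?u m (L m))"
      using res_coeff_bd(1)[OF det, of p \<nu> q] by (simp add: X_def)
    show "kirch_bd G (\<lambda>m. ?u' m 0) (\<lambda>m. ?u' m (L m))"
      unfolding kirch_bd_divide[OF z] using res_coeff_bd(2)[OF det, of \<nu> p q] by (simp add: X_def)
  qed
  also have "\<dots> = (\<Sum>m=1..nL G. \<i> * (z - \<mu>) * (X (IA m) * a m))"
    using pq out by (intro sum.cong) (auto simp: outgoing_def cB_def lead_notin_fin algebra_simps)
  also have "\<dots> = - (\<i> * (\<mu> - z) * (\<Sum>m=1..nL G. X (IA m) * a m))"
    unfolding sum_distrib_left[symmetric] by (simp add: algebra_simps)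
  finally have 1: "(\<Sum>m\<in>fin_edges G. integral {0..L m} (\<lambda>x. ?u'' m x * ?w m x - ?u m x * (- (\<mu>\<^sup>2) * ?w m x)))
     = - (\<i> * (\<mu> - z) * (\<Sum>m=1..nL G. X (IA m) * a m))" .
  have fsc: "ew \<nu> (p m) (q m) x = (\<nu>\<^sup>2 - z\<^sup>2) * ew \<nu> (?P m) (?Q m) x" for m x
    unfolding ew_scale[symmetric] using nz by simp
  have "integral {0..L m} (\<lambda>x. ?u'' m x * ?w m x - ?u m x * (- (\<mu>\<^sup>2) * ?w m x)) =
      (\<mu>\<^sup>2 - z\<^sup>2) * integral {0..L m} (\<lambda>x. ?u m x * ?w m x) - integral {0..L m} (\<lambda>x. ew \<nu> (p m) (q m) x * ?w m x)" for m
  proof -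
    have "(\<lambda>x. ?u'' m x * ?w m x - ?u m x * (- (\<mu>\<^sup>2) * ?w m x)) =
      (\<lambda>x. (\<mu>\<^sup>2 - z\<^sup>2) * (?u m x * ?w m x) - ew \<nu> (p m) (q m) x * ?w m x)"
      unfolding fsc by (intro ext) (simp add: algebra_simps)
    then show ?thesis
      by (simp only:) (subst integral_diff; (intro integrable_continuous_interval continuous_intros)?; simp)
  qed
  then have 2: "(\<mu>\<^sup>2 - z\<^sup>2) * (\<Sum>m\<in>fin_edges G. integral {0..L m} (\<lambda>x. ?u m x * ?w m x))
    - (\<Sum>m\<in>fin_edges G. integral {0..L m} (\<lambda>x. ew \<nu> (p m) (q m) x * ?w m x)) = - (\<i> * (\<mu> - z) * (\<Sum>m=1..nL G. X (IA m) * a m))"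
    using 1 by (simp add: sum_subtractf sum_distrib_left)
  have 3: "(\<Sum>m\<in>fin_edges G. integral {0..L m} (\<lambda>x. ?u m x * ?w m x)) =
     (\<Sum>m\<in>fin_edges G. integral {0..L m} (\<lambda>x. (ew \<nu> (?P m) (?Q m) x + ew z (X (IA m)) (X (IB m)) x) * ?w m x))"
    by (rule sum.cong) (auto simp: cB_def)
  show ?thesis using 2 unfolding 3 by (simp add: diff_eq_eq)
qed

lemma L2comp_fin_edges:
  assumes "\<And>m. m \<in> fin_edges G \<Longrightarrow> continuous_on {0..L m} (h m)"
  shows "L2comp G L (\<lambda>m x. if m \<in> fin_edges G \<and> x \<in> {0..L m} then h m x else 0)"
proof -
  let ?h = "\<lambda>m x. if m \<in> fin_edges G \<and> x \<in> {0..L m} then h m x else 0"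
  have "L2_on (eI G L m) (?h m)" if m: "m \<in> edges G" for m
  proof (cases "m \<in> fin_edges G")
    case True
    have "continuous_on {0..L m} (?h m) \<longleftrightarrow> continuous_on {0..L m} (h m)"
      using True by (intro continuous_on_cong) auto
    then show ?thesis using assms[OF True] by (simp add: eI_fin[OF True] L2_on_continuous)
  next
    case False
    then have "?h m = (\<lambda>x. 0)" by auto
    then show ?thesis by (simp add: L2_on_def set_borel_measurable_def set_integrable_def)
  qed
  then show ?thesis unfolding L2comp_def supp_ok_def
    by (auto simp: eI_fin fun_eq_iff lead_notin_fin dest: fin_edges_subset)
qed

lemma L2comp_lead:
  assumes k: "k \<in> {1..nL G}"
  shows "L2comp G L (\<lambda>m x. if m = k \<and> x \<in> {0..r} then 1 else 0)"
proof -
  have "L2_on (eI G L m) (\<lambda>x. if m = k \<and> x \<in> {0..r} then 1 else 0)" if m: "m \<in> edges G" for m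
  proof (cases "m = k")
    case True
    have "(\<lambda>x. indicator {0..} x *\<^sub>R (if x \<in> {0..r} then 1 else 0 :: complex)) = indicator {0..r}"
      "(\<lambda>x. indicator {0..} x *\<^sub>R (cmod (if x \<in> {0..r} then 1 else 0))\<^sup>2) = (indicator {0..r} :: real \<Rightarrow> real)"
      by (auto simp: indicator_def fun_eq_iff)
    moreover have "integrable lborel (indicator {0..r} :: real \<Rightarrow> real)"
      by (intro integrable_real_indicator) (auto simp: emeasure_lborel_Icc_eq)
    ultimately show ?thesis using True k
      by (simp add: eI_lead L2_on_def set_borel_measurable_def set_integrable_def del: atLeastAtMost_iff)
  next
    case False
    then show ?thesis by (simp add: L2_on_def set_borel_measurable_def set_integrable_def)
  qed
  moreover have "\<exists>R. \<forall>m\<in>edges G. m \<le> nL G \<longrightarrow> (\<forall>x>R. (if m = k \<and> x \<in> {0..r} then 1 else 0) = (0::complex))"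
    by (intro exI[of _ r]) auto
  ultimately show ?thesis unfolding L2comp_def supp_ok_def
    using k lead_in_edges[OF k] by (auto simp: eI_def)
qed

lemma set_integral_eq_integral_cong:
  fixes h :: "real \<Rightarrow> complex"
  assumes "\<And>x. x \<in> {a..b} \<Longrightarrow> g x = h x" "continuous_on {a..b} h"
  shows "(LINT x:{a..b}|lborel. g x) = integral {a..b} h"
proof -
  have "(LINT x:{a..b}|lborel. g x) = (LINT x:{a..b}|lborel. h x)"
    by (intro set_lebesgue_integral_cong) (use assms in auto)
  then show ?thesis
    using set_borel_integral_eq_integral(2)[OF borel_integrable_atLeastAtMost'[OF assms(2)]] by simp
qed

text \<open>The integral over \<open>{0..r}\<close> vanishes only if \<open>\<mu> * r\<close> is a
  multiple of \<open>2 * pi\<close>. The choice \<open>r = 1 / cmod \<mu>\<close> gives it modulus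
  1, which excludes this.\<close>

lemma exp_integral_nonzero:
  assumes "\<mu> \<noteq> 0"
  shows "integral {0..1 / cmod \<mu>} (\<lambda>x. exp (\<i> * \<mu> * of_real x)) \<noteq> 0"
proof
  let ?r = "1 / cmod \<mu>"
  assume 0: "integral {0..?r} (\<lambda>x. exp (\<i> * \<mu> * of_real x)) = 0"
  have "((\<lambda>x. exp (\<i> * \<mu> * of_real x)) has_integral
     exp (\<i> * \<mu> * of_real ?r) / (\<i> * \<mu>) - exp (\<i> * \<mu> * of_real 0) / (\<i> * \<mu>)) {0..?r}"
  proof (rule fundamental_theorem_of_calculus)
    fix x
    show "((\<lambda>x. exp (\<i> * \<mu> * of_real x) / (\<i> * \<mu>)) has_vector_derivative exp (\<i> * \<mu> * of_real x)) (at x within {0..?r})"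
      by (rule has_vector_derivative_real_field) (use assms in \<open>auto intro!: derivative_eq_intros\<close>)
  qed simp
  then have "exp (\<i> * \<mu> * of_real ?r) = 1" using 0 assms by (auto dest!: integral_unique simp: field_simps)
  then obtain n :: int where n: "Re (\<i> * \<mu> * of_real ?r) = 0" "Im (\<i> * \<mu> * of_real ?r) = of_int (2 * n) * pi"
    unfolding exp_eq_1 by blast
  have "cmod (\<i> * \<mu> * of_real ?r) = 1" using assms by (simp add: norm_mult norm_divide)
  then have "\<bar>of_int (2 * n) * pi\<bar> = 1" using n by (metis cmod_eq_Im)
  then have *: "real_of_int (2 * \<bar>n\<bar>) * pi = 1" by (simp add: abs_mult)
  show False
  proof (cases "n = 0")
    case False
    then have "2 \<le> real_of_int (2 * \<bar>n\<bar>)" by linarith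
    then have "2 * pi \<le> real_of_int (2 * \<bar>n\<bar>) * pi" by (intro mult_right_mono) auto
    then show False using * pi_gt3 by linarith
  qed (use * in simp)
qed

lemma not_pole_tendsto:
  assumes "F meromorphic_on UNIV" "\<not> is_pole F \<mu>"
  shows "\<exists>l. (F \<longlongrightarrow> l) (at \<mu>)"
  using assms by (auto simp: meromorphic_on_altdef not_essential_def)

text \<open>Hypothesis \<open>N\<close> says that the source \<open>ew \<nu> p q\<close> is not
  orthogonal to the outgoing state in the bilinear pairing. If no matrix element had a pole at
  \<mu>, the limit of \<open>green_resolvent\<close> would make that pairing zero.\<close>

theorem outgoing_state_resonance:
  fixes \<nu> :: real
  assumes wf: "wf_qgraph G L" and \<mu>: "\<mu> \<noteq> 0" and bc: "bc G L \<mu> a b" and out: "outgoing G b"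
    and pq: "outgoing G p" "outgoing G q"
    and N: "(\<Sum>m\<in>fin_edges G. integral {0..L m} (\<lambda>x. ew \<nu> (p m) (q m) x * ew \<mu> (a m) (b m) x)) \<noteq> 0"
  shows "\<mu> \<in> Res G L"
proof (rule ccontr)
  assume notres: "\<mu> \<notin> Res G L"
  define X where "X = res_coeff G L \<nu> p q"
  define f where "f = gf G L \<nu> p q"
  let ?c = "\<lambda>z. (complex_of_real \<nu>)\<^sup>2 - z\<^sup>2" and ?w = "\<lambda>m. ew \<mu> (a m) (b m)"
  \<comment> \<open>The matrix element against the conjugate of the outgoing state, cut off to the
    finite edges.\<close>
  define F1 where "F1 z = (\<Sum>m\<in>fin_edges G. integral {0..L m} (\<lambda>x.
        (ew \<nu> (p m / ?c z) (q m / ?c z) x + ew z (X z (IA m)) (X z (IB m)) x) * ?w m x))" for z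
  define r where "r = 1 / cmod \<mu>"
  \<comment> \<open>Testing against the indicator of \<open>{0..r}\<close> on lead \<open>k\<close>
    gives the lead amplitude times \<open>Q z\<close>. Since \<open>Q \<mu>\<close> is nonzero,
    regularity of this element controls the amplitude itself.\<close>
  define Q where "Q z = integral {0..r} (\<lambda>x. exp (\<i> * z * of_real x))" for z
  have nz: "(complex_of_real \<nu>)\<^sup>2 \<noteq> z\<^sup>2" if "0 < Im z" for z
    using that by (auto simp: power2_eq_iff dest: arg_cong[of _ _ Im])
  have Xm: "(\<lambda>z. X z i) meromorphic_on UNIV" for i
    unfolding X_def by (rule res_coeff_meromorphic)
  have L2f: "L2comp G L f"
  proof -
    have "f = (\<lambda>m x. if m \<in> fin_edges G \<and> x \<in> {0..L m} then ew \<nu> (p m) (q m) x else 0)"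
      unfolding f_def gf_def using pq by (intro ext) (auto simp: edges_split outgoing_def eI_fin lead_notin_fin)
    then show ?thesis by (simp only:) (intro L2comp_fin_edges continuous_intros)
  qed
  have ucoef: "u m x = ew \<nu> (p m / ?c z) (q m / ?c z) x + ew z (X z (IA m)) (cB G (X z) m) x"
    if "0 < Im z" "solves G L (z\<^sup>2) u f" "m \<in> edges G" "x \<in> eI G L m" for u z m x
    using res_coeff_unique[OF wf that(1) nz[OF that(1)] pq] that unfolding X_def f_def by blast
  have Qh: "Q holomorphic_on UNIV"
    using exp_integral_holomorphic[of r "\<lambda>_. 1" \<i>] by (simp add: Q_def[abs_def])

  have F1m: "F1 meromorphic_on UNIV"
  proof -
    have "F1 z = (\<Sum>m\<in>fin_edges G. (1 / ?c z) * integral {0..L m} (\<lambda>x. ew \<nu> (p m) (q m) x * ?w m x)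
       + (X z (IA m) * integral {0..L m} (\<lambda>x. exp (\<i> * z * of_real x) * ?w m x)
       + X z (IB m) * integral {0..L m} (\<lambda>x. exp ((- \<i>) * z * of_real x) * ?w m x)))" for z
      unfolding F1_def
    proof (rule sum.cong[OF refl])
      fix m
      have "ew \<nu> (p m / ?c z) (q m / ?c z) x = (1 / ?c z) * ew \<nu> (p m) (q m) x" for x
        unfolding ew_scale[symmetric] by simp
      then have "(\<lambda>x. (ew \<nu> (p m / ?c z) (q m / ?c z) x + ew z (X z (IA m)) (X z (IB m)) x) * ?w m x) =
        (\<lambda>x. (1 / ?c z) * (ew \<nu> (p m) (q m) x * ?w m x) +
          (X z (IA m) * (exp (\<i> * z * of_real x) * ?w m x) + X z (IB m) * (exp ((- \<i>) * z * of_real x) * ?w m x)))"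
        by (intro ext) (simp add: ew_def[of z] algebra_simps)
      moreover have "(\<lambda>x. (1 / ?c z) * (ew \<nu> (p m) (q m) x * ?w m x)) integrable_on {0..L m}"
        "(\<lambda>x. X z (IA m) * (exp (\<i> * z * of_real x) * ?w m x)) integrable_on {0..L m}"
        "(\<lambda>x. X z (IB m) * (exp ((- \<i>) * z * of_real x) * ?w m x)) integrable_on {0..L m}"
        by (intro integrable_continuous_interval continuous_intros)+
      ultimately show "integral {0..L m} (\<lambda>x. (ew \<nu> (p m / ?c z) (q m / ?c z) x + ew z (X z (IA m)) (X z (IB m)) x) * ?w m x) =
        (1 / ?c z) * integral {0..L m} (\<lambda>x. ew \<nu> (p m) (q m) x * ?w m x)
       + (X z (IA m) * integral {0..L m} (\<lambda>x. exp (\<i> * z * of_real x) * ?w m x)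
       + X z (IB m) * integral {0..L m} (\<lambda>x. exp ((- \<i>) * z * of_real x) * ?w m x))"
        by (simp only: integral_add integrable_add integral_mult_right)
    qed
    then have "F1 = (\<lambda>z. \<Sum>m\<in>fin_edges G. (1 / ?c z) * integral {0..L m} (\<lambda>x. ew \<nu> (p m) (q m) x * ?w m x)
       + (X z (IA m) * integral {0..L m} (\<lambda>x. exp (\<i> * z * of_real x) * ?w m x)
       + X z (IB m) * integral {0..L m} (\<lambda>x. exp ((- \<i>) * z * of_real x) * ?w m x)))" by (rule ext)
    then show ?thesis
      by (simp only:) (intro meromorphic_intros Xm entire_meromorphic[OF exp_integral_holomorphic] continuous_intros)
  qed
  have np1: "\<not> is_pole F1 \<mu>"
  proof
    assume pole: "is_pole F1 \<mu>"
    let ?g = "\<lambda>m x. if m \<in> fin_edges G \<and> x \<in> {0..L m} then cnj (?w m x) else 0"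
    have "F1 z = ip G L u ?g" if z: "0 < Im z" and u: "solves G L (z\<^sup>2) u f" for z u
    proof -
      have "(LINT x:eI G L m|lborel. u m x * cnj (?g m x)) = 0" if "m \<in> {1..nL G}" for m
        using that lead_notin_fin[of m G] by simp
      moreover have "(LINT x:eI G L m|lborel. u m x * cnj (?g m x)) = integral {0..L m} (\<lambda>x.
        (ew \<nu> (p m / ?c z) (q m / ?c z) x + ew z (X z (IA m)) (X z (IB m)) x) * ?w m x)" if m: "m \<in> fin_edges G" for m
        unfolding eI_fin[OF m]
        by (rule set_integral_eq_integral_cong)
           (use m ucoef[OF z u fin_edges_subset[OF m]] in \<open>auto simp: eI_fin[OF m] cB_def intro!: continuous_intros\<close>)
      ultimately show ?thesis unfolding ip_def sum_edges_split F1_def by simp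
    qed
    moreover have "L2comp G L ?g" by (intro L2comp_fin_edges continuous_intros)
    ultimately show False using notres L2f F1m pole unfolding Res_def by blast
  qed
  have np2: "\<not> is_pole (\<lambda>z. X z (IA k) * Q z) \<mu>" if k: "k \<in> {1..nL G}" for k
  proof
    assume pole: "is_pole (\<lambda>z. X z (IA k) * Q z) \<mu>"
    let ?g = "\<lambda>m x. if m = k \<and> x \<in> {0..r} then 1 else 0"
    have "X z (IA k) * Q z = ip G L u ?g" if z: "0 < Im z" and u: "solves G L (z\<^sup>2) u f" for z u
    proof -
      have "ip G L u ?g = (\<Sum>m\<in>edges G. if m = k then (LINT x:eI G L k|lborel. u k x * cnj (?g k x)) else 0)"
        unfolding ip_def by (intro sum.cong) auto
      also have "\<dots> = (LINT x:{0..}|lborel. u k x * cnj (?g k x))"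
        using lead_in_edges[OF k] by (simp add: eI_lead[OF k])
      also have "\<dots> = (LINT x:{0..r}|lborel. u k x)"
        unfolding set_lebesgue_integral_def by (intro Bochner_Integration.integral_cong) (auto simp: indicator_def)
      also have "\<dots> = integral {0..r} (\<lambda>x. X z (IA k) * exp (\<i> * z * of_real x))"
      proof (rule set_integral_eq_integral_cong)
        fix x assume x: "x \<in> {0..r}"
        have "p k = 0" "q k = 0" "cB G (X z) k = 0"
          using pq k lead_notin_fin[of k G] by (auto simp: outgoing_def cB_def)
        then show "u k x = X z (IA k) * exp (\<i> * z * of_real x)"
          using ucoef[OF z u lead_in_edges[OF k], of x] x k by (simp add: eI_lead ew_def)
      qed (intro continuous_intros)
      finally show ?thesis by (simp add: Q_def)
    qed
    moreover have "L2comp G L ?g" by (rule L2comp_lead[OF k])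
    moreover have "(\<lambda>z. X z (IA k) * Q z) meromorphic_on UNIV"
      by (intro meromorphic_intros Xm entire_meromorphic Qh)
    ultimately show False using notres L2f pole unfolding Res_def by blast
  qed

  have Q0: "Q \<mu> \<noteq> 0" unfolding Q_def r_def by (rule exp_integral_nonzero[OF \<mu>])
  have Qt: "(Q \<longlongrightarrow> Q \<mu>) (at \<mu>)"
    using Qh by (metis UNIV_I continuous_on_eq_continuous_at holomorphic_on_imp_continuous_on isCont_def open_UNIV)
  obtain l1 where l1: "(F1 \<longlongrightarrow> l1) (at \<mu>)" using not_pole_tendsto[OF F1m np1] by blast
  have "\<exists>l. ((\<lambda>z. X z (IA k)) \<longlongrightarrow> l) (at \<mu>)" if k: "k \<in> {1..nL G}" for k
  proof -
    have "(\<lambda>z. X z (IA k) * Q z) meromorphic_on UNIV"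
      by (intro meromorphic_intros Xm entire_meromorphic Qh)
    then obtain l where "((\<lambda>z. X z (IA k) * Q z) \<longlongrightarrow> l) (at \<mu>)"
      using not_pole_tendsto[OF _ np2[OF k]] by blast
    then have "((\<lambda>z. X z (IA k) * Q z / Q z) \<longlongrightarrow> l / Q \<mu>) (at \<mu>)"
      by (intro tendsto_divide Qt Q0)
    moreover have "eventually (\<lambda>z. X z (IA k) * Q z / Q z = X z (IA k)) (at \<mu>)"
      using tendsto_imp_eventually_ne[OF Qt Q0] by eventually_elim simp
    ultimately show ?thesis by (blast intro: Lim_transform_eventually)
  qed
  then obtain l where l: "\<And>k. k \<in> {1..nL G} \<Longrightarrow> ((\<lambda>z. X z (IA k)) \<longlongrightarrow> l k) (at \<mu>)" by metis
  let ?N = "\<Sum>m\<in>fin_edges G. integral {0..L m} (\<lambda>x. ew \<nu> (p m) (q m) x * ?w m x)"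
  \<comment> \<open>\<open>F1\<close> and the amplitudes have finite limits and their prefactors
    tend to 0.\<close>
  have "((\<lambda>z. (\<mu>\<^sup>2 - z\<^sup>2) * F1 z + \<i> * (\<mu> - z) * (\<Sum>k=1..nL G. X z (IA k) * a k)) \<longlongrightarrow>
      (\<mu>\<^sup>2 - \<mu>\<^sup>2) * l1 + \<i> * (\<mu> - \<mu>) * (\<Sum>k=1..nL G. l k * a k)) (at \<mu>)"
    by (intro tendsto_intros l1 l)
  then have lim0: "((\<lambda>z. (\<mu>\<^sup>2 - z\<^sup>2) * F1 z + \<i> * (\<mu> - z) * (\<Sum>k=1..nL G. X z (IA k) * a k)) \<longlongrightarrow> 0) (at \<mu>)"
    by simp
  \<comment> \<open>The exceptional points of \<open>green_resolvent\<close> are zeros of entire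
    functions that do not vanish at \<open>\<i>\<close>, hence isolated.\<close>
  have "eventually (\<lambda>z. ddet (ixs G) (gm G L z) \<noteq> 0 \<and> z \<in> UNIV) (at \<mu>)"
    by (rule non_zero_neighbour_alt[of _ UNIV _ \<i>])
       (auto intro!: ddet_holomorphic gm_holomorphic simp: gm_det_nonzero_upper[OF wf])
  moreover have "eventually (\<lambda>z. (complex_of_real \<nu>)\<^sup>2 - z\<^sup>2 \<noteq> 0 \<and> z \<in> UNIV) (at \<mu>)"
    using nz[of \<i>] by (intro non_zero_neighbour_alt[of _ UNIV _ \<i>]) (auto intro!: holomorphic_intros simp: eq_neg_iff_add_eq_0)
  moreover have "eventually (\<lambda>z. z \<noteq> 0 \<and> z \<in> UNIV) (at \<mu>)"
    by (intro non_zero_neighbour_alt[of _ UNIV _ \<i>]) (auto intro!: holomorphic_intros)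
  ultimately have "eventually (\<lambda>z. (\<mu>\<^sup>2 - z\<^sup>2) * F1 z + \<i> * (\<mu> - z) * (\<Sum>k=1..nL G. X z (IA k) * a k) = ?N) (at \<mu>)"
    unfolding F1_def X_def by eventually_elim (rule green_resolvent[OF wf _ _ _ pq bc out]; simp)
  then have "((\<lambda>z. ?N) \<longlongrightarrow> 0) (at \<mu>)" using lim0 by (simp add: tendsto_cong)
  then have "?N = 0" by (simp add: tendsto_const_iff)
  then show False using N by simp
qed

section \<open>Smoothness of implicitly defined functions\<close>

text \<open>A real parameter and a complex unknown: the partial derivative in the unknown is
  multiplication by \<open>Dz\<close>, so invertibility just means that \<open>Dz\<close> is
  nonzero.\<close>

lemma implicit_function:
  fixes D Dt Dz :: "real \<times> complex \<Rightarrow> complex"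
  assumes der: "\<And>x. (D has_derivative (\<lambda>h. of_real (fst h) * Dt x + snd h * Dz x)) (at x)"
    and ct: "continuous_on UNIV Dt" and cz: "continuous_on UNIV Dz"
    and D0: "D (s0, z0) = 0" and Dz0: "Dz (s0, z0) \<noteq> 0"
  shows "\<exists>d>0. \<exists>l. l s0 = z0 \<and> (\<forall>t. \<bar>t - s0\<bar> < d \<longrightarrow> D (t, l t) = 0 \<and> Dz (t, l t) \<noteq> 0 \<and>
    (l has_vector_derivative - (Dt (t, l t) / Dz (t, l t))) (at t))"
proof -
  \<comment> \<open>Keeping the parameter as a second output turns \<open>D\<close> into a local
    diffeomorphism; its inverse maps \<open>(t, 0)\<close> to the zero set of
    \<open>D\<close>.\<close>
  define f where "f x = (fst x, D x)" for x :: "real \<times> complex"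
  define F where "F x h = (fst h, of_real (fst h) * Dt x + snd h * Dz x)" for x and h :: "real \<times> complex"
  have derf: "(f has_derivative F x) (at x)" for x
    unfolding f_def[abs_def] F_def[abs_def] by (intro has_derivative_Pair der has_derivative_fst has_derivative_ident)
  have blF: "bounded_linear (F x)" for x using derf[of x] by (rule has_derivative_bounded_linear)
  define f' where "f' x = Blinfun (F x)" for x
  have f': "blinfun_apply (f' x) = F x" for x
    unfolding f'_def by (rule bounded_linear_Blinfun_apply[OF blF])
  have contf: "continuous_on UNIV f'"
    unfolding continuous_on_eq_continuous_within
  proof (intro ballI continuous_blinfun_componentwiseI1)
    fix x :: "real \<times> complex" and h :: "real \<times> complex"
    show "continuous (at x within UNIV) (\<lambda>x. blinfun_apply (f' x) h)"
      unfolding f' F_def using ct cz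
      by (cases x, intro continuous_intros) (simp_all add: continuous_on_eq_continuous_within)
  qed
  define G where "G h = (fst h, (snd h - of_real (fst h) * Dt (s0, z0)) / Dz (s0, z0))" for h :: "real \<times> complex"
  have blG: "bounded_linear G"
  proof -
    have "bounded_linear (\<lambda>h :: real \<times> complex. (fst h, (snd h - of_real (fst h) * Dt (s0, z0)) * (1 / Dz (s0, z0))))"
      by (intro bounded_linear_Pair bounded_linear_fst bounded_linear_compose[OF bounded_linear_mult_left]
          bounded_linear_sub bounded_linear_snd bounded_linear_compose[OF bounded_linear_of_real])
    then show ?thesis by (simp add: G_def[abs_def])
  qed
  have inv: "Blinfun G o\<^sub>L f' (s0, z0) = id_blinfun"
    by (rule blinfun_eqI) (simp add: f' bounded_linear_Blinfun_apply[OF blG] G_def F_def Dz0)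
  obtain U V g g' where g: "open U" "(s0, z0) \<in> U" "open V" "f (s0, z0) \<in> V" "homeomorphism U V f g"
    "\<And>y. y \<in> V \<Longrightarrow> (g has_derivative (g' y)) (at y)"
    "\<And>y. y \<in> V \<Longrightarrow> bij (blinfun_apply (f' (g y)))"
    using inverse_function_theorem[of UNIV f f' "(s0, z0)" "Blinfun G"] derf contf inv
    by (simp add: f') metis
  have "(s0, 0) \<in> V" using g(4) by (simp add: f_def D0)
  then obtain e where e: "e > 0" "ball (s0, 0) e \<subseteq> V" using g(3) openE by blast
  have inV: "(t, 0) \<in> V" if "\<bar>t - s0\<bar> < e" for t
  proof -
    have "dist (s0, 0::complex) (t, 0) < e" using that by (simp add: dist_Pair_Pair dist_real_def abs_minus_commute)
    then show ?thesis using e(2) by auto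
  qed
  define l where "l t = snd (g (t, 0))" for t
  have fg: "g (t, 0) = (t, l t)" "D (t, l t) = 0" if "\<bar>t - s0\<bar> < e" for t
  proof -
    have "f (g (t, 0)) = (t, 0)" using homeomorphism_apply2[OF g(5) inV[OF that]] .
    then show "g (t, 0) = (t, l t)" "D (t, l t) = 0"
      by (auto simp: f_def l_def prod_eq_iff) (metis prod.collapse)
  qed
  have l0: "l s0 = z0"
    using homeomorphism_apply1[OF g(5) g(2)] by (simp add: l_def f_def D0)
  \<comment> \<open>Where \<open>Dz\<close> vanishes, the derivative of \<open>f\<close> kills the
    direction \<open>(0, 1)\<close> and is not injective.\<close>
  have Dzl: "Dz (t, l t) \<noteq> 0" if t: "\<bar>t - s0\<bar> < e" for t
  proof
    assume "Dz (t, l t) = 0"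
    then have "F (t, l t) (0, 1) = F (t, l t) (0, 0)" by (simp add: F_def)
    moreover have "inj (F (t, l t))" using g(7)[OF inV[OF t]] fg(1)[OF t] by (simp add: f' bij_def)
    ultimately have "(0 :: real, 1 :: complex) = (0, 0)" by (rule injD[rotated])
    then show False by simp
  qed
  have lder: "(l has_vector_derivative - (Dt (t, l t) / Dz (t, l t))) (at t)" if t: "\<bar>t - s0\<bar> < e" for t
  proof -
    have p: "((\<lambda>t. (t, 0::complex)) has_derivative (\<lambda>s. (s, 0))) (at t)"
      by (intro has_derivative_Pair has_derivative_ident has_derivative_const)
    have "((\<lambda>t. snd (g (t, 0))) has_derivative (\<lambda>s. snd (g' (t, 0) (s, 0)))) (at t)"
      by (rule has_derivative_snd[OF has_derivative_compose[OF p g(6)[OF inV[OF t]]]])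
    then have "l differentiable (at t)" by (auto simp: l_def[abs_def] differentiable_def)
    then obtain l' where l': "(l has_vector_derivative l') (at t)"
      using vector_derivative_works by blast
    have pair: "((\<lambda>t. (t, l t)) has_derivative (\<lambda>s. (s, s *\<^sub>R l'))) (at t)"
      using l' by (intro has_derivative_Pair has_derivative_ident) (simp add: has_vector_derivative_def)
    have "((\<lambda>t. D (t, l t)) has_derivative (\<lambda>s. of_real s * Dt (t, l t) + (s *\<^sub>R l') * Dz (t, l t))) (at t)"
      using has_derivative_compose[OF pair der[of "(t, l t)"]] by simp
    moreover have "((\<lambda>t. D (t, l t)) has_derivative (\<lambda>s. 0)) (at t)"
    proof (rule has_derivative_transform_within_open[OF has_derivative_const[of 0]])
      show "open {s0 - e<..<s0 + e}" "t \<in> {s0 - e<..<s0 + e}" using t by auto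
      show "0 = D (x, l x)" if "x \<in> {s0 - e<..<s0 + e}" for x using fg(2)[of x] that by auto
    qed
    ultimately have "(\<lambda>s. of_real s * Dt (t, l t) + (s *\<^sub>R l') * Dz (t, l t)) = (\<lambda>s. 0)"
      by (rule has_derivative_unique)
    from fun_cong[OF this, of 1] have "l' = - (Dt (t, l t) / Dz (t, l t))"
      using Dzl[OF t] by (simp add: field_simps eq_neg_iff_add_eq_0)
    then show ?thesis using l' by simp
  qed
  show ?thesis using e(1) l0 fg(2) Dzl lder by blast
qed

text \<open>Iterated derivatives stay in a class closed under differentiation. They agree with its
  members only on \<open>T\<close>; openness of \<open>T\<close> makes this enough to differentiate
  again.\<close>

lemma smooth_onI_closed:
  assumes T: "open T" and f: "f \<in> Q"
    and Q: "\<And>q. q \<in> Q \<Longrightarrow> \<exists>q'\<in>Q. \<forall>t\<in>T. (q has_vector_derivative q' t) (at t)"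
  shows "smooth_on T f"
proof -
  have "\<exists>q\<in>Q. \<forall>t\<in>T. vderivs n f t = q t" for n
  proof (induction n)
    case 0
    then show ?case using f by auto
  next
    case (Suc n)
    then obtain q where q: "q \<in> Q" "\<And>t. t \<in> T \<Longrightarrow> vderivs n f t = q t" by blast
    obtain q' where q': "q' \<in> Q" "\<And>t. t \<in> T \<Longrightarrow> (q has_vector_derivative q' t) (at t)" using Q[OF q(1)] by blast
    have "vderivs (Suc n) f t = q' t" if "t \<in> T" for t
      using has_vector_derivative_transform_within_open[OF q'(2)[OF that] T that] q(2)
      by (simp add: vector_derivative_at)
    then show ?case using q'(1) by blast
  qed
  then show ?thesis unfolding smooth_on_def
  proof (intro allI ballI)
    fix n t assume t: "t \<in> T" and *: "\<And>n. \<exists>q\<in>Q. \<forall>t\<in>T. vderivs n f t = q t"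
    obtain q where q: "q \<in> Q" "\<And>t. t \<in> T \<Longrightarrow> vderivs n f t = q t" using * by blast
    obtain q' where q': "(q has_vector_derivative q' t) (at t)" using Q[OF q(1)] t by blast
    then have "(vderivs n f has_vector_derivative q' t) (at t)"
      using has_vector_derivative_transform_within_open[OF q' T t] q(2) by simp
    then show "vderivs n f differentiable (at t)"
      by (auto simp: has_vector_derivative_def differentiable_def)
  qed
qed

text \<open>The functions of \<open>(t, z)\<close> from which the secular determinant is built; the class is closed
  under both partial derivatives.\<close>

inductive_set TZ :: "(real \<Rightarrow> real) set \<Rightarrow> (real \<times> complex \<Rightarrow> complex) set" for S where
  const: "(\<lambda>x. c) \<in> TZ S"
| freq: "snd \<in> TZ S"
| coef: "h \<in> S \<Longrightarrow> (\<lambda>x. of_real (vderivs n h (fst x))) \<in> TZ S"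
| scale: "h \<in> S \<Longrightarrow> (\<lambda>x. of_real (exp (- h (fst x)))) \<in> TZ S"
| expo: "h \<in> S \<Longrightarrow> (\<lambda>x. exp (c * snd x * of_real (exp (- h (fst x))))) \<in> TZ S"
| add: "F \<in> TZ S \<Longrightarrow> H \<in> TZ S \<Longrightarrow> (\<lambda>x. F x + H x) \<in> TZ S"
| mult: "F \<in> TZ S \<Longrightarrow> H \<in> TZ S \<Longrightarrow> (\<lambda>x. F x * H x) \<in> TZ S"

lemma smooth_has_derivative:
  fixes h :: "real \<Rightarrow> real"
  assumes "smooth_on UNIV h"
  shows "(vderivs n h has_real_derivative vderivs (Suc n) h t) (at t)"
proof -
  have "vderivs n h differentiable (at t)" using assms by (simp add: smooth_on_def)
  then show ?thesis
    by (simp add: has_real_derivative_iff_has_vector_derivative vector_derivative_works)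
qed

lemma TZ_has_derivative:
  assumes S: "\<And>h. h \<in> S \<Longrightarrow> smooth_on UNIV h" and "F \<in> TZ S"
  shows "\<exists>Ft\<in>TZ S. \<exists>Fz\<in>TZ S. \<forall>x. (F has_derivative (\<lambda>h. of_real (fst h) * Ft x + snd h * Fz x)) (at x)"
  using assms(2)
proof induction
  case (const c)
  show ?case by (intro bexI[OF _ TZ.const[of 0]] bexI[OF _ TZ.const[of 0]]) simp
next
  case freq
  have "(snd has_derivative (\<lambda>h. of_real (fst h) * 0 + snd h * 1)) (at x)" for x :: "real \<times> complex"
    by (auto intro!: derivative_eq_intros)
  then show ?case by (intro bexI[OF _ TZ.const[of 0]] bexI[OF _ TZ.const[of 1]] allI)
next
  case (coef h n)
  have hd: "(vderivs n h has_real_derivative vderivs (Suc n) h t) (at t)" for t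
    by (rule smooth_has_derivative[OF S[OF coef]])
  have "((\<lambda>x. of_real (vderivs n h (fst x))) has_derivative
      (\<lambda>s. of_real (fst s) * of_real (vderivs (Suc n) h (fst x)) + snd s * 0)) (at x)" for x :: "real \<times> complex"
    using has_derivative_of_real[OF has_derivative_compose[OF has_derivative_fst[OF has_derivative_ident] hd[unfolded has_field_derivative_def]], of x UNIV]
    by (simp add: mult.commute)
  then show ?case by (intro bexI[OF _ TZ.coef[OF coef]] bexI[OF _ TZ.const[of 0]] allI)
next
  case (scale h)
  have hd: "(h has_real_derivative vderivs (Suc 0) h t) (at t)" for t
    using smooth_has_derivative[OF S[OF scale], of 0] by simp
  have hd': "((\<lambda>t. exp (- h t)) has_real_derivative - (vderivs (Suc 0) h t) * exp (- h t)) (at t)" for t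
    by (auto intro!: derivative_eq_intros hd)
  have "((\<lambda>x. of_real (exp (- h (fst x)))) has_derivative
      (\<lambda>s. of_real (fst s) * ((- 1) * of_real (vderivs (Suc 0) h (fst x)) * of_real (exp (- h (fst x)))) + snd s * 0)) (at x)" for x :: "real \<times> complex"
    using has_derivative_of_real[OF has_derivative_compose[OF has_derivative_fst[OF has_derivative_ident] hd'[unfolded has_field_derivative_def]], of x UNIV]
    by (simp add: ac_simps)
  then show ?case
    by (intro bexI[OF _ TZ.mult[OF TZ.mult[OF TZ.const[of "- 1"] TZ.coef[OF scale]] TZ.scale[OF scale]]] bexI[OF _ TZ.const[of 0]] allI)
next
  case (expo h c)
  have hd: "(h has_real_derivative vderivs (Suc 0) h t) (at t)" for t
    using smooth_has_derivative[OF S[OF expo], of 0] by simp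
  have hd': "((\<lambda>t. exp (- h t)) has_real_derivative - (vderivs (Suc 0) h t) * exp (- h t)) (at t)" for t
    by (auto intro!: derivative_eq_intros hd)
  have e: "((\<lambda>x. complex_of_real (exp (- h (fst x)))) has_derivative
      (\<lambda>s. - (of_real (fst s) * (of_real (vderivs (Suc 0) h (fst x)) * of_real (exp (- h (fst x))))))) (at x)" for x :: "real \<times> complex"
    using has_derivative_of_real[OF has_derivative_compose[OF has_derivative_fst[OF has_derivative_ident] hd'[unfolded has_field_derivative_def]], of x UNIV]
    by (simp add: ac_simps)
  let ?e = "\<lambda>x. complex_of_real (exp (- h (fst x)))" and ?v = "\<lambda>x. complex_of_real (vderivs (Suc 0) h (fst x))"
    and ?E = "\<lambda>x. exp (c * snd x * complex_of_real (exp (- h (fst x))))"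
  have arg: "((\<lambda>x. c * snd x * ?e x) has_derivative
      (\<lambda>s. c * snd x * (- (of_real (fst s) * (?v x * ?e x))) + c * snd s * ?e x)) (at x)" for x :: "real \<times> complex"
    by (intro has_derivative_mult has_derivative_mult_right has_derivative_snd has_derivative_ident e)
  have "(?E has_derivative
      (\<lambda>s. of_real (fst s) * (((- c) * snd x) * (?v x * (?e x * ?E x))) + snd s * (c * (?e x * ?E x)))) (at x)" for x :: "real \<times> complex"
  proof -
    have "(exp has_derivative (*) (exp (c * snd x * ?e x))) (at (c * snd x * ?e x))"
      using DERIV_exp[of "c * snd x * ?e x"] by (simp add: has_field_derivative_def)
    from has_derivative_compose[OF arg[of x] this] show ?thesis
      by (rule has_derivative_eq_rhs) (auto simp: fun_eq_iff algebra_simps)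
  qed
  moreover have "(\<lambda>x. ((- c) * snd x) * (?v x * (?e x * ?E x))) \<in> TZ S" "(\<lambda>x. c * (?e x * ?E x)) \<in> TZ S"
    by (intro TZ.mult TZ.const TZ.freq TZ.coef TZ.scale TZ.expo expo)+
  ultimately show ?case
    by (intro bexI[of _ "\<lambda>x. ((- c) * snd x) * (?v x * (?e x * ?E x))"] bexI[of _ "\<lambda>x. c * (?e x * ?E x)"]) auto
next
  case (add F H)
  then obtain Ft Fz Ht Hz where *: "Ft \<in> TZ S" "Fz \<in> TZ S" "Ht \<in> TZ S" "Hz \<in> TZ S"
    "\<And>x. (F has_derivative (\<lambda>h. of_real (fst h) * Ft x + snd h * Fz x)) (at x)"
    "\<And>x. (H has_derivative (\<lambda>h. of_real (fst h) * Ht x + snd h * Hz x)) (at x)" by blast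
  have "((\<lambda>x. F x + H x) has_derivative (\<lambda>h. of_real (fst h) * (Ft x + Ht x) + snd h * (Fz x + Hz x))) (at x)" for x
    by (rule has_derivative_eq_rhs, rule has_derivative_add[OF *(5,6)]) (auto simp: fun_eq_iff algebra_simps)
  then show ?case by (intro bexI[OF _ TZ.add[OF *(1,3)]] bexI[OF _ TZ.add[OF *(2,4)]] allI)
next
  case (mult F H)
  then obtain Ft Fz Ht Hz where *: "Ft \<in> TZ S" "Fz \<in> TZ S" "Ht \<in> TZ S" "Hz \<in> TZ S"
    "\<And>x. (F has_derivative (\<lambda>h. of_real (fst h) * Ft x + snd h * Fz x)) (at x)"
    "\<And>x. (H has_derivative (\<lambda>h. of_real (fst h) * Ht x + snd h * Hz x)) (at x)" by blast
  have "((\<lambda>x. F x * H x) has_derivative (\<lambda>h. of_real (fst h) * (Ft x * H x + F x * Ht x) + snd h * (Fz x * H x + F x * Hz x))) (at x)" for x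
    by (rule has_derivative_eq_rhs, rule has_derivative_mult[OF *(5,6)]) (auto simp: fun_eq_iff algebra_simps)
  then show ?case
    by (intro bexI[OF _ TZ.add[OF TZ.mult[OF *(1) mult.hyps(2)] TZ.mult[OF mult.hyps(1) *(3)]]]
      bexI[OF _ TZ.add[OF TZ.mult[OF *(2) mult.hyps(2)] TZ.mult[OF mult.hyps(1) *(4)]]] allI)
qed

lemma TZ_continuous:
  assumes "\<And>h. h \<in> S \<Longrightarrow> smooth_on UNIV h" "F \<in> TZ S"
  shows "continuous_on UNIV F"
  unfolding continuous_on_eq_continuous_within
proof
  fix x
  obtain F' where "(F has_derivative F') (at x)" using TZ_has_derivative[OF assms] by blast
  then show "continuous (at x within UNIV) F" by (rule has_derivative_continuous)
qed

lemma has_vector_derivative_along_curve: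
  assumes F: "(F has_derivative (\<lambda>h. of_real (fst h) * A + snd h * B)) (at (t, l t))"
    and l: "(l has_vector_derivative l') (at t)"
  shows "((\<lambda>t. F (t, l t)) has_vector_derivative (A + l' * B :: complex)) (at t)"
proof -
  have pair: "((\<lambda>t. (t, l t)) has_derivative (\<lambda>s. (s, s *\<^sub>R l'))) (at t)"
    using l by (intro has_derivative_Pair has_derivative_ident) (simp add: has_vector_derivative_def)
  show ?thesis
    using has_derivative_compose[OF pair F]
    by (simp add: has_vector_derivative_def scaleR_conv_of_real algebra_simps)
qed

text \<open>Here \<open>D\<close> becomes the partial derivative \<open>Dz\<close> of the secular
  function. Implicit differentiation gives \<open>l' = - Dt / Dz\<close>, so polynomials in
  \<open>1 / Dz\<close> and \<open>TZ\<close> functions along the curve are closed under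
  differentiation.\<close>

inductive_set curveQ :: "(real \<Rightarrow> real) set \<Rightarrow> (real \<times> complex \<Rightarrow> complex) \<Rightarrow> (real \<Rightarrow> complex) \<Rightarrow> (real \<Rightarrow> complex) set"
  for S D l where
  base: "F \<in> TZ S \<Longrightarrow> (\<lambda>t. F (t, l t)) \<in> curveQ S D l"
| inv: "(\<lambda>t. inverse (D (t, l t))) \<in> curveQ S D l"
| add: "f \<in> curveQ S D l \<Longrightarrow> g \<in> curveQ S D l \<Longrightarrow> (\<lambda>t. f t + g t) \<in> curveQ S D l"
| mult: "f \<in> curveQ S D l \<Longrightarrow> g \<in> curveQ S D l \<Longrightarrow> (\<lambda>t. f t * g t) \<in> curveQ S D l"

lemma curveQ_derivative:
  assumes S: "\<And>h. h \<in> S \<Longrightarrow> smooth_on UNIV h" and Dt: "Dt \<in> TZ S" and Dz: "Dz \<in> TZ S"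
    and nz: "\<And>t. t \<in> T \<Longrightarrow> Dz (t, l t) \<noteq> 0"
    and l: "\<And>t. t \<in> T \<Longrightarrow> (l has_vector_derivative - (Dt (t, l t) / Dz (t, l t))) (at t)"
    and q: "q \<in> curveQ S Dz l"
  shows "\<exists>q'\<in>curveQ S Dz l. \<forall>t\<in>T. (q has_vector_derivative q' t) (at t)"
  using q
proof induction
  case (base F)
  obtain Ft Fz where F: "Ft \<in> TZ S" "Fz \<in> TZ S"
    "\<And>x. (F has_derivative (\<lambda>h. of_real (fst h) * Ft x + snd h * Fz x)) (at x)"
    using TZ_has_derivative[OF S base] by blast
  let ?q = "\<lambda>t. Ft (t, l t) + ((- 1) * (Dt (t, l t) * inverse (Dz (t, l t)))) * Fz (t, l t)"
  have "?q \<in> curveQ S Dz l"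
    by (intro curveQ.add curveQ.mult curveQ.base[OF F(1)] curveQ.base[OF F(2)] curveQ.base[OF Dt]
        curveQ.base[OF TZ.const] curveQ.inv)
  moreover have "((\<lambda>t. F (t, l t)) has_vector_derivative ?q t) (at t)" if "t \<in> T" for t
    using has_vector_derivative_along_curve[of F "Ft (t, l t)" "Fz (t, l t)" t l, OF F(3) l[OF that]]
    by (simp add: divide_inverse)
  ultimately show ?case by (intro bexI[of _ ?q]) auto
next
  case inv
  obtain Ft Fz where F: "Ft \<in> TZ S" "Fz \<in> TZ S"
    "\<And>x. (Dz has_derivative (\<lambda>h. of_real (fst h) * Ft x + snd h * Fz x)) (at x)"
    using TZ_has_derivative[OF S Dz] by blast
  let ?d = "\<lambda>t. Ft (t, l t) + ((- 1) * (Dt (t, l t) * inverse (Dz (t, l t)))) * Fz (t, l t)"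
  let ?q = "\<lambda>t. (- 1) * (?d t * (inverse (Dz (t, l t)) * inverse (Dz (t, l t))))"
  have "?q \<in> curveQ S Dz l"
    by (intro curveQ.add curveQ.mult curveQ.base[OF F(1)] curveQ.base[OF F(2)] curveQ.base[OF Dt]
        curveQ.base[OF TZ.const] curveQ.inv)
  moreover have "((\<lambda>t. inverse (Dz (t, l t))) has_vector_derivative ?q t) (at t)" if t: "t \<in> T" for t
  proof -
    have d: "((\<lambda>t. Dz (t, l t)) has_vector_derivative ?d t) (at t)"
      using has_vector_derivative_along_curve[of Dz "Ft (t, l t)" "Fz (t, l t)" t l, OF F(3) l[OF t]]
      by (simp add: divide_inverse)
    have i: "(inverse has_field_derivative - (inverse (Dz (t, l t)) ^ Suc (Suc 0))) (at (Dz (t, l t)))"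
      by (rule DERIV_inverse[OF nz[OF t]])
    show ?thesis
      using field_vector_diff_chain_at[OF d i] by (simp add: o_def mult.assoc)
  qed
  ultimately show ?case by (intro bexI[of _ ?q]) auto
next
  case (add f g)
  then obtain f' g' where *: "f' \<in> curveQ S Dz l" "g' \<in> curveQ S Dz l"
    "\<And>t. t \<in> T \<Longrightarrow> (f has_vector_derivative f' t) (at t)" "\<And>t. t \<in> T \<Longrightarrow> (g has_vector_derivative g' t) (at t)"
    by blast
  have "\<forall>t\<in>T. ((\<lambda>t. f t + g t) has_vector_derivative f' t + g' t) (at t)"
    using has_vector_derivative_add[OF *(3,4)] by simp
  then show ?case by (rule bexI[OF _ curveQ.add[OF *(1,2)]])
next
  case (mult f g)
  then obtain f' g' where *: "f' \<in> curveQ S Dz l" "g' \<in> curveQ S Dz l"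
    "\<And>t. t \<in> T \<Longrightarrow> (f has_vector_derivative f' t) (at t)" "\<And>t. t \<in> T \<Longrightarrow> (g has_vector_derivative g' t) (at t)"
    by blast
  have "\<forall>t\<in>T. ((\<lambda>t. f t * g t) has_vector_derivative f t * g' t + f' t * g t) (at t)"
    using has_vector_derivative_mult[OF *(3,4)] by simp
  then show ?case
    by (rule bexI[OF _ curveQ.add[OF curveQ.mult[OF mult.hyps(1) *(2)] curveQ.mult[OF *(1) mult.hyps(2)]]])
qed

lemma smooth_implicit_function:
  assumes S: "\<And>h. h \<in> S \<Longrightarrow> smooth_on UNIV h" and D: "D \<in> TZ S"
    and D0: "D (0, z0) = 0" and Dz0: "((\<lambda>z. D (0, z)) has_field_derivative c) (at z0)" "c \<noteq> 0"
  obtains d l where "d > 0" "l 0 = z0" "\<forall>t. \<bar>t\<bar> < d \<longrightarrow> D (t, l t) = 0" "smooth_on {-d<..<d} l"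
proof -
  obtain Dt Dz where Dd: "Dt \<in> TZ S" "Dz \<in> TZ S"
    "\<And>x. (D has_derivative (\<lambda>h. of_real (fst h) * Dt x + snd h * Dz x)) (at x)"
    using TZ_has_derivative[OF S D] by blast
  have "((\<lambda>z. (0::real, z)) has_derivative (\<lambda>h. (0, h))) (at z0)"
    by (intro has_derivative_Pair has_derivative_const has_derivative_ident)
  from has_derivative_compose[OF this Dd(3)[of "(0, z0)"]]
  have "((\<lambda>z. D (0, z)) has_field_derivative Dz (0, z0)) (at z0)"
    by (simp add: has_field_derivative_def mult_commute_abs)
  then have "Dz (0, z0) = c" using Dz0(1) DERIV_unique by blast
  then have nz: "Dz (0, z0) \<noteq> 0" using Dz0(2) by simp
  obtain d l where dl: "d > 0" "l 0 = z0" "\<And>t. \<bar>t - 0\<bar> < d \<Longrightarrow> D (t, l t) = 0"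
    "\<And>t. \<bar>t - 0\<bar> < d \<Longrightarrow> Dz (t, l t) \<noteq> 0"
    "\<And>t. \<bar>t - 0\<bar> < d \<Longrightarrow> (l has_vector_derivative - (Dt (t, l t) / Dz (t, l t))) (at t)"
    using implicit_function[OF Dd(3) TZ_continuous[OF S Dd(1)] TZ_continuous[OF S Dd(2)] D0 nz] by blast
  have "smooth_on {-d<..<d} l"
  proof (rule smooth_onI_closed[of _ _ "curveQ S Dz l"])
    show "l \<in> curveQ S Dz l" using curveQ.base[OF TZ.freq, of l S Dz] by simp
    fix q assume q: "q \<in> curveQ S Dz l"
    show "\<exists>q'\<in>curveQ S Dz l. \<forall>t\<in>{-d<..<d}. (q has_vector_derivative q' t) (at t)"
      by (rule curveQ_derivative[OF S Dd(1,2) _ _ q]) (use dl(4,5) in auto)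
  qed simp
  then show ?thesis using that[of d l, OF dl(1) dl(2)] dl(3) by simp
qed

section \<open>The branch of resonances through a simple eigenvalue\<close>

lemma ew_eq_0_imp:
  assumes z: "z \<noteq> 0" and L: "0 < L" and eq: "\<And>x. x \<in> {0..L} \<Longrightarrow> ew z a b x = 0"
  shows "a = 0" "b = 0"
proof -
  have 0: "a + b = 0" using eq[of 0] L by simp
  have "((\<lambda>x. 0) has_vector_derivative \<i> * z * ew z a (-b) 0) (at 0 within {0..L})"
    by (rule has_vector_derivative_transform[OF _ _ ew_deriv[of z a b]]) (use eq L in auto)
  then have "\<i> * z * ew z a (-b) 0 = 0"
    using L by (intro vector_derivative_unique_within[OF _ _ has_vector_derivative_const, of 0 "{0..L}"])
      (auto simp: trivial_limit_within)
  then have "a - b = 0" using z by simp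
  then show "a = 0" "b = 0" using 0 by auto
qed

text \<open>Carries simplicity from square integrable eigenfunctions over to outgoing amplitudes: at
  a real frequency the latter vanish on the leads and so define eigenfunctions.\<close>

lemma simple_eigenvalue_coefficients:
  assumes wf: "wf_qgraph G l" and lam: "lam > 0"
    and simple: "simple_eigenvalue G l (complex_of_real (lam\<^sup>2))"
    and u: "eigfun G l (complex_of_real (lam\<^sup>2)) u"
    and uc: "\<forall>m\<in>edges G. \<forall>x\<in>eI G l m. u m x = ew lam (\<alpha>0 m) (\<beta>0 m) x"
    and out0: "outgoing G \<alpha>0" "outgoing G \<beta>0"
    and bc: "bc G l lam \<alpha> \<beta>" and out: "outgoing G \<beta>"
  shows "\<exists>c. \<forall>m\<in>edges G. \<alpha> m = c * \<alpha>0 m \<and> \<beta> m = c * \<beta>0 m"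
proof -
  have lam0: "complex_of_real lam \<noteq> 0" using lam by simp
  have outa: "outgoing G \<alpha>" by (rule outgoing_real_frequency[OF wf lam0 _ bc out]) simp
  have "solves G l ((complex_of_real lam)\<^sup>2) (gf G l lam \<alpha> \<beta>) zero_fun"
    by (rule coefficients_solves[OF wf lam0 outa out bc])
  then have sol: "solves G l (complex_of_real (lam\<^sup>2)) (gf G l lam \<alpha> \<beta>) zero_fun" by simp
  obtain v where v: "\<And>w. solves G l (complex_of_real (lam\<^sup>2)) w zero_fun \<Longrightarrow> \<exists>c. w = (\<lambda>m x. c * v m x)"
    using simple by (auto simp: simple_eigenvalue_def)
  obtain c1 where c1: "gf G l lam \<alpha> \<beta> = (\<lambda>m x. c1 * v m x)" using v[OF sol] by blast
  obtain c2 where c2: "u = (\<lambda>m x. c2 * v m x)" using v u unfolding eigfun_def by blast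
  have "c2 \<noteq> 0" using u c2 by (auto simp: eigfun_def zero_fun_def)
  then have c: "gf G l lam \<alpha> \<beta> m x = c1 / c2 * u m x" for m x
    by (simp add: c1 c2)
  have fin: "\<alpha> m = c1 / c2 * \<alpha>0 m \<and> \<beta> m = c1 / c2 * \<beta>0 m" if m: "m \<in> fin_edges G" for m
  proof -
    have "ew lam (\<alpha> m - c1 / c2 * \<alpha>0 m) (\<beta> m - c1 / c2 * \<beta>0 m) x = 0" if x: "x \<in> {0..l m}" for x
    proof -
      have "x \<in> eI G l m" using x by (simp add: eI_fin[OF m])
      then have "ew lam (\<alpha> m) (\<beta> m) x = c1 / c2 * ew lam (\<alpha>0 m) (\<beta>0 m) x"
        using c[of m x] uc fin_edges_subset[OF m] by (simp add: gf_def)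
      then show ?thesis unfolding ew_diff ew_scale by simp
    qed
    from ew_eq_0_imp[OF lam0 wf_qgraphD(4)[OF wf m] this] show ?thesis by simp
  qed
  have "\<alpha> m = c1 / c2 * \<alpha>0 m \<and> \<beta> m = c1 / c2 * \<beta>0 m" if "m \<in> edges G" for m
    using that fin out outa out0 by (auto simp: edges_split outgoing_def)
  then show ?thesis by blast
qed

text \<open>The derivative at \<open>z = \<lambda>\<close> of \<open>z \<mapsto> gm z\<close> applied to the coefficients of the eigenfunction.\<close>

definition dvec :: "qgraph \<Rightarrow> (nat \<Rightarrow> real) \<Rightarrow> complex \<Rightarrow> (nat \<Rightarrow> complex) \<Rightarrow> (nat \<Rightarrow> complex) \<Rightarrow> ix \<Rightarrow> complex" where
  "dvec G L z \<alpha> \<beta> i = - bd_rhs G (\<lambda>_. 0) (\<lambda>m. \<i> * L m * ew z (\<alpha> m) (- \<beta> m) (L m))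
      (\<lambda>_. 0) (\<lambda>m. \<i> * L m * ew z (\<alpha> m) (\<beta> m) (L m)) i"

lemma ew_freq_deriv: "((\<lambda>z. ew z a b x) has_field_derivative \<i> * x * ew z a (-b) x) (at z within S)"
  unfolding ew_def by (auto intro!: derivative_eq_intros simp: algebra_simps)

lemma gm_sum_deriv:
  assumes X: "\<And>m. X (IA m) = \<alpha> m" "\<And>m. X (IB m) = \<beta> m" and i: "i \<in> ixs G"
  shows "((\<lambda>z. \<Sum>j\<in>ixs G. gm G L z i j * X j) has_field_derivative dvec G L z \<alpha> \<beta> i) (at z)"
proof (cases i)
  case (IA m)
  then show ?thesis using i by (simp add: gm_sum_IA dvec_def bd_rhs_def)
next
  case (IB m)
  then have m: "m \<in> fin_edges G" using i by simp
  show ?thesis unfolding IB gm_sum_IB[OF m] X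
    by (auto intro!: derivative_eq_intros ew_freq_deriv simp: dvec_def bd_rhs_def)
next
  case (IV v)
  have "((\<lambda>z. (\<Sum>m | m \<in> fin_edges G \<and> tgt G m = v. ew z (\<alpha> m) (- \<beta> m) (L m))
      - (\<Sum>m | m \<in> edges G \<and> src G m = v. \<alpha> m - (if m \<in> fin_edges G then \<beta> m else 0))) has_field_derivative
     (\<Sum>m | m \<in> fin_edges G \<and> tgt G m = v. \<i> * L m * ew z (\<alpha> m) (- (- \<beta> m)) (L m)) - 0) (at z)"
    by (intro DERIV_diff DERIV_sum ew_freq_deriv DERIV_const)
  then show ?thesis unfolding IV gm_sum_IV X by (simp add: dvec_def bd_rhs_def)
qed

lemma mass_complex:
  "complex_of_real (mass G L z \<alpha> \<beta>) = (\<Sum>m\<in>fin_edges G. integral {0..L m} (\<lambda>x.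
      ew z (\<alpha> m) (\<beta> m) x * ew (cnj z) (cnj (\<beta> m)) (cnj (\<alpha> m)) x))"
proof -
  have "complex_of_real (integral {0..L m} (\<lambda>x. (cmod (ew z (\<alpha> m) (\<beta> m) x))\<^sup>2)) =
     integral {0..L m} (\<lambda>x. ew z (\<alpha> m) (\<beta> m) x * ew (cnj z) (cnj (\<beta> m)) (cnj (\<alpha> m)) x)" for m
    unfolding ew_cnj[symmetric] complex_norm_square[symmetric]
    by (rule integral_of_real_continuous[symmetric]) (intro continuous_intros)
  then show ?thesis by (simp add: mass_def)
qed

text \<open>Pairing \<open>\<zeta> \<partial>\<^sub>z u + \<xi>\<close> with the eigenfunction: its boundary data are admissible, and
  \<open>(\<partial>\<^sub>x\<^sup>2 + \<lambda>\<^sup>2)\<close> maps it to \<open>- 2 \<lambda> \<zeta> u\<close>.\<close>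

lemma eigenvalue_nondegenerate:
  assumes wf: "wf_qgraph G l" and lam: "lam \<noteq> 0"
    and bc: "bc G l (complex_of_real lam) \<alpha>0 \<beta>0" and out: "outgoing G \<alpha>0" "outgoing G \<beta>0"
    and mass: "mass G l (complex_of_real lam) \<alpha>0 \<beta>0 \<noteq> 0"
    and eq: "\<And>i. i \<in> ixs G \<Longrightarrow> (\<Sum>j\<in>ixs G. gm G l (complex_of_real lam) i j * \<xi> j) = - (\<zeta> * dvec G l (complex_of_real lam) \<alpha>0 \<beta>0 i)"
  shows "\<zeta> = 0"
proof -
  let ?lam = "complex_of_real lam"
  let ?u = "\<lambda>m. ew ?lam (\<alpha>0 m) (\<beta>0 m)" and ?k = "\<lambda>m. ew ?lam (\<alpha>0 m) (- \<beta>0 m)"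
  let ?d = "\<lambda>m. \<zeta> * (\<i> * l m * ?k m (l m))" and ?e = "\<lambda>m. \<zeta> * (\<i> * l m * ?u m (l m))"
  have "(\<Sum>j\<in>ixs G. gm G l ?lam i j * \<xi> j) = bd_rhs G (\<lambda>_. 0) ?d (\<lambda>_. 0) ?e i" if "i \<in> ixs G" for i
    unfolding eq[OF that] dvec_def by (cases i) (simp_all add: bd_rhs_def sum_distrib_left)
  note bd = gm_solution_bd[OF this]
  \<comment> \<open>\<open>\<i> * x * ?k m x\<close> is the frequency derivative of
    \<open>?u m x\<close>. Differentiating \<open>u'' + z^2 * u = 0\<close> in \<open>z\<close>
    produces the source term in \<open>?q''\<close>.\<close>
  let ?q = "\<lambda>m x. \<zeta> * (\<i> * of_real x * ?k m x) + ew ?lam (\<xi> (IA m)) (cB G \<xi> m) x"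
  let ?q' = "\<lambda>m x. \<zeta> * \<i> * ?k m x + \<i> * ?lam * (\<zeta> * (\<i> * of_real x * ?u m x) + ew ?lam (\<xi> (IA m)) (- cB G \<xi> m) x)"
  let ?q'' = "\<lambda>m x. - (?lam\<^sup>2) * ?q m x - 2 * \<zeta> * ?lam * ?u m x"
  let ?w = "\<lambda>m. ew ?lam (cnj (\<beta>0 m)) (cnj (\<alpha>0 m))"
  have bcw: "bc G l ?lam (\<lambda>m. cnj (\<beta>0 m)) (\<lambda>m. cnj (\<alpha>0 m))" using bc_cnj[OF bc] by simp
  have xid: "(complex_of_real has_vector_derivative 1) (at x within S)" for x S
    using has_vector_derivative_of_real[OF DERIV_ident] by simp
  have "(\<Sum>m\<in>fin_edges G. integral {0..l m} (\<lambda>x. ?q'' m x * ?w m x - ?q m x * (- (?lam\<^sup>2) * ?w m x)))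
    = (\<Sum>m=1..nL G. ?q' m 0 * ?w m 0 - ?q m 0 * (\<i> * ?lam * ew ?lam (cnj (\<beta>0 m)) (- cnj (\<alpha>0 m)) 0))"
  proof (rule green_finite_edges[OF wf _ _ ew_deriv ew_deriv2 _ _ bcD[OF bcw]])
    fix m x
    have "(?q m has_vector_derivative
       \<zeta> * ((\<i> * of_real x) * (\<i> * ?lam * ew ?lam (\<alpha>0 m) (- (- \<beta>0 m)) x) + (\<i> * 1) * ?k m x)
       + \<i> * ?lam * ew ?lam (\<xi> (IA m)) (- cB G \<xi> m) x) (at x within {0..l m})"
      by (intro has_vector_derivative_add has_vector_derivative_mult_right has_vector_derivative_mult ew_deriv xid)
    then show "(?q m has_vector_derivative ?q' m x) (at x within {0..l m})"
      by (rule has_vector_derivative_eq_rhs) (simp add: algebra_simps)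
    have "(?q' m has_vector_derivative \<zeta> * \<i> * (\<i> * ?lam * ew ?lam (\<alpha>0 m) (- (- \<beta>0 m)) x) + \<i> * ?lam *
       (\<zeta> * ((\<i> * of_real x) * (\<i> * ?lam * ?k m x) + (\<i> * 1) * ?u m x)
       + \<i> * ?lam * ew ?lam (\<xi> (IA m)) (- (- cB G \<xi> m)) x)) (at x within {0..l m})"
      by (intro has_vector_derivative_add has_vector_derivative_mult_right has_vector_derivative_mult ew_deriv xid)
    then show "(?q' m has_vector_derivative ?q'' m x) (at x within {0..l m})"
      by (rule has_vector_derivative_eq_rhs) (simp add: algebra_simps power2_eq_square)
  next
    show "cont_bd G (\<lambda>m. ?q m 0) (\<lambda>m. ?q m (l m))" using bd(1) by simp
    \<comment> \<open>\<open>gm\<close> works with derivatives divided by \<open>\<i> * z\<close>.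
      Differentiating that factor in \<open>z\<close> adds a multiple of the Kirchhoff data of the
      eigenfunction.\<close>
    have "kirch_bd G (\<lambda>m. \<zeta> * \<i> * (\<alpha>0 m - \<beta>0 m)) (\<lambda>m. \<zeta> * \<i> * ?k m (l m))"
      using bc by (intro kirch_bd_scale) (simp add: bc_def)
    from kirch_bd_add[OF this kirch_bd_scale[OF bd(2), of "\<i> * ?lam"]]
    show "kirch_bd G (\<lambda>m. ?q' m 0) (\<lambda>m. ?q' m (l m))" by simp
  qed
  also have "\<dots> = 0" using out by (intro sum.neutral) (auto simp: outgoing_def)
  finally have "(\<Sum>m\<in>fin_edges G. integral {0..l m} (\<lambda>x. ?q'' m x * ?w m x - ?q m x * (- (?lam\<^sup>2) * ?w m x))) = 0" .
  moreover have "(\<lambda>x. ?q'' m x * ?w m x - ?q m x * (- (?lam\<^sup>2) * ?w m x)) = (\<lambda>x. (- 2 * \<zeta> * ?lam) * (?u m x * ?w m x))" for m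
    by (intro ext) (simp add: algebra_simps)
  ultimately have "(- 2 * \<zeta> * ?lam) * (\<Sum>m\<in>fin_edges G. integral {0..l m} (\<lambda>x. ?u m x * ?w m x)) = 0"
    by (simp only: integral_mult_right sum_distrib_left)
  then have "(- 2 * \<zeta> * ?lam) * complex_of_real (mass G l ?lam \<alpha>0 \<beta>0) = 0"
    by (simp add: mass_complex)
  then show ?thesis using lam mass by simp
qed

lemma TZ_diff:
  assumes "F \<in> TZ S" "H \<in> TZ S"
  shows "(\<lambda>x. F x - H x) \<in> TZ S"
  using TZ.add[OF assms(1) TZ.mult[OF TZ.const[of "- 1"] assms(2)]] by simp

lemma gm_TZ:
  assumes "i \<in> ixs G" "j \<in> ixs G"
  shows "(\<lambda>x. gm G (\<lambda>m. exp (- a m (fst x)) * l m) (snd x) i j) \<in> TZ (a ` fin_edges G)"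
proof -
  have E: "(\<lambda>x. exp (\<i> * snd x * complex_of_real (exp (- a m (fst x)) * l m))) \<in> TZ (a ` fin_edges G)"
    "(\<lambda>x. exp (- (\<i> * snd x * complex_of_real (exp (- a m (fst x)) * l m)))) \<in> TZ (a ` fin_edges G)"
    "(\<lambda>x. - exp (- (\<i> * snd x * complex_of_real (exp (- a m (fst x)) * l m)))) \<in> TZ (a ` fin_edges G)"
    if m: "m \<in> fin_edges G" for m
  proof -
    have 1: "(\<lambda>x. exp (c * of_real (l m) * snd x * complex_of_real (exp (- a m (fst x))))) \<in> TZ (a ` fin_edges G)" for c
      using TZ.expo[of "a m" "a ` fin_edges G" "c * of_real (l m)"] m by simp
    show "(\<lambda>x. exp (\<i> * snd x * complex_of_real (exp (- a m (fst x)) * l m))) \<in> TZ (a ` fin_edges G)"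
      using 1[of \<i>] by (simp add: ac_simps)
    show 2: "(\<lambda>x. exp (- (\<i> * snd x * complex_of_real (exp (- a m (fst x)) * l m)))) \<in> TZ (a ` fin_edges G)"
      using 1[of "- \<i>"] by (simp add: ac_simps)
    show "(\<lambda>x. - exp (- (\<i> * snd x * complex_of_real (exp (- a m (fst x)) * l m)))) \<in> TZ (a ` fin_edges G)"
      using TZ.mult[OF TZ.const[of "-1"] 2] by simp
  qed
  show ?thesis using assms
    by (cases i; cases j)
       (auto intro!: TZ.const TZ.add TZ_diff E if_const_pred[where Q = "\<lambda>h. h \<in> TZ (a ` fin_edges G)"]
         simp del: if_split of_real_mult)
qed

lemma ddet_TZ:
  assumes "finite I" "\<And>i j. i \<in> I \<Longrightarrow> j \<in> I \<Longrightarrow> (\<lambda>x. M x i j) \<in> TZ S"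
  shows "(\<lambda>x. ddet I (M x)) \<in> TZ S"
  by (rule ddet_closed) (auto intro: TZ.const TZ.add TZ.mult assms)

lemma repl_col_sum:
  assumes "finite I" "k \<in> I"
  shows "(\<Sum>j\<in>I. repl_col M k b i j * Y j) = (\<Sum>j\<in>I. M i j * (Y(k := 0)) j) + b i * Y k"
proof -
  have "(\<Sum>j\<in>I. repl_col M k b i j * Y j) = b i * Y k + (\<Sum>j\<in>I - {k}. repl_col M k b i j * Y j)"
    using assms by (simp add: sum.remove repl_col_def)
  also have "(\<Sum>j\<in>I - {k}. repl_col M k b i j * Y j) = (\<Sum>j\<in>I - {k}. M i j * (Y(k := 0)) j)"
    by (intro sum.cong) (auto simp: repl_col_def)
  also have "\<dots> = (\<Sum>j\<in>I. M i j * (Y(k := 0)) j)"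
    using assms by (simp add: sum.remove)
  finally show ?thesis by simp
qed

text \<open>\<open>b\<close> is the \<open>z\<close>-derivative of the system applied to the
  eigenvector \<open>X0\<close>, and \<open>B\<close> is the secular matrix with column
  \<open>i0\<close> replaced by \<open>b\<close>, where \<open>X0 i0\<close> is nonzero.
  Invertibility of \<open>B\<close> combines simplicity of the eigenvalue with
  \<open>eigenvalue_nondegenerate\<close>.\<close>

theorem resonance_branch:
  assumes wf: "wf_qgraph G l" and lam: "lam > 0"
    and a_smooth: "\<forall>m\<in>fin_edges G. smooth_on UNIV (a m)" and a_zero: "\<forall>m\<in>fin_edges G. a m 0 = 0"
    and simple: "simple_eigenvalue G l (complex_of_real (lam\<^sup>2))"
    and u: "eigfun G l (complex_of_real (lam\<^sup>2)) u"
    and uc: "\<forall>m\<in>edges G. \<forall>x\<in>eI G l m. u m x = ew lam (\<alpha>0 m) (\<beta>0 m) x"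
    and bc: "bc G l (complex_of_real lam) \<alpha>0 \<beta>0" and out: "outgoing G \<alpha>0" "outgoing G \<beta>0"
    and mass: "mass G l (complex_of_real lam) \<alpha>0 \<beta>0 \<noteq> 0"
  obtains d lt \<alpha> \<beta> where "d > 0" "smooth_on {-d<..<d} lt" "lt 0 = complex_of_real lam"
    "\<forall>t. \<bar>t\<bar> < d \<longrightarrow> bc G (\<lambda>m. exp (- a m t) * l m) (lt t) (\<alpha> t) (\<beta> t) \<and> outgoing G (\<beta> t)"
    "\<forall>m\<in>edges G. \<alpha> 0 m = \<alpha>0 m \<and> \<beta> 0 m = \<beta>0 m"
    "\<forall>m\<in>edges G. (\<lambda>t. \<alpha> t m) differentiable (at 0) \<and> (\<lambda>t. \<beta> t m) differentiable (at 0)"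
proof -
  let ?lam = "complex_of_real lam" and ?I = "ixs G" and ?S = "a ` fin_edges G"
  define M where "M x = gm G (\<lambda>m. exp (- a m (fst x)) * l m) (snd x)" for x :: "real \<times> complex"
  define D where "D x = ddet ?I (M x)" for x
  have lam0: "?lam \<noteq> 0" using lam by simp
  have S: "smooth_on UNIV h" if "h \<in> ?S" for h using that a_smooth by auto
  have M0: "M (0, z) i j = gm G l z i j" if "i \<in> ?I" "j \<in> ?I" for z i j
    unfolding M_def using a_zero that by (cases i; cases j) (simp_all cong: if_cong)
  have MT: "(\<lambda>x. M x i j) \<in> TZ ?S" if "i \<in> ?I" "j \<in> ?I" for i j
    unfolding M_def by (rule gm_TZ[OF that])
  have DT: "D \<in> TZ ?S"
    unfolding D_def[abs_def] by (rule ddet_TZ[OF finite_ixs MT])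
  obtain X0 where X0: "\<And>i. i \<in> ?I \<Longrightarrow> (\<Sum>j\<in>?I. gm G l ?lam i j * X0 j) = 0"
    and X0A: "\<And>m. X0 (IA m) = \<alpha>0 m" and X0B: "\<And>m. X0 (IB m) = \<beta>0 m"
    using bc_gm_kernel[OF wf bc out(2)] by blast
  have "\<exists>i\<in>?I. X0 i \<noteq> 0"
  proof (rule ccontr)
    assume "\<not> ?thesis"
    then have 0: "X0 i = 0" if "i \<in> ?I" for i using that by blast
    have "mass G l ?lam \<alpha>0 \<beta>0 = 0"
      unfolding mass_def using 0[of "IA _"] 0[of "IB _"] by (simp add: X0A X0B fin_edges_subset)
    then show False using mass by simp
  qed
  then obtain i0 where i0: "i0 \<in> ?I" "X0 i0 \<noteq> 0" by blast
  define b where "b = dvec G l ?lam \<alpha>0 \<beta>0"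
  define B where "B x = repl_col (M x) i0 b" for x
  have BT: "(\<lambda>x. B x i j) \<in> TZ ?S" if "i \<in> ?I" "j \<in> ?I" for i j
    unfolding B_def repl_col_def using that
    by (intro if_const_pred[where Q = "\<lambda>h. h \<in> TZ ?S"] TZ.const MT)
  have sum0: "(\<Sum>j\<in>?I. M (0, z) i j * Y j) = (\<Sum>j\<in>?I. gm G l z i j * Y j)" if "i \<in> ?I" for z i Y
    using that by (intro sum.cong) (auto simp: M0)
  \<comment> \<open>For a kernel vector \<open>Y\<close> of \<open>B\<close>, let \<xi> be
    \<open>Y\<close> with component \<open>i0\<close> set to 0. Then \<open>gm\<close> maps \<xi> to
    \<open>- Y i0 * b\<close>; nondegeneracy gives \<open>Y i0 = 0\<close>, simplicity makes \<xi> a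
    multiple of \<open>X0\<close>, and \<open>\<xi> i0 = 0\<close> makes the multiple zero.\<close>
  have B0: "ddet ?I (B (0, ?lam)) \<noteq> 0"
  proof
    assume "ddet ?I (B (0, ?lam)) = 0"
    then obtain Y i1 where Y: "i1 \<in> ?I" "Y i1 \<noteq> 0" "\<And>i. i \<in> ?I \<Longrightarrow> (\<Sum>j\<in>?I. B (0, ?lam) i j * Y j) = 0"
      unfolding ddet_eq_0_iff[OF finite_ixs] by blast
    define \<xi> where "\<xi> = Y(i0 := 0)"
    have \<xi>: "(\<Sum>j\<in>?I. gm G l ?lam i j * \<xi> j) = - (Y i0 * b i)" if i: "i \<in> ?I" for i
      using Y(3)[OF i] unfolding B_def repl_col_sum[OF finite_ixs i0(1)] \<xi>_def[symmetric] sum0[OF i]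
      by (simp add: add_eq_0_iff mult.commute)
    have "Y i0 = 0"
      by (rule eigenvalue_nondegenerate[OF wf _ bc out mass]) (use lam \<xi> in \<open>auto simp: b_def\<close>)
    then have \<xi>0: "(\<Sum>j\<in>?I. gm G l ?lam i j * \<xi> j) = 0" if "i \<in> ?I" for i using \<xi>[OF that] by simp
    obtain c where c: "\<forall>m\<in>edges G. \<xi> (IA m) = c * \<alpha>0 m \<and> cB G \<xi> m = c * \<beta>0 m"
      using simple_eigenvalue_coefficients[OF wf lam simple u uc out gm_kernel_bc[OF \<xi>0] outgoing_cB] by blast
    have diff: "\<xi> i - c * X0 i = 0" if i: "i \<in> ?I" for i
    proof (rule gm_kernel_zero[of G l ?lam "\<lambda>i. \<xi> i - c * X0 i"])
      show "(\<Sum>j\<in>?I. gm G l ?lam i j * (\<xi> j - c * X0 j)) = 0" if "i \<in> ?I" for i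
      proof -
        have "(\<Sum>j\<in>?I. gm G l ?lam i j * (\<xi> j - c * X0 j)) =
          (\<Sum>j\<in>?I. gm G l ?lam i j * \<xi> j) - c * (\<Sum>j\<in>?I. gm G l ?lam i j * X0 j)"
          unfolding sum_distrib_left sum_subtractf[symmetric] by (intro sum.cong) (auto simp: algebra_simps)
        then show ?thesis using \<xi>0[OF that] X0[OF that] by simp
      qed
      show "\<xi> (IA m) - c * X0 (IA m) = 0" if "m \<in> edges G" for m using c that by (simp add: X0A)
      show "\<xi> (IB m) - c * X0 (IB m) = 0" if "m \<in> fin_edges G" for m
        using c that fin_edges_subset[OF that] by (auto simp: X0B cB_def)
    qed (rule i)
    have "c = 0" using diff[OF i0(1)] i0(2) by (simp add: \<xi>_def)
    then have "\<xi> i1 = 0" using diff[OF Y(1)] by simp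
    then show False using Y(2) \<open>Y i0 = 0\<close> by (auto simp: \<xi>_def split: if_splits)
  qed
  have D0: "D (0, ?lam) = 0"
    unfolding D_def ddet_eq_0_iff[OF finite_ixs] using i0 X0 by (intro exI[of _ X0]) (auto simp: sum0)
  \<comment> \<open>Cramer's rule for the vector \<open>X0 / (z - lam)\<close>: the difference
    quotient of the determinant, times \<open>X0 i0\<close>, is a determinant whose column
    \<open>i0\<close> is the difference quotient of the system applied to \<open>X0\<close>. That
    column tends to \<open>b\<close>.\<close>
  have Dder: "((\<lambda>z. D (0, z)) has_field_derivative ddet ?I (B (0, ?lam)) / X0 i0) (at ?lam)"
    unfolding has_field_derivative_iff
  proof (rule Lim_transform_eventually)
    let ?f = "\<lambda>z i. (\<Sum>j\<in>?I. gm G l z i j * X0 j) / (z - ?lam)"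
    have gmc: "((\<lambda>z. gm G l z i j) \<longlongrightarrow> gm G l ?lam i j) (at ?lam)" for i j
      using gm_holomorphic[of G l i j UNIV]
      by (metis UNIV_I continuous_on_eq_continuous_at holomorphic_on_imp_continuous_on isCont_def open_UNIV)
    have "((\<lambda>z. ddet ?I (repl_col (gm G l z) i0 (?f z))) \<longlongrightarrow> ddet ?I (repl_col (gm G l ?lam) i0 b)) (at ?lam)"
    proof (rule tendsto_ddet[OF finite_ixs])
      fix i j assume ij: "i \<in> ?I" "j \<in> ?I"
      show "((\<lambda>z. repl_col (gm G l z) i0 (?f z) i j) \<longlongrightarrow> repl_col (gm G l ?lam) i0 b i j) (at ?lam)"
      proof (cases "j = i0")
        case True
        have "((\<lambda>z. \<Sum>j\<in>?I. gm G l z i j * X0 j) has_field_derivative b i) (at ?lam)"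
          unfolding b_def by (rule gm_sum_deriv[OF X0A X0B ij(1)])
        then show ?thesis using True X0[OF ij(1)] by (simp add: repl_col_def has_field_derivative_iff)
      next
        case False
        then show ?thesis using gmc by (simp add: repl_col_def)
      qed
    qed
    moreover have "ddet ?I (repl_col (gm G l ?lam) i0 b) = ddet ?I (B (0, ?lam))"
      by (rule ddet_cong[OF finite_ixs]) (auto simp: B_def repl_col_def M0)
    ultimately show "((\<lambda>z. ddet ?I (repl_col (gm G l z) i0 (?f z)) / X0 i0) \<longlongrightarrow> ddet ?I (B (0, ?lam)) / X0 i0) (at ?lam)"
      using i0(2) by (intro tendsto_intros) auto
    have "ddet ?I (repl_col (gm G l z) i0 (?f z)) / X0 i0 = (D (0, z) - D (0, ?lam)) / (z - ?lam)" if "z \<noteq> ?lam" for z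
    proof -
      have "(X0 i0 / (z - ?lam)) * ddet ?I (gm G l z) = ddet ?I (repl_col (gm G l z) i0 (?f z))"
        by (rule ddet_cramer[OF finite_ixs i0(1), of _ "\<lambda>j. X0 j / (z - ?lam)"]) (simp add: sum_divide_distrib)
      moreover have "D (0, z) = ddet ?I (gm G l z)"
        unfolding D_def by (rule ddet_cong[OF finite_ixs M0])
      ultimately show ?thesis using D0 i0(2) by (simp add: field_simps)
    qed
    then show "\<forall>\<^sub>F z in at ?lam. ddet ?I (repl_col (gm G l z) i0 (?f z)) / X0 i0 = (D (0, z) - D (0, ?lam)) / (z - ?lam)"
      by (auto simp: eventually_at_filter)
  qed
  have nz: "ddet ?I (B (0, ?lam)) / X0 i0 \<noteq> 0" using B0 i0(2) by simp
  obtain d lt where dl: "d > 0" "lt 0 = ?lam" "\<forall>t. \<bar>t\<bar> < d \<longrightarrow> D (t, lt t) = 0" "smooth_on {-d<..<d} lt"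
    using smooth_implicit_function[OF S DT D0 Dder nz] by blast
  have ltd: "lt differentiable (at t)" if "\<bar>t\<bar> < d" for t
  proof -
    have "t \<in> {-d<..<d}" using that by auto
    then show ?thesis using dl(4) vderivs.simps(1)[of lt] unfolding smooth_on_def by metis
  qed
  define bt where "bt t = ddet ?I (B (t, lt t))" for t
  \<comment> \<open>The kernel vector normalised by freezing component \<open>i0\<close>; the others
    solve a system with the invertible matrix \<open>B\<close>, so Cramer's rule makes them
    differentiable at 0.\<close>
  define X where "X t j = (if j = i0 then X0 i0 else
     ddet ?I (repl_col (B (t, lt t)) j (\<lambda>i. - X0 i0 * M (t, lt t) i i0)) / bt t)" for t j
  have curve: "(\<lambda>t. F (t, lt t)) differentiable (at 0)" if FT: "F \<in> TZ ?S" for F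
  proof -
    have "\<exists>Ft\<in>TZ ?S. \<exists>Fz\<in>TZ ?S. \<forall>x. (F has_derivative (\<lambda>h. of_real (fst h) * Ft x + snd h * Fz x)) (at x)"
      by (rule TZ_has_derivative[OF _ FT]) (rule S)
    then obtain Ft Fz where "\<forall>x. (F has_derivative (\<lambda>h. of_real (fst h) * Ft x + snd h * Fz x)) (at x)"
      by (elim bexE)
    from spec[OF this, of "(0, lt 0)"]
    have F: "(F has_derivative (\<lambda>h. of_real (fst h) * Ft (0, lt 0) + snd h * Fz (0, lt 0))) (at (0, lt 0))" .
    have "(lt has_vector_derivative vector_derivative lt (at 0)) (at 0)"
      using ltd[of 0] dl(1) by (simp add: vector_derivative_works)
    from has_vector_derivative_along_curve[OF F this] show ?thesis
      by (auto simp: has_vector_derivative_def differentiable_def)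
  qed
  have btT: "bt differentiable (at 0)"
    unfolding bt_def[abs_def] by (rule curve[of "\<lambda>x. ddet ?I (B x)"]) (rule ddet_TZ[OF finite_ixs BT])
  have bt0: "bt 0 \<noteq> 0" using B0 dl(2) by (simp add: bt_def)
  have Xd: "(\<lambda>t. X t j) differentiable (at 0)" if j: "j \<in> ?I" for j
  proof (cases "j = i0")
    case True
    then show ?thesis by (simp add: X_def)
  next
    case False
    have "(\<lambda>t. ddet ?I (repl_col (B (t, lt t)) j (\<lambda>i. - X0 i0 * M (t, lt t) i i0))) differentiable (at 0)"
    proof (rule curve[of "\<lambda>x. ddet ?I (repl_col (B x) j (\<lambda>i. - X0 i0 * M x i i0))"], rule ddet_TZ[OF finite_ixs])
      fix i k assume "i \<in> ?I" "k \<in> ?I"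
      then show "(\<lambda>x. repl_col (B x) j (\<lambda>i. - X0 i0 * M x i i0) i k) \<in> TZ ?S"
        unfolding repl_col_def
        by (intro if_const_pred[where Q = "\<lambda>h. h \<in> TZ ?S"] TZ.mult TZ.const MT BT i0(1))
    qed
    then show ?thesis using False bt0 btT by (simp add: X_def)
  qed
  have "continuous (at 0) bt" using btT by (rule differentiable_imp_continuous_within)
  then have "eventually (\<lambda>t. bt t \<noteq> 0) (at 0)"
    using bt0 by (auto simp: continuous_within intro: tendsto_imp_eventually_ne)
  then obtain e where e: "e > 0" "\<And>t. t \<noteq> 0 \<Longrightarrow> \<bar>t\<bar> < e \<Longrightarrow> bt t \<noteq> 0"
    unfolding eventually_at by (auto simp: dist_real_def)
  have bt: "bt t \<noteq> 0" if "\<bar>t\<bar> < e" for t using e(2)[of t] bt0 that by (cases "t = 0") auto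
  have kern: "(\<Sum>j\<in>?I. M (t, lt t) i j * X t j) = 0" if t: "\<bar>t\<bar> < d" "\<bar>t\<bar> < e" and i: "i \<in> ?I" for t i
  proof -
    let ?x = "(t, lt t)"
    let ?r = "\<lambda>i. - X0 i0 * M ?x i i0"
    have nz: "ddet ?I (B ?x) \<noteq> 0" using bt[OF t(2)] by (simp add: bt_def)
    obtain Y where Y: "\<And>i. i \<in> ?I \<Longrightarrow> (\<Sum>j\<in>?I. B ?x i j * Y j) = ?r i"
      using ddet_solve[OF finite_ixs nz, of ?r] by blast
    \<comment> \<open>Replacing column \<open>i0\<close> of \<open>B\<close> by a multiple of the
      original column gives a multiple of \<open>ddet ?I (M ?x)\<close>, which vanishes on the
      branch. With \<open>Y i0 = 0\<close> the vector \<open>b\<close> drops out of the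
      equations.\<close>
    have "Y i0 * ddet ?I (B ?x) = ddet ?I (repl_col (B ?x) i0 ?r)"
      by (rule ddet_cramer[OF finite_ixs i0(1) Y])
    also have "repl_col (B ?x) i0 ?r = repl_col (M ?x) i0 ?r" by (intro ext) (simp add: B_def repl_col_def)
    also have "ddet ?I (repl_col (M ?x) i0 ?r) = (if i0 = i0 then - X0 i0 else 0) * ddet ?I (M ?x)"
      by (rule ddet_cramer[OF finite_ixs i0(1), of _ "\<lambda>j. if j = i0 then - X0 i0 else 0", symmetric])
         (use i0(1) in \<open>simp add: if_distrib sum.delta cong: if_cong\<close>)
    also have "\<dots> = 0" using dl(3) t(1) by (simp add: D_def)
    finally have Y0: "Y i0 = 0" using nz by simp
    have XY: "X t j = (if j = i0 then X0 i0 else Y j)" if "j \<in> ?I" for j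
      using ddet_cramer[OF finite_ixs that Y] nz by (simp add: X_def bt_def field_simps)
    have "(\<Sum>j\<in>?I. M ?x i j * X t j) = M ?x i i0 * X0 i0 + (\<Sum>j\<in>?I - {i0}. M ?x i j * X t j)"
      using i0(1) by (simp add: sum.remove XY)
    also have "(\<Sum>j\<in>?I - {i0}. M ?x i j * X t j) = (\<Sum>j\<in>?I - {i0}. M ?x i j * (Y(i0 := 0)) j)"
      by (intro sum.cong) (auto simp: XY)
    also have "\<dots> = (\<Sum>j\<in>?I. M ?x i j * (Y(i0 := 0)) j)"
      using i0(1) by (simp add: sum.remove)
    also have "\<dots> = ?r i" using Y[OF i] unfolding B_def repl_col_sum[OF finite_ixs i0(1)] by (simp add: Y0)
    finally show ?thesis by simp
  qed
  have X00: "X 0 j = X0 j" if j: "j \<in> ?I" for j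
  proof (cases "j = i0")
    case False
    have "(\<Sum>j\<in>?I. B (0, ?lam) i j * (X0(i0 := 0)) j) = - X0 i0 * M (0, ?lam) i i0" if i: "i \<in> ?I" for i
    proof -
      have "(\<Sum>j\<in>?I. gm G l ?lam i j * X0 j) = gm G l ?lam i i0 * X0 i0 + (\<Sum>j\<in>?I. gm G l ?lam i j * (X0(i0 := 0)) j)"
        using i0(1) by (simp add: sum.remove)
      then show ?thesis
        unfolding B_def repl_col_sum[OF finite_ixs i0(1)] sum0[OF i] fun_upd_upd using X0[OF i]
        by (simp add: M0[OF i i0(1)] add_eq_0_iff mult.commute)
    qed
    from ddet_cramer[OF finite_ixs j this]
    have "X0 j * bt 0 = ddet ?I (repl_col (B (0, ?lam)) j (\<lambda>i. - X0 i0 * M (0, ?lam) i i0))"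
      using False dl(2) by (simp add: bt_def)
    then show ?thesis using False bt0 dl(2) by (simp add: X_def field_simps)
  qed (simp add: X_def)
  show ?thesis
  proof (rule that[of "min d e" lt "\<lambda>t m. X t (IA m)" "\<lambda>t. cB G (X t)"])
    show "0 < min d e" using dl(1) e(1) by simp
    show "smooth_on {- min d e<..<min d e} lt"
      using dl(4) unfolding smooth_on_def by auto
    show "lt 0 = ?lam" by (rule dl(2))
    show "\<forall>t. \<bar>t\<bar> < min d e \<longrightarrow> bc G (\<lambda>m. exp (- a m t) * l m) (lt t) (\<lambda>m. X t (IA m)) (cB G (X t)) \<and> outgoing G (cB G (X t))"
      using kern by (auto intro!: gm_kernel_bc simp: M_def)
    show "\<forall>m\<in>edges G. X 0 (IA m) = \<alpha>0 m \<and> cB G (X 0) m = \<beta>0 m"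
      using X00[of "IA _"] X00[of "IB _"] out(2) by (auto simp: X0A X0B cB_def outgoing_def edges_split)
    show "\<forall>m\<in>edges G. (\<lambda>t. X t (IA m)) differentiable at 0 \<and> (\<lambda>t. cB G (X t) m) differentiable at 0"
      using Xd[of "IA _"] Xd[of "IB _"] 
      by (auto simp: cB_def intro!: if_const_pred[where Q = "\<lambda>h. h differentiable at 0"])
  qed
qed

section \<open>Generalized eigenfunctions at an eigenvalue\<close>

text \<open>Eliminating the existential vertex values leaves pairwise equations between boundary
  values, and these pass to limits in \<open>bc_limit\<close>.\<close>

lemma cont_bd_iff:
  "cont_bd G p0 pl \<longleftrightarrow>
    (\<forall>m\<in>edges G. \<forall>n\<in>edges G. src G m = src G n \<longrightarrow> p0 m = p0 n) \<and>
    (\<forall>m\<in>edges G. \<forall>n\<in>fin_edges G. src G m = tgt G n \<longrightarrow> p0 m = pl n) \<and>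
    (\<forall>m\<in>fin_edges G. \<forall>n\<in>fin_edges G. tgt G m = tgt G n \<longrightarrow> pl m = pl n)" (is "?l \<longleftrightarrow> ?r")
proof
  assume r: ?r
  have r1: "p0 m = p0 n" if "m \<in> edges G" "n \<in> edges G" "src G m = src G n" for m n
    using conjunct1[OF r] that by blast
  have r2: "p0 m = pl n" if "m \<in> edges G" "n \<in> fin_edges G" "src G m = tgt G n" for m n
    using conjunct1[OF conjunct2[OF r]] that by blast
  have r3: "pl m = pl n" if "m \<in> fin_edges G" "n \<in> fin_edges G" "tgt G m = tgt G n" for m n
    using conjunct2[OF conjunct2[OF r]] that by blast
  define U where "U v = (if \<exists>m\<in>edges G. src G m = v then p0 (SOME m. m \<in> edges G \<and> src G m = v)
    else pl (SOME m. m \<in> fin_edges G \<and> tgt G m = v))" for v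
  have "p0 m = U (src G m)" if m: "m \<in> edges G" for m
  proof -
    define n where "n = (SOME n. n \<in> edges G \<and> src G n = src G m)"
    have n: "n \<in> edges G \<and> src G n = src G m"
      unfolding n_def by (rule someI[of "\<lambda>n. n \<in> edges G \<and> src G n = src G m" m]) (simp add: m)
    have "U (src G m) = p0 n" unfolding U_def n_def by (rule if_P) (use m in blast)
    moreover have "p0 m = p0 n" using m n by (intro r1) simp_all
    ultimately show ?thesis by simp
  qed
  moreover have "pl m = U (tgt G m)" if m: "m \<in> fin_edges G" for m
  proof (cases "\<exists>n\<in>edges G. src G n = tgt G m")
    case True
    then obtain n0 where n0: "n0 \<in> edges G" "src G n0 = tgt G m" by blast
    define n where "n = (SOME n. n \<in> edges G \<and> src G n = tgt G m)"
    have n: "n \<in> edges G \<and> src G n = tgt G m"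
      unfolding n_def by (rule someI[of "\<lambda>n. n \<in> edges G \<and> src G n = tgt G m" n0]) (simp add: n0)
    have "U (tgt G m) = p0 n" unfolding U_def n_def by (rule if_P[OF True])
    moreover have "p0 n = pl m" using m n by (intro r2) simp_all
    ultimately show ?thesis by simp
  next
    case False
    define n where "n = (SOME n. n \<in> fin_edges G \<and> tgt G n = tgt G m)"
    have n: "n \<in> fin_edges G \<and> tgt G n = tgt G m"
      unfolding n_def by (rule someI[of "\<lambda>n. n \<in> fin_edges G \<and> tgt G n = tgt G m" m]) (simp add: m)
    have "U (tgt G m) = pl n" unfolding U_def n_def by (rule if_not_P[OF False])
    moreover have "pl m = pl n" using m n by (intro r3) simp_all
    ultimately show ?thesis by simp
  qed
  ultimately show ?l unfolding cont_bd_def by blast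
qed (auto simp: cont_bd_def)

lemma tendsto_ew [tendsto_intros]:
  "(f \<longlongrightarrow> z) F \<Longrightarrow> (g \<longlongrightarrow> a) F \<Longrightarrow> (h \<longlongrightarrow> b) F \<Longrightarrow> ((\<lambda>x. ew (f x) (g x) (h x) c) \<longlongrightarrow> ew z a b c) F"
  unfolding ew_def by (intro tendsto_intros)

lemma tendsto_eventually_eq:
  fixes a b :: complex
  assumes "F \<noteq> bot" "(f \<longlongrightarrow> a) F" "(g \<longlongrightarrow> b) F" "eventually (\<lambda>x. f x = g x) F"
  shows "a = b"
  using tendsto_unique[OF assms(1,2)] Lim_transform_eventually[OF assms(3), of f] assms(4)
  by (simp add: eq_commute)

lemma bc_limit:
  assumes F: "F \<noteq> bot" and ev: "eventually (\<lambda>x. bc G L (z x) (\<alpha> x) (\<beta> x)) F"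
    and z: "(z \<longlongrightarrow> z0) F"
    and \<alpha>: "\<And>m. m \<in> edges G \<Longrightarrow> ((\<lambda>x. \<alpha> x m) \<longlongrightarrow> \<alpha>0 m) F"
    and \<beta>: "\<And>m. m \<in> edges G \<Longrightarrow> ((\<lambda>x. \<beta> x m) \<longlongrightarrow> \<beta>0 m) F"
  shows "bc G L z0 \<alpha>0 \<beta>0"
  unfolding bc_def
proof
  have t0: "((\<lambda>x. \<alpha> x m + \<beta> x m) \<longlongrightarrow> \<alpha>0 m + \<beta>0 m) F" if "m \<in> edges G" for m
    using that by (intro tendsto_intros \<alpha> \<beta>)
  have tl: "((\<lambda>x. ew (z x) (\<alpha> x m) (\<beta> x m) (L m)) \<longlongrightarrow> ew z0 (\<alpha>0 m) (\<beta>0 m) (L m)) F" if "m \<in> fin_edges G" for m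
    using fin_edges_subset[OF that] by (intro tendsto_intros z \<alpha> \<beta>)
  have e: "eventually (\<lambda>x. cont_bd G (\<lambda>m. \<alpha> x m + \<beta> x m) (\<lambda>m. ew (z x) (\<alpha> x m) (\<beta> x m) (L m))) F"
    using ev by eventually_elim (simp add: bc_def)
  note e = e[unfolded cont_bd_iff]
  show "cont_bd G (\<lambda>m. \<alpha>0 m + \<beta>0 m) (\<lambda>m. ew z0 (\<alpha>0 m) (\<beta>0 m) (L m))"
    unfolding cont_bd_iff
  proof (intro conjI ballI impI)
    show "\<alpha>0 m + \<beta>0 m = \<alpha>0 n + \<beta>0 n" if "m \<in> edges G" "n \<in> edges G" "src G m = src G n" for m n
      by (rule tendsto_eventually_eq[OF F t0[OF that(1)] t0[OF that(2)]])
         (rule eventually_mono[OF e], use that in blast)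
    show "\<alpha>0 m + \<beta>0 m = ew z0 (\<alpha>0 n) (\<beta>0 n) (L n)" if "m \<in> edges G" "n \<in> fin_edges G" "src G m = tgt G n" for m n
      by (rule tendsto_eventually_eq[OF F t0[OF that(1)] tl[OF that(2)]])
         (rule eventually_mono[OF e], use that in blast)
    show "ew z0 (\<alpha>0 m) (\<beta>0 m) (L m) = ew z0 (\<alpha>0 n) (\<beta>0 n) (L n)" if "m \<in> fin_edges G" "n \<in> fin_edges G" "tgt G m = tgt G n" for m n
      by (rule tendsto_eventually_eq[OF F tl[OF that(1)] tl[OF that(2)]])
         (rule eventually_mono[OF e], use that in blast)
  qed
  show "kirch_bd G (\<lambda>m. \<alpha>0 m - \<beta>0 m) (\<lambda>m. ew z0 (\<alpha>0 m) (- \<beta>0 m) (L m))"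
    unfolding kirch_bd_def
  proof (intro allI impI)
    fix v assume v: "v < nV G"
    show "(\<Sum>m | m \<in> fin_edges G \<and> tgt G m = v. ew z0 (\<alpha>0 m) (- \<beta>0 m) (L m)) =
      (\<Sum>m | m \<in> edges G \<and> src G m = v. \<alpha>0 m - \<beta>0 m)"
    proof (rule tendsto_eventually_eq[OF F])
      show "((\<lambda>x. \<Sum>m | m \<in> fin_edges G \<and> tgt G m = v. ew (z x) (\<alpha> x m) (- \<beta> x m) (L m)) \<longlongrightarrow>
        (\<Sum>m | m \<in> fin_edges G \<and> tgt G m = v. ew z0 (\<alpha>0 m) (- \<beta>0 m) (L m))) F"
        by (intro tendsto_intros z \<alpha> \<beta>) (auto dest: fin_edges_subset)
      show "((\<lambda>x. \<Sum>m | m \<in> edges G \<and> src G m = v. \<alpha> x m - \<beta> x m) \<longlongrightarrow>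
        (\<Sum>m | m \<in> edges G \<and> src G m = v. \<alpha>0 m - \<beta>0 m)) F"
        by (intro tendsto_intros \<alpha> \<beta>) auto
      show "eventually (\<lambda>x. (\<Sum>m | m \<in> fin_edges G \<and> tgt G m = v. ew (z x) (\<alpha> x m) (- \<beta> x m) (L m)) =
        (\<Sum>m | m \<in> edges G \<and> src G m = v. \<alpha> x m - \<beta> x m)) F"
        using ev by eventually_elim (use v in \<open>simp add: bc_def kirch_bd_def\<close>)
    qed
  qed
qed

lemma isCont_ew_integral:
  fixes t :: real
  assumes "isCont f1 t" "isCont f2 t" "isCont f3 t" "isCont f4 t" "isCont f5 t" "isCont f6 t"
  shows "isCont (\<lambda>t. integral {0..b} (\<lambda>x. ew (f1 t) (f2 t) (f3 t) x * ew (f4 t) (f5 t) (f6 t) x)) t"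
proof -
  define \<Psi> where "\<Psi> y = integral {0..b} (\<lambda>x. ew (fst y) (fst (snd y)) (fst (snd (snd y))) x *
    ew (fst (snd (snd (snd y)))) (fst (snd (snd (snd (snd y))))) (snd (snd (snd (snd (snd y))))) x)"
    for y :: "complex \<times> complex \<times> complex \<times> complex \<times> complex \<times> complex"
  have "continuous_on UNIV (\<lambda>y. integral (cbox 0 b) (\<lambda>x. ew (fst y) (fst (snd y)) (fst (snd (snd y))) x *
    ew (fst (snd (snd (snd y)))) (fst (snd (snd (snd (snd y))))) (snd (snd (snd (snd (snd y))))) x))"
    by (rule integral_continuous_on_param) (auto simp: case_prod_beta intro!: continuous_intros)
  then have "continuous_on UNIV \<Psi>" by (simp add: \<Psi>_def[abs_def])
  then have "isCont \<Psi> y" for y using continuous_on_eq_continuous_at[OF open_UNIV] by blast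
  moreover have "isCont (\<lambda>t. (f1 t, f2 t, f3 t, f4 t, f5 t, f6 t)) t"
    by (intro continuous_intros assms)
  ultimately have "isCont (\<lambda>t. \<Psi> (f1 t, f2 t, f3 t, f4 t, f5 t, f6 t)) t"
    by (rule isCont_o2[rotated])
  then show ?thesis by (simp add: \<Psi>_def)
qed

lemma det_nonzero_no_eigfun:
  assumes wf: "wf_qgraph G L" and x: "x \<noteq> 0" and nz: "ddet (ixs G) (gm G L (complex_of_real x)) \<noteq> 0"
  shows "\<not> eigfun G L (complex_of_real (x\<^sup>2)) w"
proof
  assume w: "eigfun G L (complex_of_real (x\<^sup>2)) w"
  then have sol: "solves G L ((complex_of_real x)\<^sup>2) w zero_fun" by (simp add: eigfun_def)
  have x0: "complex_of_real x \<noteq> 0" "0 \<le> Im (complex_of_real x)" using x by auto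
  obtain \<alpha> \<beta> where ab: "outgoing G \<beta>" "bc G L x \<alpha> \<beta>"
    "\<forall>m\<in>edges G. \<forall>y\<in>eI G L m. w m y = ew x (\<alpha> m) (\<beta> m) y"
    by (rule homogeneous_solves_coefficients[OF wf x0 sol])
  have "\<forall>m\<in>edges G. \<alpha> m = 0 \<and> \<beta> m = 0"
    using nz ab(1,2) unfolding gm_det_eq_0_iff[OF wf] by blast
  then have "w m y = 0" for m y
    using ab(3) sol by (cases "m \<in> edges G"; cases "y \<in> eI G L m") (auto simp: solves_def supp_ok_def)
  then have "w = zero_fun" by (intro ext) (simp add: zero_fun_def)
  then show False using w by (simp add: eigfun_def)
qed

text \<open>\<open>gen_eigfuns\<close> describes \<open>E\<close> only off the point spectrum, and
  continuity in the frequency is given pointwise in \<open>x\<close>. The amplitudes are therefore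
  expressed through values at fixed points, and all relations are carried to \<open>lam\<close> by
  continuity.\<close>

lemma gen_eigfun_at_eigenvalue:
  assumes wf: "wf_qgraph G l" and lam: "lam > 0" and E: "gen_eigfuns G l E" and k: "k \<in> {1..nL G}"
    and bc0: "bc G l (complex_of_real lam) \<alpha>0 \<beta>0" and out0: "outgoing G \<alpha>0" "outgoing G \<beta>0"
  obtains A B where "bc G l (complex_of_real lam) A B" "\<forall>m\<in>{1..nL G}. B m = (if m = k then 1 else 0)"
    "\<forall>m\<in>edges G. \<forall>x\<in>eI G l m. E (complex_of_real lam) k m x = ew lam (A m) (B m) x"
    "(\<Sum>m\<in>fin_edges G. integral {0..l m} (\<lambda>x. ew lam (\<alpha>0 m) (\<beta>0 m) x * ew lam (cnj (B m)) (cnj (A m)) x)) = 0"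
proof -
  let ?lam = "complex_of_real lam"
  define e where "e m y x = E (complex_of_real x) k m y" for m y and x :: real
  \<comment> \<open>Keeps \<open>lam * r m\<close> in the interval from 0 to \<open>pi / 2\<close>,
    where the sine in \<open>J m lam = 2 * \<i> * sin (lam * r m)\<close> is nonzero.\<close>
  define r where "r m = min (l m) (pi / (2 * lam))" for m
  define J where "J m x = exp (\<i> * complex_of_real x * of_real (r m)) - exp (- (\<i> * complex_of_real x * of_real (r m)))" for m and x :: real
  \<comment> \<open>On a finite edge the values at 0 and \<open>r m\<close> form a 2 by 2 system
    with determinant \<open>J m x\<close> up to sign. On a lead the incoming amplitude is prescribed
    and one value suffices.\<close>
  define A where "A x m = (if m \<in> fin_edges G then
      (e m (r m) x - exp (- (\<i> * complex_of_real x * of_real (r m))) * e m 0 x) / J m x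
      else e m 0 x - (if m = k then 1 else 0))" for x m
  define B where "B x m = e m 0 x - A x m" for x m
  obtain U where U: "open U" "\<real> \<subseteq> U" "\<forall>k m x. (\<lambda>z. E z k m x) holomorphic_on U"
    using conjunct2[OF E[unfolded gen_eigfuns_def]] by (elim exE conjE)
  have ec: "isCont (e m y) lam" for m y
  proof -
    have "isCont (\<lambda>z. E z k m y) ?lam"
    proof -
      have "continuous_on U (\<lambda>z. E z k m y)"
        by (rule holomorphic_on_imp_continuous_on) (rule U(3)[rule_format])
      moreover have "?lam \<in> U" using U(2) by auto
      ultimately show ?thesis using continuous_on_eq_continuous_at[OF U(1)] by blast
    qed
    moreover have "isCont complex_of_real lam" by (rule continuous_of_real[OF continuous_ident])
    ultimately show ?thesis unfolding e_def by (rule isCont_o2[rotated])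
  qed
  have r: "0 < r m" "r m \<le> l m" if "m \<in> fin_edges G" for m
    using wf_qgraphD(4)[OF wf that] lam by (auto simp: r_def)
  have J0: "J m lam \<noteq> 0" if m: "m \<in> fin_edges G" for m
  proof -
    have "lam * r m \<le> pi / 2" using lam by (simp add: r_def min_def field_simps)
    then have "lam * r m < pi" using pi_gt_zero by linarith
    then have "0 < sin (lam * r m)" using r[OF m] lam by (intro sin_gt_zero) auto
    moreover have "J m lam = 2 * \<i> * of_real (sin (lam * r m))"
      unfolding J_def by (simp add: sin_exp_eq flip: sin_of_real) (simp add: field_simps)
    ultimately show ?thesis by simp
  qed
  have Jc: "isCont (J m) lam" for m unfolding J_def by (intro continuous_intros)
  have Ac: "isCont (\<lambda>x. A x m) lam" for m
    unfolding A_def using ec Jc J0 by (cases "m \<in> fin_edges G") (auto intro!: continuous_intros)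
  have Bc: "isCont (\<lambda>x. B x m) lam" for m
    unfolding B_def by (intro continuous_intros ec Ac)
  have lim: "filterlim complex_of_real (at ?lam) (at lam)"
    by (intro filterlim_atI tendsto_intros) (auto simp: eventually_at_filter)
  \<comment> \<open>Zeros of the secular determinant are isolated, so a punctured neighbourhood of
    \<open>lam\<close> contains no eigenvalues and the characterisation of \<open>E\<close> applies
    there.\<close>
  have "eventually (\<lambda>z. ddet (ixs G) (gm G l z) \<noteq> 0 \<and> z \<in> UNIV) (at ?lam)"
    by (rule non_zero_neighbour_alt[of _ UNIV _ \<i>])
       (auto intro!: ddet_holomorphic gm_holomorphic simp: gm_det_nonzero_upper[OF wf])
  from eventually_compose_filterlim[OF this lim]
  have ev1: "eventually (\<lambda>x. ddet (ixs G) (gm G l (complex_of_real x)) \<noteq> 0) (at lam)" by simp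
  have ev2: "eventually (\<lambda>x. \<forall>m\<in>fin_edges G. J m x \<noteq> 0) (at lam)"
    using Jc J0 by (intro eventually_ball_finite) (auto simp: isCont_def intro: tendsto_imp_eventually_ne)
  have ev3: "eventually (\<lambda>x. x > 0 \<and> x \<noteq> lam) (at lam)"
    using order_tendstoD(1)[OF tendsto_ident_at[of lam UNIV] lam] by (auto simp: eventually_at_filter elim: eventually_mono)
  have ev: "eventually (\<lambda>x. x > 0 \<and> x \<noteq> lam \<and> bc G l (complex_of_real x) (A x) (B x) \<and>
     (\<forall>m\<in>{1..nL G}. B x m = (if m = k then 1 else 0)) \<and>
     (\<forall>m\<in>edges G. \<forall>y\<in>eI G l m. e m y x = ew (complex_of_real x) (A x m) (B x m) y)) (at lam)"
    using ev1 ev2 ev3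
  proof eventually_elim
    case (elim x)
    let ?x = "complex_of_real x"
    have x0: "?x \<noteq> 0" using elim by simp
    have ne: "\<nexists>w. eigfun G l (complex_of_real (x\<^sup>2)) w"
      using det_nonzero_no_eigfun[OF wf _ elim(1)] elim(3) by auto
    note * = bspec[OF mp[OF spec[OF conjunct1[OF E[unfolded gen_eigfuns_def]], of x] ne] k]
    have sol: "solves_loc G l (?x\<^sup>2) (E ?x k) zero_fun" using conjunct1[OF *] by simp
    note leads = conjunct2[OF *]
    obtain s where s: "\<And>m y. m \<in> {1..nL G} \<Longrightarrow> 0 \<le> y \<Longrightarrow> E ?x k m y = ew ?x (s m) (if m = k then 1 else 0) y"
    proof -
      obtain s where "\<And>m y. m \<in> {1..nL G} \<Longrightarrow> y\<ge>0 \<Longrightarrow> E ?x k m y = (if m = k then exp (- \<i> * x * y) else 0) + s m * exp (\<i> * x * y)"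
        using leads by metis
      then show ?thesis by (intro that[of s]) (auto simp: ew_def)
    qed
    obtain \<alpha> \<beta> where ab: "bc G l ?x \<alpha> \<beta>" "\<forall>m\<in>{1..nL G}. \<alpha> m = s m \<and> \<beta> m = (if m = k then 1 else 0)"
      "\<forall>m\<in>edges G. \<forall>y\<in>eI G l m. E ?x k m y = ew ?x (\<alpha> m) (\<beta> m) y"
      by (rule solves_loc_coefficients[OF wf x0 sol s])
    have eq: "\<alpha> m = A x m \<and> \<beta> m = B x m" if m: "m \<in> edges G" for m
    proof -
      have "0 \<in> eI G l m" using m wf_qgraphD(4)[OF wf, of m] by (auto simp: eI_def edges_def fin_edges_def)
      then have e0: "e m 0 x = \<alpha> m + \<beta> m" using ab(3) m by (simp add: e_def)
      have "\<alpha> m = A x m"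
      proof (cases "m \<in> fin_edges G")
        case True
        have "r m \<in> eI G l m" using r[OF True] by (simp add: eI_fin[OF True])
        then have "e m (r m) x = ew ?x (\<alpha> m) (\<beta> m) (r m)" using ab(3) m by (simp add: e_def)
        then have "e m (r m) x - exp (- (\<i> * ?x * of_real (r m))) * e m 0 x = \<alpha> m * J m x"
          unfolding e0 by (simp add: ew_def J_def algebra_simps)
        then show ?thesis using True elim(2) by (simp add: A_def)
      next
        case False
        then show ?thesis using m ab(2) e0 by (auto simp: A_def edges_split)
      qed
      then show ?thesis using e0 by (simp add: B_def)
    qed
    \<comment> \<open>Applied to constant families, \<open>bc_limit\<close> serves as a congruence
      rule for coefficients agreeing on the edges.\<close>
    have "bc G l ?x (A x) (B x)"
      using bc_limit[of "at (0::real)" G l "\<lambda>_. ?x" "\<lambda>_. \<alpha>" "\<lambda>_. \<beta>" ?x "A x" "B x"] ab(1) eq by simp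
    then show ?case using elim(3) ab eq lead_in_edges by (auto simp: e_def)
  qed
  have T: "at lam \<noteq> bot" by simp
  have bcl: "bc G l ?lam (A lam) (B lam)"
  proof (rule bc_limit[OF T])
    show "eventually (\<lambda>x. bc G l (complex_of_real x) (A x) (B x)) (at lam)"
      using ev by eventually_elim simp
  qed (use Ac Bc in \<open>auto simp: isCont_def intro!: tendsto_intros\<close>)
  have Bl: "B lam m = (if m = k then 1 else 0)" if m: "m \<in> {1..nL G}" for m
    by (rule tendsto_eventually_eq[OF T Bc[of m, unfolded isCont_def] tendsto_const])
       (use ev in \<open>eventually_elim, use m in simp\<close>)
  have El: "E ?lam k m y = ew ?lam (A lam m) (B lam m) y" if m: "m \<in> edges G" and y: "y \<in> eI G l m" for m y
  proof -
    have "e m y lam = ew ?lam (A lam m) (B lam m) y"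
    proof (rule tendsto_eventually_eq[OF T])
      show "(e m y \<longlongrightarrow> e m y lam) (at lam)" using ec by (simp add: isCont_def)
      show "((\<lambda>x. ew (complex_of_real x) (A x m) (B x m) y) \<longlongrightarrow> ew ?lam (A lam m) (B lam m) y) (at lam)"
        using Ac Bc by (auto simp: isCont_def intro!: tendsto_intros)
      show "eventually (\<lambda>x. e m y x = ew (complex_of_real x) (A x m) (B x m) y) (at lam)"
        using ev by eventually_elim (use m y in blast)
    qed
    then show ?thesis by (simp add: e_def)
  qed
  \<comment> \<open>Green's formula makes \<open>x^2 - lam^2\<close> times this pairing zero, as the
    eigenfunction vanishes on the leads. Orthogonality at \<open>lam\<close> is the limit.\<close>
  define W where "W x = (\<Sum>m\<in>fin_edges G. integral {0..l m} (\<lambda>y. ew ?lam (\<alpha>0 m) (\<beta>0 m) y *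
     ew (complex_of_real x) (cnj (B x m)) (cnj (A x m)) y))" for x
  have W: "W lam = 0"
  proof (rule tendsto_eventually_eq[OF T])
    have "isCont W lam" unfolding W_def
      by (intro continuous_intros isCont_ew_integral Ac Bc)
    then show "(W \<longlongrightarrow> W lam) (at lam)" by (simp add: isCont_def)
    show "((\<lambda>_. 0) \<longlongrightarrow> 0) (at lam)" by (rule tendsto_const)
    show "eventually (\<lambda>x. W x = 0) (at lam)"
      using ev
    proof eventually_elim
      case (elim x)
      have bcx: "bc G l (complex_of_real x) (\<lambda>m. cnj (B x m)) (\<lambda>m. cnj (A x m))"
        using bc_cnj[of G l "complex_of_real x" "A x" "B x"] elim by simp
      have "((complex_of_real x)\<^sup>2 - ?lam\<^sup>2) * W x = 0"
        unfolding W_def green_bc[OF wf bc0 bcx]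
        by (rule sum.neutral) (use out0 in \<open>auto simp: outgoing_def\<close>)
      moreover have "(complex_of_real x)\<^sup>2 - ?lam\<^sup>2 \<noteq> 0"
      proof -
        have "x\<^sup>2 \<noteq> lam\<^sup>2" using elim lam by (simp add: power2_eq_iff)
        then show ?thesis by (metis eq_iff_diff_eq_0 of_real_eq_iff of_real_power)
      qed
      ultimately show ?case by simp
    qed
  qed
  show ?thesis
    by (rule that[of "A lam" "B lam"]) (use bcl Bl El W in \<open>auto simp: W_def\<close>)
qed

text \<open>At equal frequencies Green's formula says that the Wronskians on the leads sum to zero.
  Two generalized eigenfunctions give symmetry, one and a conjugate give unitarity;
  \<open>A k m\<close> is the amplitude usually written \<open>s\<^sub>m\<^sub>k\<close>.\<close>

lemma scattering_relations:
  assumes wf: "wf_qgraph G l" and lam: "lam \<noteq> 0"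
    and bc: "\<And>k. k \<in> {1..nL G} \<Longrightarrow> bc G l (complex_of_real lam) (A k) (B k)"
    and B: "\<And>k m. k \<in> {1..nL G} \<Longrightarrow> m \<in> {1..nL G} \<Longrightarrow> B k m = (if m = k then 1 else 0)"
    and k: "k \<in> {1..nL G}" and j: "j \<in> {1..nL G}"
  shows "A k j = A j k" "(\<Sum>m=1..nL G. A k m * cnj (A j m)) = (if k = j then 1 else 0)"
proof -
  let ?lam = "complex_of_real lam"
  have gen: "(\<Sum>m=1..nL G. a m * d m) = (\<Sum>m=1..nL G. b m * c m)" if "bc G l ?lam a b" "bc G l ?lam c d" for a b c d
  proof -
    have "0 = (\<Sum>m=1..nL G. \<i> * ?lam * (a m - b m) * (c m + d m) - \<i> * ?lam * (a m + b m) * (c m - d m))"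
      using green_bc[OF wf that] by simp
    also have "\<dots> = (\<Sum>m=1..nL G. 2 * \<i> * ?lam * (a m * d m - b m * c m))"
      by (intro sum.cong) (auto simp: algebra_simps)
    also have "\<dots> = 2 * \<i> * ?lam * ((\<Sum>m=1..nL G. a m * d m) - (\<Sum>m=1..nL G. b m * c m))"
      by (simp add: sum_distrib_left[symmetric] sum_subtractf)
    finally show ?thesis using lam by simp
  qed
  have delta: "(\<Sum>m=1..nL G. f m * (if m = i then 1 else 0)) = f i" if "i \<in> {1..nL G}" for f :: "nat \<Rightarrow> complex" and i
    using that by (simp add: if_distrib sum.delta' cong: if_cong)
  have delta': "(\<Sum>m=1..nL G. (if m = i then 1 else 0) * f m) = f i" if "i \<in> {1..nL G}" for f :: "nat \<Rightarrow> complex" and i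
    using delta[OF that, of f] by (simp only: mult.commute)
  have Bs: "(\<Sum>m=1..nL G. f m * B i m) = f i" "(\<Sum>m=1..nL G. B i m * f m) = f i" if "i \<in> {1..nL G}" for f and i
  proof -
    have "(\<Sum>m=1..nL G. f m * B i m) = (\<Sum>m=1..nL G. f m * (if m = i then 1 else 0))"
      using that by (intro sum.cong) (auto simp: B)
    then show "(\<Sum>m=1..nL G. f m * B i m) = f i" using delta[OF that] by simp
    then show "(\<Sum>m=1..nL G. B i m * f m) = f i" by (simp only: mult.commute)
  qed
  have "A k j = (\<Sum>m=1..nL G. A k m * B j m)" by (rule Bs(1)[OF j, symmetric])
  also have "\<dots> = (\<Sum>m=1..nL G. B k m * A j m)" by (rule gen[OF bc[OF k] bc[OF j]])
  also have "\<dots> = A j k" by (rule Bs(2)[OF k])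
  finally show "A k j = A j k" .
  have "(\<Sum>m=1..nL G. A k m * cnj (A j m)) = (\<Sum>m=1..nL G. B k m * cnj (B j m))"
    using gen[OF bc[OF k], of "\<lambda>m. cnj (B j m)" "\<lambda>m. cnj (A j m)"] bc_cnj[OF bc[OF j]] by simp
  also have "\<dots> = cnj (B j k)" by (rule Bs(2)[OF k])
  finally show "(\<Sum>m=1..nL G. A k m * cnj (A j m)) = (if k = j then 1 else 0)"
    using B[OF j k] by simp
qed

section \<open>The second derivative of the branch\<close>

lemma integral_stretch:
  fixes h :: "real \<Rightarrow> complex"
  assumes c: "0 < c" and b: "0 \<le> b" and h: "continuous_on {0..c * b} h"
  shows "integral {0..c * b} h = of_real c * integral {0..b} (\<lambda>y. h (c * y))"
proof -
  have "((\<lambda>y. h (c * y)) has_integral (1 / \<bar>c\<bar>) *\<^sub>R integral {0..c * b} h) ((\<lambda>x. x / c) ` {0..c * b})"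
    using c by (intro has_integral_stretch_real integrable_integral integrable_continuous_interval h) auto
  also have "(\<lambda>x. x / c) ` {0..c * b} = {0..b}"
    using c b by (auto simp: image_def field_simps zero_le_mult_iff intro!: bexI[of _ "c * _"])
  finally show ?thesis using c by (auto dest!: integral_unique simp: scaleR_conv_of_real)
qed

lemma has_vector_derivative_iff_quotient:
  fixes f :: "real \<Rightarrow> complex"
  shows "(f has_vector_derivative f') (at t) \<longleftrightarrow> ((\<lambda>s. (f s - f t) / of_real (s - t)) \<longlongrightarrow> f') (at t)"
proof -
  have "(f has_vector_derivative f') (at t) \<longleftrightarrow>
      ((\<lambda>s. norm ((f s - f t) - (s - t) *\<^sub>R f') / norm (s - t)) \<longlongrightarrow> 0) (at t)"
    unfolding has_vector_derivative_def has_derivative_iff_norm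
    by (simp add: bounded_linear_scaleR_left)
  also have "\<dots> \<longleftrightarrow> ((\<lambda>s. norm ((f s - f t) / of_real (s - t) - f')) \<longlongrightarrow> 0) (at t)"
  proof (rule tendsto_cong)
    have "norm ((f s - f t) - (s - t) *\<^sub>R f') / norm (s - t) = norm ((f s - f t) / of_real (s - t) - f')" if "s \<noteq> t" for s
    proof -
      have "(f s - f t) / of_real (s - t) - f' = ((f s - f t) - (s - t) *\<^sub>R f') / of_real (s - t)"
        using that by (simp add: scaleR_conv_of_real diff_divide_distrib)
      then show ?thesis by (simp only: norm_divide norm_of_real real_norm_def)
    qed
    then show "eventually (\<lambda>s. norm ((f s - f t) - (s - t) *\<^sub>R f') / norm (s - t) = norm ((f s - f t) / of_real (s - t) - f')) (at t)"
      by (auto simp: eventually_at_filter)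
  qed
  also have "\<dots> \<longleftrightarrow> ((\<lambda>s. (f s - f t) / of_real (s - t)) \<longlongrightarrow> f') (at t)"
    by (simp add: tendsto_norm_zero_iff LIM_zero_iff)
  finally show ?thesis .
qed

text \<open>The product rule at a zero of \<open>f\<close> asks only continuity of \<open>g\<close>;
  in the applications \<open>g\<close> contains integrals over the edges.\<close>

lemma has_vector_derivative_mult_vanishing:
  fixes f g :: "real \<Rightarrow> complex"
  assumes f: "(f has_vector_derivative f') (at t)" and f0: "f t = 0" and g: "isCont g t"
  shows "((\<lambda>s. f s * g s) has_vector_derivative f' * g t) (at t)"
proof -
  have "((\<lambda>s. (f s - f t) / of_real (s - t) * g s) \<longlongrightarrow> f' * g t) (at t)"
    using f g by (intro tendsto_mult) (auto simp: isCont_def has_vector_derivative_iff_quotient)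
  then show ?thesis by (simp add: has_vector_derivative_iff_quotient f0)
qed

text \<open>Dividing the flux identity by \<open>t^2\<close> uses just the first derivatives of the
  amplitudes and gives \<open>Im (lt t) / t^2\<close> a limit. Hence the first derivative of
  \<open>Im lt\<close> vanishes at 0, and the limit is half the second.\<close>

lemma second_derivative_of_quadratic_bound:
  fixes lt :: "real \<Rightarrow> complex" and c :: "nat \<Rightarrow> complex"
  assumes d: "d > 0" and sm: "smooth_on {-d<..<d} lt" and Im0: "Im (lt 0) = 0"
    and \<alpha>: "\<And>m. m \<in> S \<Longrightarrow> ((\<lambda>t. \<alpha> t m) has_vector_derivative c m) (at 0)"
    and \<alpha>0: "\<And>m. m \<in> S \<Longrightarrow> \<alpha> 0 m = (0 :: complex)"
    and flux: "\<And>t. \<bar>t\<bar> < d \<Longrightarrow> (\<Sum>m\<in>S. (cmod (\<alpha> t m))\<^sup>2) = - 2 * Im (lt t) * ms t"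
    and ms: "(ms \<longlongrightarrow> 1) (at (0::real))"
  shows "Im (vderivs 2 lt 0) = - (\<Sum>m\<in>S. (cmod (c m))\<^sup>2)"
proof -
  define g where "g t = Im (lt t)" for t
  define g' where "g' t = Im (vderivs 1 lt t)" for t
  have dv: "vderivs n lt differentiable (at t)" if "\<bar>t\<bar> < d" for n t
  proof -
    have "t \<in> {-d<..<d}" using that by auto
    then show ?thesis using sm by (simp add: smooth_on_def)
  qed
  have hd: "((\<lambda>t. Im (vderivs n lt t)) has_real_derivative Im (vderivs (Suc n) lt t)) (at t)" if "\<bar>t\<bar> < d" for n t
  proof -
    have "(vderivs n lt has_vector_derivative vderivs (Suc n) lt t) (at t)"
      using dv[OF that] by (simp add: vector_derivative_works)
    from bounded_linear.has_vector_derivative[OF bounded_linear_Im this]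
    show ?thesis by (simp add: has_real_derivative_iff_has_vector_derivative)
  qed
  have gd: "(g has_real_derivative g' t) (at t)" if "\<bar>t\<bar> < d" for t
    using hd[OF that, of 0] by (simp add: g_def[abs_def] g'_def)
  have g'd: "(g' has_real_derivative Im (vderivs 2 lt 0)) (at 0)"
    using hd[of 0 1] d by (simp add: g'_def[abs_def] numeral_2_eq_2)
  have evd: "eventually (\<lambda>t. \<bar>t\<bar> < d \<and> t \<noteq> 0) (at 0)"
    unfolding eventually_at using d by (intro exI[of _ d]) (auto simp: dist_real_def)
  have quot: "((\<lambda>t. g t / t\<^sup>2) \<longlongrightarrow> - (\<Sum>m\<in>S. (cmod (c m))\<^sup>2) / (2 * 1)) (at 0)"
  proof (rule Lim_transform_eventually)
    have q: "((\<lambda>t. \<alpha> t m / of_real t) \<longlongrightarrow> c m) (at 0)" if "m \<in> S" for m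
      using \<alpha>[OF that] \<alpha>0[OF that]
      by (simp add: has_vector_derivative_iff_quotient)
    show "((\<lambda>t. - (\<Sum>m\<in>S. (cmod (\<alpha> t m / of_real t))\<^sup>2) / (2 * ms t)) \<longlongrightarrow> - (\<Sum>m\<in>S. (cmod (c m))\<^sup>2) / (2 * 1)) (at 0)"
      by (intro tendsto_intros q ms) auto
    have "eventually (\<lambda>t. ms t \<noteq> 0) (at 0)" using ms by (rule tendsto_imp_eventually_ne) simp
    with evd show "eventually (\<lambda>t. - (\<Sum>m\<in>S. (cmod (\<alpha> t m / of_real t))\<^sup>2) / (2 * ms t) = g t / t\<^sup>2) (at 0)"
    proof eventually_elim
      case (elim t)
      have "(\<Sum>m\<in>S. (cmod (\<alpha> t m / of_real t))\<^sup>2) = (\<Sum>m\<in>S. (cmod (\<alpha> t m))\<^sup>2) / t\<^sup>2"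
        by (simp add: norm_divide power_divide sum_divide_distrib)
      also have "\<dots> = - 2 * g t * ms t / t\<^sup>2" using flux[of t] elim by (simp add: g_def)
      finally show ?case using elim by (simp add: field_simps)
    qed
  qed
  have "((\<lambda>t. t * (g t / t\<^sup>2)) \<longlongrightarrow> 0 * (- (\<Sum>m\<in>S. (cmod (c m))\<^sup>2) / (2 * 1))) (at 0)"
    by (intro tendsto_mult quot tendsto_ident_at)
  then have "((\<lambda>t. t * (g t / t\<^sup>2)) \<longlongrightarrow> 0) (at 0)" by simp
  moreover have "eventually (\<lambda>t. t * (g t / t\<^sup>2) = g t / t) (at 0)"
    using evd by eventually_elim (simp add: power2_eq_square)
  ultimately have "((\<lambda>t. g t / t) \<longlongrightarrow> 0) (at 0)" by (rule Lim_transform_eventually)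
  moreover have "((\<lambda>t. g t / t) \<longlongrightarrow> g' 0) (at 0)"
    using gd[of 0] d Im0 by (simp add: has_field_derivative_iff g_def)
  ultimately have g'0: "g' 0 = 0" using tendsto_unique[of "at (0::real)"] by (metis at_neq_bot)
  \<comment> \<open>L'Hopital's rule, with the difference quotient of \<open>g'\<close> at 0 as the
    resulting limit.\<close>
  have "((\<lambda>t. g t / t\<^sup>2) \<longlongrightarrow> Im (vderivs 2 lt 0) / 2) (at_right 0)"
  proof (rule lhopital_right_0)
    have "isCont g 0" using gd[of 0] d by (simp add: DERIV_isCont)
    then show "(g \<longlongrightarrow> 0) (at_right 0)"
      using Im0 by (simp add: isCont_def g_def filterlim_at_split)
    show "((\<lambda>t. t\<^sup>2) \<longlongrightarrow> (0::real)) (at_right 0)" by (auto intro!: tendsto_eq_intros)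
    show "eventually (\<lambda>t. t\<^sup>2 \<noteq> (0::real)) (at_right 0)" "eventually (\<lambda>t. 2 * t \<noteq> (0::real)) (at_right 0)"
      by (auto simp: eventually_at_filter)
    have ev: "eventually (\<lambda>t. \<bar>t\<bar> < d) (at_right 0)"
      using evd by (auto simp: eventually_at_split elim: eventually_mono)
    show "eventually (\<lambda>t. (g has_real_derivative g' t) (at t)) (at_right 0)"
      using ev by eventually_elim (rule gd)
    show "eventually (\<lambda>t. ((\<lambda>t. t\<^sup>2) has_real_derivative 2 * t) (at t)) (at_right 0)"
      by (intro always_eventually allI) (auto intro!: derivative_eq_intros)
    have "((\<lambda>t. g' t / t) \<longlongrightarrow> Im (vderivs 2 lt 0)) (at 0)"
      using g'd g'0 by (simp add: has_field_derivative_iff)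
    then have "((\<lambda>t. g' t / t / 2) \<longlongrightarrow> Im (vderivs 2 lt 0) / 2) (at 0)" by (intro tendsto_intros) auto
    then have "((\<lambda>t. g' t / (2 * t)) \<longlongrightarrow> Im (vderivs 2 lt 0) / 2) (at 0)" by (simp add: mult.commute)
    then show "((\<lambda>t. g' t / (2 * t)) \<longlongrightarrow> Im (vderivs 2 lt 0) / 2) (at_right 0)"
      by (simp add: filterlim_at_split)
  qed
  moreover have "((\<lambda>t. g t / t\<^sup>2) \<longlongrightarrow> - (\<Sum>m\<in>S. (cmod (c m))\<^sup>2) / (2 * 1)) (at_right 0)"
    using quot by (simp add: filterlim_at_split)
  ultimately have "Im (vderivs 2 lt 0) / 2 = - (\<Sum>m\<in>S. (cmod (c m))\<^sup>2) / (2 * 1)"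
    using tendsto_unique[of "at_right (0::real)"] by (metis trivial_limit_at_right_real)
  then show ?thesis by simp
qed

text \<open>Unitarity is given for rows; symmetry moves the summation index \<open>k\<close> into
  the second place.\<close>

lemma unitary_norm:
  fixes c :: "nat \<Rightarrow> complex" and A :: "nat \<Rightarrow> nat \<Rightarrow> complex"
  assumes sym: "\<And>k m. k \<in> S \<Longrightarrow> m \<in> S \<Longrightarrow> A k m = A m k"
    and unit: "\<And>k j. k \<in> S \<Longrightarrow> j \<in> S \<Longrightarrow> (\<Sum>m\<in>S. A k m * cnj (A j m)) = (if k = j then 1 else 0)"
    and S: "finite S"
  shows "(\<Sum>k\<in>S. (cmod (\<Sum>m\<in>S. c m * cnj (A k m)))\<^sup>2) = (\<Sum>m\<in>S. (cmod (c m))\<^sup>2)"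
proof -
  have "complex_of_real (\<Sum>k\<in>S. (cmod (\<Sum>m\<in>S. c m * cnj (A k m)))\<^sup>2) =
    (\<Sum>k\<in>S. (\<Sum>m\<in>S. c m * cnj (A k m)) * cnj (\<Sum>m\<in>S. c m * cnj (A k m)))"
    by (simp add: complex_norm_square del: of_real_power)
  also have "\<dots> = (\<Sum>k\<in>S. \<Sum>m\<in>S. \<Sum>n\<in>S. c m * cnj (c n) * (A k n * cnj (A k m)))"
    by (simp add: sum_product ac_simps)
  also have "\<dots> = (\<Sum>m\<in>S. \<Sum>n\<in>S. \<Sum>k\<in>S. c m * cnj (c n) * (A k n * cnj (A k m)))"
    by (subst sum.swap) (intro sum.cong refl sum.swap)
  also have "\<dots> = (\<Sum>m\<in>S. \<Sum>n\<in>S. c m * cnj (c n) * (\<Sum>k\<in>S. A n k * cnj (A m k)))"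
    by (intro sum.cong refl) (auto simp: sum_distrib_left sym)
  also have "\<dots> = (\<Sum>m\<in>S. \<Sum>n\<in>S. if n = m then c m * cnj (c m) else 0)"
    by (intro sum.cong refl) (auto simp: unit)
  also have "\<dots> = (\<Sum>m\<in>S. c m * cnj (c m))"
    using S by (simp add: sum.delta')
  also have "\<dots> = complex_of_real (\<Sum>m\<in>S. (cmod (c m))\<^sup>2)"
    by (simp add: complex_norm_square del: of_real_power)
  finally show ?thesis by (simp only: of_real_eq_iff)
qed

section \<open>The coefficients \<open>F\<^sub>k\<close> in terms of wave amplitudes\<close>

lemma sum_vertices_endpoints:
  fixes f :: "nat \<Rightarrow> nat \<Rightarrow> complex"
  assumes wf: "wf_qgraph G L"
  shows "(\<Sum>v<nV G. \<Sum>m\<in>{m\<in>edges G. endpt G m v}. f m v) =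
    (\<Sum>m\<in>edges G. f m (src G m)) + (\<Sum>m\<in>fin_edges G. f m (tgt G m))"
proof -
  have "(\<Sum>m\<in>{m\<in>edges G. endpt G m v}. f m v) =
    (\<Sum>m | m \<in> edges G \<and> src G m = v. f m (src G m)) + (\<Sum>m | m \<in> fin_edges G \<and> tgt G m = v. f m (tgt G m))" for v
  proof -
    have "{m\<in>edges G. endpt G m v} = {m. m \<in> edges G \<and> src G m = v} \<union> {m. m \<in> fin_edges G \<and> tgt G m = v}"
      by (auto simp: endpt_def fin_edges_def edges_def)
    moreover have "{m. m \<in> edges G \<and> src G m = v} \<inter> {m. m \<in> fin_edges G \<and> tgt G m = v} = {}"
      by (auto dest: wf_qgraphD(3)[OF wf])
    ultimately show ?thesis by (simp add: sum.union_disjoint)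
  qed
  moreover have "(\<Sum>v<nV G. \<Sum>m | m \<in> edges G \<and> src G m = v. f m (src G m)) = (\<Sum>m\<in>edges G. f m (src G m))"
    by (rule sum.group) (auto dest: wf_qgraphD[OF wf])
  moreover have "(\<Sum>v<nV G. \<Sum>m | m \<in> fin_edges G \<and> tgt G m = v. f m (tgt G m)) = (\<Sum>m\<in>fin_edges G. f m (tgt G m))"
    by (rule sum.group) (auto dest: wf_qgraphD[OF wf])
  ultimately show ?thesis by (simp add: sum.distrib)
qed

lemma ew_wronskian: "ew z a (-b) x * ew z c d x - ew z a b x * ew z c (-d) x = 2 * (a * d - b * c)"
proof -
  let ?E = "exp (\<i> * z * of_real x)" and ?E' = "exp (- (\<i> * z * of_real x))"
  have "ew z a (-b) x * ew z c d x - ew z a b x * ew z c (-d) x = 2 * (a * d - b * c) * (?E * ?E')"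
    by (simp add: ew_def algebra_simps)
  also have "?E * ?E' = 1" by (simp flip: exp_add)
  finally show ?thesis by simp
qed

text \<open>The change of \<open>u' * w\<close> along an edge for \<open>u = ew z a b\<close> and
  \<open>w = ew w c d\<close>. The far ends \<open>x\<close> and \<open>y\<close> differ because the
  state lives on the perturbed length and its partner on the original one.\<close>

definition bterm :: "complex \<Rightarrow> complex \<Rightarrow> complex \<Rightarrow> complex \<Rightarrow> complex \<Rightarrow> complex \<Rightarrow> real \<Rightarrow> real \<Rightarrow> complex" where
  "bterm z a b w c d x y = \<i> * z * (ew z a (-b) x * ew w c d y - (a - b) * (c + d))"

text \<open>Since \<open>u\<close> and \<open>cnj e\<^sup>k\<close> solve the same equation on each edge, the boundary terms
  \<open>3 \<partial>\<^sub>\<nu>u cnj e - u \<partial>\<^sub>\<nu>cnj e\<close> sum over the two ends of the edge to \<open>2 \<partial>\<^sub>\<nu>u cnj e\<close>.\<close>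

lemma Fcoef_coefficients:
  assumes wf: "wf_qgraph G l" and lam: "lam > 0"
    and u: "\<forall>m\<in>edges G. \<forall>x\<in>eI G l m. u m x = ew lam (\<alpha> m) (\<beta> m) x"
    and E: "\<forall>m\<in>edges G. \<forall>x\<in>eI G l m. E (complex_of_real lam) k m x = ew lam (A m) (B m) x"
  shows "Fcoef G l a lam u E k =
    lam * (\<Sum>m\<in>fin_edges G. adot G a m * integral {0..l m} (\<lambda>x. ew lam (\<alpha> m) (\<beta> m) x * ew lam (cnj (B m)) (cnj (A m)) x))
    + 1 / (2 * lam) * (\<Sum>m\<in>fin_edges G. adot G a m * bterm lam (\<alpha> m) (\<beta> m) lam (cnj (B m)) (cnj (A m)) (l m) (l m))"
proof -
  let ?lam = "complex_of_real lam"
  let ?e = "E ?lam k" and ?q = "\<lambda>m. ew ?lam (cnj (B m)) (cnj (A m))" and ?q' = "\<lambda>m. ew ?lam (cnj (B m)) (- cnj (A m))"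
  have lead0: "adot G a m = 0" if "m \<in> {1..nL G}" for m
    using that lead_notin_fin[of m G] by (simp add: adot_def)
  have in0: "0 \<in> eI G l m" "l m \<in> eI G l m" if "m \<in> fin_edges G" for m
    using wf_qgraphD(4)[OF wf that] by (auto simp: eI_fin[OF that])
  have cq: "cnj (ew ?lam (A m) (B m) x) = ?q m x" for m x by (simp add: ew_cnj)
  have cq': "cnj (\<i> * ?lam * ew ?lam (A m) (- B m) x) = \<i> * ?lam * ?q' m x" for m x
    using ew_uminus[of ?lam "cnj (B m)" "- cnj (A m)" x] by (simp add: ew_cnj)
  have ipu: "ip G l (\<lambda>m x. complex_of_real (adot G a m) * u m x) ?e =
    (\<Sum>m\<in>fin_edges G. adot G a m * integral {0..l m} (\<lambda>x. ew ?lam (\<alpha> m) (\<beta> m) x * ?q m x))"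
  proof -
    have "(LINT x:eI G l m|lborel. complex_of_real (adot G a m) * u m x * cnj (?e m x)) =
      adot G a m * integral {0..l m} (\<lambda>x. ew ?lam (\<alpha> m) (\<beta> m) x * ?q m x)" if m: "m \<in> fin_edges G" for m
    proof -
      have "(LINT x:eI G l m|lborel. complex_of_real (adot G a m) * u m x * cnj (?e m x)) =
        integral {0..l m} (\<lambda>x. complex_of_real (adot G a m) * (ew ?lam (\<alpha> m) (\<beta> m) x * ?q m x))"
        unfolding eI_fin[OF m]
      proof (rule set_integral_eq_integral_cong)
        fix x assume "x \<in> {0..l m}"
        then show "complex_of_real (adot G a m) * u m x * cnj (?e m x) = complex_of_real (adot G a m) * (ew ?lam (\<alpha> m) (\<beta> m) x * ?q m x)"
          using u E fin_edges_subset[OF m] by (simp add: eI_fin[OF m] cq)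
      qed (intro continuous_intros)
      then show ?thesis by simp
    qed
    then show ?thesis unfolding ip_def sum_edges_split using lead0 by simp
  qed
  define T where "T m v = complex_of_real (adot G a m / 4) *
     (3 * dnu G l u m v * cnj (vval G l ?e m v) - vval G l u m v * cnj (dnu G l ?e m v))" for m v
  have dn: "vector_derivative (h m) (at x within eI G l m) = \<i> * ?lam * ew ?lam (a' m) (- b' m) x"
    if m: "m \<in> fin_edges G" and x: "x = 0 \<or> x = l m"
      and h: "\<forall>m\<in>edges G. \<forall>x\<in>eI G l m. h m x = ew ?lam (a' m) (b' m) x" for h a' b' m x
    by (rule vector_derivative_within_eI[OF wf fin_edges_subset[OF m] _ _ ew_deriv])
       (use m x h fin_edges_subset[OF m] in auto)
  have Tm: "T m (src G m) + T m (tgt G m) = adot G a m / 2 * bterm lam (\<alpha> m) (\<beta> m) lam (cnj (B m)) (cnj (A m)) (l m) (l m)"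
    if m: "m \<in> fin_edges G" for m
  proof -
    have ne: "src G m \<noteq> tgt G m" by (rule wf_qgraphD(3)[OF wf m])
    have me: "m \<in> edges G" by (rule fin_edges_subset[OF m])
    have v0: "vval G l u m (src G m) = ew ?lam (\<alpha> m) (\<beta> m) 0" "cnj (vval G l ?e m (src G m)) = ?q m 0"
      using u E me in0[OF m] by (auto simp: vval_def simp flip: cq)
    have vl: "vval G l u m (tgt G m) = ew ?lam (\<alpha> m) (\<beta> m) (l m)" "cnj (vval G l ?e m (tgt G m)) = ?q m (l m)"
      using u E me in0[OF m] ne by (auto simp: vval_def simp flip: cq)
    have d0: "dnu G l u m (src G m) = - (\<i> * ?lam * ew ?lam (\<alpha> m) (- \<beta> m) 0)"
      "cnj (dnu G l ?e m (src G m)) = - (\<i> * ?lam * ?q' m 0)"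
      unfolding cq'[symmetric] using dn[OF m _ u, of 0] dn[OF m _ E, of 0] by (simp_all add: dnu_def)
    have dl: "dnu G l u m (tgt G m) = \<i> * ?lam * ew ?lam (\<alpha> m) (- \<beta> m) (l m)"
      "cnj (dnu G l ?e m (tgt G m)) = \<i> * ?lam * ?q' m (l m)"
      unfolding cq'[symmetric] using dn[OF m _ u, of "l m"] dn[OF m _ E, of "l m"] ne by (simp_all add: dnu_def)
    let ?p = "ew ?lam (\<alpha> m) (\<beta> m)" and ?p' = "ew ?lam (\<alpha> m) (- \<beta> m)"
    have w: "?p (l m) * ?q' m (l m) = ?p' (l m) * ?q m (l m) - (?p' 0 * ?q m 0 - ?p 0 * ?q' m 0)"
      using ew_wronskian[of ?lam "\<alpha> m" "\<beta> m" "l m" "cnj (B m)" "cnj (A m)"]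
        ew_wronskian[of ?lam "\<alpha> m" "\<beta> m" 0 "cnj (B m)" "cnj (A m)"]
      by (simp add: algebra_simps)
    have "T m (src G m) + T m (tgt G m) = complex_of_real (adot G a m / 4) * (\<i> * ?lam) *
       (3 * (?p' (l m) * ?q m (l m)) - 3 * (?p' 0 * ?q m 0) - ?p (l m) * ?q' m (l m) + ?p 0 * ?q' m 0)"
      unfolding T_def v0 vl d0 dl by (simp add: algebra_simps)
    also have "\<dots> = complex_of_real (adot G a m / 4) * (\<i> * ?lam) * (2 * (?p' (l m) * ?q m (l m) - ?p' 0 * ?q m 0))"
      unfolding w by (simp add: algebra_simps)
    also have "\<dots> = adot G a m / 2 * bterm lam (\<alpha> m) (\<beta> m) lam (cnj (B m)) (cnj (A m)) (l m) (l m)"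
      by (simp add: bterm_def)
    finally show ?thesis .
  qed
  have "(\<Sum>v<nV G. \<Sum>m\<in>{m\<in>edges G. endpt G m v}. T m v) = (\<Sum>m\<in>fin_edges G. T m (src G m) + T m (tgt G m))"
    unfolding sum_vertices_endpoints[OF wf] sum_edges_split sum.distrib
    by (simp add: T_def lead0)
  also have "\<dots> = 1 / 2 * (\<Sum>m\<in>fin_edges G. adot G a m * bterm lam (\<alpha> m) (\<beta> m) lam (cnj (B m)) (cnj (A m)) (l m) (l m))"
    unfolding sum_distrib_left by (intro sum.cong) (auto simp: Tm)
  finally have sT: "(\<Sum>v<nV G. \<Sum>m\<in>{m\<in>edges G. endpt G m v}. T m v) =
    1 / 2 * (\<Sum>m\<in>fin_edges G. adot G a m * bterm lam (\<alpha> m) (\<beta> m) lam (cnj (B m)) (cnj (A m)) (l m) (l m))" .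
  show ?thesis
    unfolding Fcoef_def Let_def ipu T_def[symmetric] sT by simp
qed

section \<open>Green's identity for the rescaled state\<close>

lemma ew_green_edge:
  assumes "0 \<le> b"
  shows "(w\<^sup>2 - z\<^sup>2) * integral {0..b} (\<lambda>x. ew z a a' x * ew w c c' x) =
    (\<i> * z * ew z a (-a') b * ew w c c' b - \<i> * z * (a - a') * (c + c'))
    - (\<i> * w * ew w c (-c') b * ew z a a' b - \<i> * w * (c - c') * (a + a'))"
proof -
  have "((\<lambda>x. (w\<^sup>2 - z\<^sup>2) * (ew z a a' x * ew w c c' x)) has_integral
     ((\<i> * z * ew z a (-a') b) * ew w c c' b - ew z a a' b * (\<i> * w * ew w c (-c') b))
     - ((\<i> * z * ew z a (-a') 0) * ew w c c' 0 - ew z a a' 0 * (\<i> * w * ew w c (-c') 0))) {0..b}"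
  proof (rule fundamental_theorem_of_calculus[OF assms])
    fix x
    have "((\<lambda>x. (\<i> * z * ew z a (-a') x) * ew w c c' x - ew z a a' x * (\<i> * w * ew w c (-c') x)) has_vector_derivative
      ((\<i> * z * ew z a (-a') x) * (\<i> * w * ew w c (-c') x) + (- (z\<^sup>2) * ew z a a' x) * ew w c c' x)
      - (ew z a a' x * (- (w\<^sup>2) * ew w c c' x) + (\<i> * z * ew z a (-a') x) * (\<i> * w * ew w c (-c') x))) (at x within {0..b})"
      by (intro has_vector_derivative_diff has_vector_derivative_mult ew_deriv ew_deriv2)
    then show "((\<lambda>x. (\<i> * z * ew z a (-a') x) * ew w c c' x - ew z a a' x * (\<i> * w * ew w c (-c') x)) has_vector_derivative
      (w\<^sup>2 - z\<^sup>2) * (ew z a a' x * ew w c c' x)) (at x within {0..b})"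
      by (rule has_vector_derivative_eq_rhs) (simp add: algebra_simps)
  qed
  from integral_unique[OF this]
  have "(w\<^sup>2 - z\<^sup>2) * integral {0..b} (\<lambda>x. ew z a a' x * ew w c c' x) =
     ((\<i> * z * ew z a (-a') b) * ew w c c' b - ew z a a' b * (\<i> * w * ew w c (-c') b))
     - ((\<i> * z * ew z a (-a') 0) * ew w c c' 0 - ew z a a' 0 * (\<i> * w * ew w c (-c') 0))"
    by (simp only: integral_mult_right)
  also have "\<dots> = (\<i> * z * ew z a (-a') b * ew w c c' b - \<i> * z * (a - a') * (c + c'))
    - (\<i> * w * ew w c (-c') b * ew z a a' b - \<i> * w * (c - c') * (a + a'))"
    by (simp add: algebra_simps)
  finally show ?thesis .
qed

text \<open>An outgoing state for the lengths \<open>\<rho>\<^sub>m l\<^sub>m\<close> is rescaled to the lengths \<open>l\<^sub>m\<close> and paired with a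
  solution \<open>ew w c c'\<close> of the unperturbed problem; every term on the right is small if \<open>\<rho>\<close> is close
  to \<open>1\<close> and the state is small on the leads.\<close>

lemma rescaled_green:
  assumes wf: "wf_qgraph G l"
    and bc1: "bc G (\<lambda>m. \<rho> m * l m) z \<alpha> \<beta>" and out: "outgoing G \<beta>"
    and bc2: "bc G l w c c'"
  shows "(\<Sum>m\<in>fin_edges G. (w\<^sup>2 - (z * \<rho> m)\<^sup>2) * integral {0..l m} (\<lambda>x. ew (z * \<rho> m) (\<alpha> m) (\<beta> m) x * ew w (c m) (c' m) x))
    = (\<Sum>m=1..nL G. \<alpha> m * (\<i> * (z * (c m + c' m) - w * (c m - c' m))))
      + (\<Sum>m\<in>fin_edges G. (\<rho> m - 1) * bterm z (\<alpha> m) (\<beta> m) w (c m) (c' m) (\<rho> m * l m) (l m))"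
proof -
  define P where "P m = bterm z (\<alpha> m) (\<beta> m) w (c m) (c' m) (\<rho> m * l m) (l m)" for m
  define Q where "Q m = \<i> * w * ew w (c m) (- c' m) (l m) * ew z (\<alpha> m) (\<beta> m) (\<rho> m * l m) - \<i> * w * (c m - c' m) * (\<alpha> m + \<beta> m)" for m
  \<comment> \<open>The rescaled state has flux \<open>\<rho> m * P m\<close>, but the Kirchhoff law
    holds for the unscaled derivative, that is for \<open>P m\<close>; the surplus
    \<open>(\<rho> m - 1) * P m\<close> is split off.\<close>
  have edge: "(w\<^sup>2 - (z * \<rho> m)\<^sup>2) * integral {0..l m} (\<lambda>x. ew (z * \<rho> m) (\<alpha> m) (\<beta> m) x * ew w (c m) (c' m) x)
     = (\<rho> m - 1) * P m + P m - Q m" if m: "m \<in> fin_edges G" for m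
    by (subst ew_green_edge[OF less_imp_le[OF wf_qgraphD(4)[OF wf m]]])
       (simp only: ew_mult_freq P_def Q_def bterm_def, simp add: algebra_simps)
  have sP: "(\<Sum>m\<in>fin_edges G. P m) = (\<Sum>m=1..nL G. \<i> * z * (\<alpha> m - \<beta> m) * (c m + c' m))"
    using green_bd[OF wf bcD(2)[OF bc1] bcD(1)[OF bc2]] by (simp add: P_def bterm_def algebra_simps)
  have sQ: "(\<Sum>m\<in>fin_edges G. Q m) = (\<Sum>m=1..nL G. \<i> * w * (c m - c' m) * (\<alpha> m + \<beta> m))"
    using green_bd[OF wf bcD(2)[OF bc2] bcD(1)[OF bc1]] by (simp add: Q_def)
  have "(\<Sum>m=1..nL G. \<i> * z * (\<alpha> m - \<beta> m) * (c m + c' m)) - (\<Sum>m=1..nL G. \<i> * w * (c m - c' m) * (\<alpha> m + \<beta> m))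
    = (\<Sum>m=1..nL G. \<alpha> m * (\<i> * (z * (c m + c' m) - w * (c m - c' m))))"
    unfolding sum_subtractf[symmetric] using out by (intro sum.cong) (auto simp: outgoing_def algebra_simps)
  then have "(\<Sum>m\<in>fin_edges G. P m) - (\<Sum>m\<in>fin_edges G. Q m) = (\<Sum>m=1..nL G. \<alpha> m * (\<i> * (z * (c m + c' m) - w * (c m - c' m))))"
    unfolding sP sQ .
  then show ?thesis
    unfolding P_def[symmetric] using edge by (simp add: sum.distrib sum_subtractf)
qed

lemma vector_derivative_exp_scale:
  fixes h :: "real \<Rightarrow> real"
  assumes "smooth_on UNIV h" "h 0 = 0"
  shows "((\<lambda>t. complex_of_real (exp (- h t))) has_vector_derivative - complex_of_real (vector_derivative h (at 0))) (at 0)"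
proof -
  have "(h has_real_derivative vector_derivative h (at 0)) (at 0)"
    using smooth_has_derivative[OF assms(1), of 0 0] by simp
  then have "((\<lambda>t. exp (- h t)) has_real_derivative - vector_derivative h (at 0)) (at 0)"
    using assms(2) by (auto intro!: derivative_eq_intros)
  from has_vector_derivative_of_real[OF this] show ?thesis by simp
qed

text \<open>Differentiate the Green identity for the rescaled state at \<open>t = 0\<close>.\<close>

lemma lead_coefficient_derivative:
  fixes lt :: "real \<Rightarrow> complex"
  assumes wf: "wf_qgraph G l" and lam: "lam > 0"
    and a_smooth: "\<forall>m\<in>fin_edges G. smooth_on UNIV (a m)" and a_zero: "\<forall>m\<in>fin_edges G. a m 0 = 0"
    and d: "d > 0" and lt0: "lt 0 = complex_of_real lam" and ltd: "(lt has_vector_derivative lt') (at 0)"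
    and bc: "\<forall>t. \<bar>t\<bar> < d \<longrightarrow> bc G (\<lambda>m. exp (- a m t) * l m) (lt t) (\<alpha> t) (\<beta> t) \<and> outgoing G (\<beta> t)"
    and \<alpha>c: "\<And>m. m \<in> edges G \<Longrightarrow> isCont (\<lambda>t. \<alpha> t m) 0" and \<beta>c: "\<And>m. m \<in> edges G \<Longrightarrow> isCont (\<lambda>t. \<beta> t m) 0"
    and \<alpha>d: "\<And>m. m \<in> {1..nL G} \<Longrightarrow> ((\<lambda>t. \<alpha> t m) has_vector_derivative c m) (at 0)"
    and \<alpha>0: "\<And>m. m \<in> {1..nL G} \<Longrightarrow> \<alpha> 0 m = 0"
    and bcE: "bc G l (complex_of_real lam) A B"
    and orth: "(\<Sum>m\<in>fin_edges G. integral {0..l m} (\<lambda>x. ew lam (\<alpha> 0 m) (\<beta> 0 m) x * ew lam (cnj (B m)) (cnj (A m)) x)) = 0"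
  shows "\<i> * (\<Sum>m=1..nL G. c m * cnj (A m)) =
    lam * (\<Sum>m\<in>fin_edges G. adot G a m * integral {0..l m} (\<lambda>x. ew lam (\<alpha> 0 m) (\<beta> 0 m) x * ew lam (cnj (B m)) (cnj (A m)) x))
    + 1 / (2 * lam) * (\<Sum>m\<in>fin_edges G. adot G a m * bterm lam (\<alpha> 0 m) (\<beta> 0 m) lam (cnj (B m)) (cnj (A m)) (l m) (l m))"
proof -
  let ?lam = "complex_of_real lam"
  define \<rho> where "\<rho> m t = exp (- a m t)" for m t
  define I where "I m t = integral {0..l m} (\<lambda>x. ew (lt t * \<rho> m t) (\<alpha> t m) (\<beta> t m) x * ew ?lam (cnj (B m)) (cnj (A m)) x)" for m t
  define T where "T m t = bterm (lt t) (\<alpha> t m) (\<beta> t m) ?lam (cnj (B m)) (cnj (A m)) (\<rho> m t * l m) (l m)" for m t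
  define R where "R m t = \<i> * (lt t * (cnj (B m) + cnj (A m)) - ?lam * (cnj (B m) - cnj (A m)))" for m t
  have bcE': "bc G l ?lam (\<lambda>m. cnj (B m)) (\<lambda>m. cnj (A m))" using bc_cnj[OF bcE] by simp
  have eq: "(\<Sum>m\<in>fin_edges G. (?lam\<^sup>2 - (lt t * \<rho> m t)\<^sup>2) * I m t) =
     (\<Sum>m=1..nL G. \<alpha> t m * R m t) + (\<Sum>m\<in>fin_edges G. (complex_of_real (\<rho> m t) - 1) * T m t)" if "\<bar>t\<bar> < d" for t
    unfolding I_def T_def R_def
    by (rule rescaled_green[OF wf _ _ bcE']) (use bc that in \<open>auto simp: \<rho>_def\<close>)
  have \<rho>d: "((\<lambda>t. complex_of_real (\<rho> m t)) has_vector_derivative - complex_of_real (adot G a m)) (at 0)"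
    if "m \<in> fin_edges G" for m
    using vector_derivative_exp_scale[of "a m"] a_smooth a_zero that by (simp add: \<rho>_def adot_def)
  have \<rho>0: "\<rho> m 0 = 1" if "m \<in> fin_edges G" for m using a_zero that by (simp add: \<rho>_def)
  have ltc: "isCont lt 0" using ltd by (rule has_vector_derivative_continuous)
  have \<rho>c: "isCont (\<lambda>t. complex_of_real (\<rho> m t)) 0" if "m \<in> fin_edges G" for m
    using \<rho>d[OF that] by (rule has_vector_derivative_continuous)
  have \<rho>c': "isCont (\<rho> m) 0" if "m \<in> fin_edges G" for m
    using continuous_Re[OF \<rho>c[OF that]] by simp
  have Ic: "isCont (I m) 0" if "m \<in> fin_edges G" for m
    unfolding I_def[abs_def] using that fin_edges_subset[OF that]
    by (intro isCont_ew_integral continuous_intros ltc \<rho>c \<alpha>c \<beta>c)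
  have Tc: "isCont (T m) 0" if "m \<in> fin_edges G" for m
    unfolding T_def[abs_def] bterm_def using that fin_edges_subset[OF that]
    by (intro continuous_intros ltc \<rho>c' \<alpha>c \<beta>c)
  have Rc: "isCont (R m) 0" for m unfolding R_def[abs_def] by (intro continuous_intros ltc)
  have fd: "((\<lambda>t. ?lam\<^sup>2 - (lt t * \<rho> m t)\<^sup>2) has_vector_derivative 2 * ?lam\<^sup>2 * adot G a m - 2 * ?lam * lt') (at 0)"
    if m: "m \<in> fin_edges G" for m
  proof -
    have p: "((\<lambda>t. lt t * \<rho> m t) has_vector_derivative lt 0 * (- complex_of_real (adot G a m)) + lt' * \<rho> m 0) (at 0)"
      by (intro has_vector_derivative_mult ltd \<rho>d[OF m])
    have "((\<lambda>t. ?lam\<^sup>2 - (lt t * \<rho> m t) * (lt t * \<rho> m t)) has_vector_derivative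
      0 - ((lt 0 * \<rho> m 0) * (lt 0 * (- complex_of_real (adot G a m)) + lt' * \<rho> m 0) +
      (lt 0 * (- complex_of_real (adot G a m)) + lt' * \<rho> m 0) * (lt 0 * \<rho> m 0))) (at 0)"
      by (intro has_vector_derivative_diff has_vector_derivative_const has_vector_derivative_mult p)
    then show ?thesis by (simp add: \<rho>0[OF m] lt0 power2_eq_square algebra_simps)
  qed
  \<comment> \<open>In this and the next two derivatives one factor of each product vanishes at 0,
    so the integral, flux and lead factors enter through continuity alone.\<close>
  have L: "((\<lambda>t. \<Sum>m\<in>fin_edges G. (?lam\<^sup>2 - (lt t * \<rho> m t)\<^sup>2) * I m t) has_vector_derivative
     (\<Sum>m\<in>fin_edges G. (2 * ?lam\<^sup>2 * adot G a m - 2 * ?lam * lt') * I m 0)) (at 0)"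
    by (intro has_vector_derivative_sum has_vector_derivative_mult_vanishing fd Ic) (auto simp: lt0 \<rho>0)
  have R1: "((\<lambda>t. \<Sum>m=1..nL G. \<alpha> t m * R m t) has_vector_derivative (\<Sum>m=1..nL G. c m * R m 0)) (at 0)"
    by (intro has_vector_derivative_sum has_vector_derivative_mult_vanishing \<alpha>d \<alpha>0 Rc) auto
  have R2: "((\<lambda>t. \<Sum>m\<in>fin_edges G. (complex_of_real (\<rho> m t) - 1) * T m t) has_vector_derivative
     (\<Sum>m\<in>fin_edges G. (- complex_of_real (adot G a m) - 0) * T m 0)) (at 0)"
    by (intro has_vector_derivative_sum has_vector_derivative_mult_vanishing has_vector_derivative_diff
        has_vector_derivative_const \<rho>d Tc) (auto simp: \<rho>0)
  have "((\<lambda>t. \<Sum>m\<in>fin_edges G. (?lam\<^sup>2 - (lt t * \<rho> m t)\<^sup>2) * I m t) has_vector_derivative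
     (\<Sum>m=1..nL G. c m * R m 0) + (\<Sum>m\<in>fin_edges G. (- complex_of_real (adot G a m) - 0) * T m 0)) (at 0)"
    by (rule has_vector_derivative_transform_within_open[OF has_vector_derivative_add[OF R1 R2], of "{-d<..<d}"])
       (use d eq in auto)
  then have id: "(\<Sum>m\<in>fin_edges G. (2 * ?lam\<^sup>2 * adot G a m - 2 * ?lam * lt') * I m 0) =
     (\<Sum>m=1..nL G. c m * R m 0) + (\<Sum>m\<in>fin_edges G. (- complex_of_real (adot G a m) - 0) * T m 0)"
    using L vector_derivative_unique_at by blast
  have I0: "I m 0 = integral {0..l m} (\<lambda>x. ew ?lam (\<alpha> 0 m) (\<beta> 0 m) x * ew ?lam (cnj (B m)) (cnj (A m)) x)"
    if "m \<in> fin_edges G" for m using that by (simp add: I_def lt0 \<rho>0)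
  have T0: "T m 0 = bterm ?lam (\<alpha> 0 m) (\<beta> 0 m) ?lam (cnj (B m)) (cnj (A m)) (l m) (l m)"
    if "m \<in> fin_edges G" for m using that by (simp add: T_def lt0 \<rho>0)
  have R0: "R m 0 = 2 * ?lam * (\<i> * cnj (A m))" for m by (simp add: R_def lt0 algebra_simps)
  let ?SI = "\<Sum>m\<in>fin_edges G. adot G a m * I m 0" and ?ST = "\<Sum>m\<in>fin_edges G. adot G a m * T m 0"
    and ?SA = "\<Sum>m=1..nL G. c m * cnj (A m)"
  have orth': "(\<Sum>m\<in>fin_edges G. I m 0) = 0" using orth by (simp add: I0)
  have "(\<Sum>m\<in>fin_edges G. (2 * ?lam\<^sup>2 * adot G a m - 2 * ?lam * lt') * I m 0) =
     2 * ?lam\<^sup>2 * ?SI - 2 * ?lam * lt' * (\<Sum>m\<in>fin_edges G. I m 0)"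
    by (simp add: sum_distrib_left sum_subtractf algebra_simps)
  moreover have "(\<Sum>m=1..nL G. c m * R m 0) = 2 * ?lam * (\<i> * ?SA)"
    unfolding R0 by (simp add: sum_distrib_left algebra_simps)
  moreover have "(\<Sum>m\<in>fin_edges G. (- complex_of_real (adot G a m) - 0) * T m 0) = - ?ST"
    by (simp add: sum_negf)
  ultimately have "2 * ?lam\<^sup>2 * ?SI = 2 * ?lam * (\<i> * ?SA) - ?ST" using id orth' by simp
  then have "2 * ?lam * (\<i> * ?SA) = 2 * ?lam * (?lam * ?SI + 1 / (2 * ?lam) * ?ST)"
    using lam by (simp add: power2_eq_square algebra_simps)
  then have "\<i> * ?SA = ?lam * ?SI + 1 / (2 * ?lam) * ?ST"
    using lam by (subst (asm) mult_cancel_left) simp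
  then show ?thesis by (simp add: I0 T0)
qed

lemma scaled_ew_integral:
  assumes "0 < r" "0 \<le> b"
  shows "integral {0..r * b} (\<lambda>x. ew z1 a1 b1 x * ew z2 a2 b2 x)
    = of_real r * integral {0..b} (\<lambda>x. ew (z1 * of_real r) a1 b1 x * ew (z2 * of_real r) a2 b2 x)"
  unfolding ew_mult_freq by (rule integral_stretch[OF assms]) (intro continuous_intros)

lemma outgoing_cnj: "outgoing G \<alpha> \<Longrightarrow> outgoing G (\<lambda>m. cnj (\<alpha> m))"
  by (simp add: outgoing_def)

lemma ip_eq_mass:
  assumes wf: "wf_qgraph G l" and out: "outgoing G \<alpha>" "outgoing G \<beta>"
    and u: "\<forall>m\<in>edges G. \<forall>x\<in>eI G l m. u m x = ew z (\<alpha> m) (\<beta> m) x"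
  shows "ip G l u u = mass G l z \<alpha> \<beta>"
proof -
  have "(LINT x:eI G l m|lborel. u m x * cnj (u m x)) = 0" if m: "m \<in> {1..nL G}" for m
  proof -
    have "(LINT x:eI G l m|lborel. u m x * cnj (u m x)) = (LINT x:eI G l m|lborel. 0)"
      unfolding set_lebesgue_integral_def
      by (intro Bochner_Integration.integral_cong)
         (use u lead_in_edges[OF m] out m in \<open>auto simp: indicator_def outgoing_def\<close>)
    then show ?thesis by simp
  qed
  moreover have "(LINT x:eI G l m|lborel. u m x * cnj (u m x)) =
    integral {0..l m} (\<lambda>x. ew z (\<alpha> m) (\<beta> m) x * ew (cnj z) (cnj (\<beta> m)) (cnj (\<alpha> m)) x)" if m: "m \<in> fin_edges G" for m
    unfolding eI_fin[OF m]
  proof (rule set_integral_eq_integral_cong)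
    fix x assume "x \<in> {0..l m}"
    then show "u m x * cnj (u m x) = ew z (\<alpha> m) (\<beta> m) x * ew (cnj z) (cnj (\<beta> m)) (cnj (\<alpha> m)) x"
      using u fin_edges_subset[OF m] by (simp add: eI_fin[OF m] ew_cnj)
  qed (intro continuous_intros)
  ultimately show ?thesis unfolding ip_def sum_edges_split mass_complex by simp
qed

theorem theorem1:
  fixes G :: qgraph and l :: "nat \<Rightarrow> real" and a :: "nat \<Rightarrow> real \<Rightarrow> real"
    and lam :: real and u :: "nat \<Rightarrow> real \<Rightarrow> complex"
    and E :: "complex \<Rightarrow> nat \<Rightarrow> nat \<Rightarrow> real \<Rightarrow> complex"
  assumes wf: "wf_qgraph G l"
    and a_smooth: "\<forall>m\<in>fin_edges G. smooth_on UNIV (a m)"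
    and a_zero: "\<forall>m\<in>fin_edges G. a m 0 = 0"
    and lam_pos: "lam > 0"
    and simple: "simple_eigenvalue G l (complex_of_real (lam\<^sup>2))"
    and u_eig: "eigfun G l (complex_of_real (lam\<^sup>2)) u"
    and u_norm: "ip G l u u = 1"
    and E_gen: "gen_eigfuns G l E"
  shows "\<exists>t0>0. \<exists>lt :: real \<Rightarrow> complex.
           smooth_on {-t0<..<t0} lt \<and> lt 0 = complex_of_real lam \<and>
           (\<forall>t. \<bar>t\<bar> < t0 \<longrightarrow> lt t \<in> Res G (\<lambda>m. exp (- a m t) * l m)) \<and>
           Im (vderivs 2 lt 0) = - (\<Sum>k=1..nL G. (cmod (Fcoef G l a lam u E k))\<^sup>2)"
proof -
  let ?lam = "complex_of_real lam"
  have lam0: "?lam \<noteq> 0" "0 \<le> Im ?lam" using lam_pos by auto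
  have sol: "solves G l (?lam\<^sup>2) u zero_fun" using u_eig by (simp add: eigfun_def)
  obtain \<alpha>0 \<beta>0 where out0: "outgoing G \<beta>0" "Im ?lam = 0 \<longrightarrow> outgoing G \<alpha>0" and bc0: "bc G l ?lam \<alpha>0 \<beta>0"
    and uc: "\<forall>m\<in>edges G. \<forall>x\<in>eI G l m. u m x = ew ?lam (\<alpha>0 m) (\<beta>0 m) x"
    by (rule homogeneous_solves_coefficients[OF wf lam0 sol])
  have outa: "outgoing G \<alpha>0" using out0(2) by simp
  have mass1: "complex_of_real (mass G l ?lam \<alpha>0 \<beta>0) = 1"
    using ip_eq_mass[OF wf outa out0(1) uc] u_norm by simp
  then have mass0: "mass G l ?lam \<alpha>0 \<beta>0 \<noteq> 0" by auto
  obtain d lt \<alpha> \<beta> where d: "d > 0" and sm: "smooth_on {-d<..<d} lt" and lt0: "lt 0 = ?lam"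
    and bct: "\<forall>t. \<bar>t\<bar> < d \<longrightarrow> bc G (\<lambda>m. exp (- a m t) * l m) (lt t) (\<alpha> t) (\<beta> t) \<and> outgoing G (\<beta> t)"
    and at0: "\<forall>m\<in>edges G. \<alpha> 0 m = \<alpha>0 m \<and> \<beta> 0 m = \<beta>0 m"
    and diff: "\<forall>m\<in>edges G. (\<lambda>t. \<alpha> t m) differentiable (at 0) \<and> (\<lambda>t. \<beta> t m) differentiable (at 0)"
    by (rule resonance_branch[OF wf lam_pos a_smooth a_zero simple u_eig uc bc0 outa out0(1) mass0])
  define \<rho> where "\<rho> m t = exp (- a m t)" for m t
  have \<rho>pos: "0 < \<rho> m t" for m t by (simp add: \<rho>_def)
  have lpos: "0 \<le> l m" if "m \<in> fin_edges G" for m using wf_qgraphD(4)[OF wf that] by simp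
  have \<rho>0: "\<rho> m 0 = 1" if "m \<in> fin_edges G" for m using a_zero that by (simp add: \<rho>_def)
  have \<rho>c: "isCont (\<lambda>t. complex_of_real (\<rho> m t)) 0" if "m \<in> fin_edges G" for m
    unfolding \<rho>_def using vector_derivative_exp_scale[of "a m"] a_smooth a_zero that
    by (auto intro: has_vector_derivative_continuous)
  have wft: "wf_qgraph G (\<lambda>m. \<rho> m t * l m)" for t
    using wf \<rho>pos by (auto simp: wf_qgraph_def)
  have "vderivs 0 lt differentiable (at 0)"
  proof -
    have "0 \<in> {-d<..<d}" using d by simp
    then show ?thesis using sm unfolding smooth_on_def by blast
  qed
  then obtain lt' where ltd: "(lt has_vector_derivative lt') (at 0)"
    using vector_derivative_works by auto
  have ltc: "isCont lt 0" using ltd by (rule has_vector_derivative_continuous)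
  have \<alpha>c: "isCont (\<lambda>t. \<alpha> t m) 0" and \<beta>c: "isCont (\<lambda>t. \<beta> t m) 0" if "m \<in> edges G" for m
    using diff that differentiable_imp_continuous_within by blast+
  define c where "c m = vector_derivative (\<lambda>t. \<alpha> t m) (at 0)" for m
  have \<alpha>d: "((\<lambda>t. \<alpha> t m) has_vector_derivative c m) (at 0)" if "m \<in> {1..nL G}" for m
    using diff lead_in_edges[OF that] unfolding c_def vector_derivative_works by blast
  have \<alpha>0: "\<alpha> 0 m = 0" if "m \<in> {1..nL G}" for m
    using at0 lead_in_edges[OF that] outa that by (simp add: outgoing_def)

  \<comment> \<open>The pairing required by \<open>outgoing_state_resonance\<close>, with the
    conjugated eigenfunction waves as source, pulled back to fixed intervals to obtain continuity in
    \<open>t\<close>. At \<open>t = 0\<close> it is the mass of the eigenfunction, which is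
    1.\<close>
  define N where "N t = (\<Sum>m\<in>fin_edges G. of_real (\<rho> m t) * integral {0..l m} (\<lambda>x.
     ew (?lam * \<rho> m t) (cnj (\<beta>0 m)) (cnj (\<alpha>0 m)) x * ew (lt t * \<rho> m t) (\<alpha> t m) (\<beta> t m) x))" for t
  have Neq: "(\<Sum>m\<in>fin_edges G. integral {0..\<rho> m t * l m} (\<lambda>x.
     ew ?lam (cnj (\<beta>0 m)) (cnj (\<alpha>0 m)) x * ew (lt t) (\<alpha> t m) (\<beta> t m) x)) = N t" for t
    unfolding N_def by (intro sum.cong refl scaled_ew_integral \<rho>pos lpos)
  have N0: "N 0 = 1"
  proof -
    have "N 0 = complex_of_real (mass G l ?lam \<alpha>0 \<beta>0)"
      unfolding N_def mass_complex
      by (intro sum.cong refl) (use at0 fin_edges_subset in \<open>simp add: lt0 \<rho>0 mult.commute\<close>)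
    then show ?thesis using mass1 by simp
  qed
  have Nc: "isCont N 0" unfolding N_def
    by (intro continuous_intros isCont_ew_integral \<rho>c ltc \<alpha>c \<beta>c fin_edges_subset)
  \<comment> \<open>The mass of the state on the perturbed graph, the factor of
    \<open>Im (lt t)\<close> in the flux identity; its limit 1 comes from the normalisation of
    \<open>u\<close>.\<close>
  define ms where "ms t = mass G (\<lambda>m. \<rho> m t * l m) (lt t) (\<alpha> t) (\<beta> t)" for t
  define Mc where "Mc t = (\<Sum>m\<in>fin_edges G. of_real (\<rho> m t) * integral {0..l m} (\<lambda>x.
     ew (lt t * \<rho> m t) (\<alpha> t m) (\<beta> t m) x * ew (cnj (lt t) * \<rho> m t) (cnj (\<beta> t m)) (cnj (\<alpha> t m)) x))" for t
  have ms_eq: "complex_of_real (ms t) = Mc t" for t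
    unfolding ms_def mass_complex Mc_def by (intro sum.cong refl scaled_ew_integral \<rho>pos lpos)
  have Mcc: "isCont Mc 0" unfolding Mc_def
    by (intro continuous_intros isCont_ew_integral \<rho>c ltc \<alpha>c \<beta>c fin_edges_subset)
  have "Mc 0 = complex_of_real (mass G l ?lam \<alpha>0 \<beta>0)"
    unfolding Mc_def mass_complex
    by (intro sum.cong refl) (use at0 fin_edges_subset in \<open>simp add: lt0 \<rho>0\<close>)
  then have "((\<lambda>t. Re (Mc t)) \<longlongrightarrow> 1) (at 0)"
    using tendsto_Re[OF Mcc[unfolded isCont_def]] mass1 by simp
  then have mslim: "(ms \<longlongrightarrow> 1) (at 0)" by (simp flip: ms_eq)

  \<comment> \<open>The interval is shrunk so that the pairing stays nonzero (resonance) and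
    \<open>Re (lt t)\<close> stays positive (second form of the flux identity).\<close>
  have "eventually (\<lambda>t. N t \<noteq> 0) (at 0)"
    using Nc N0 by (intro tendsto_imp_eventually_ne[of N 1]) (auto simp: isCont_def)
  moreover have "eventually (\<lambda>t. Re (lt t) > 0) (at 0)"
    using tendsto_Re[OF ltc[unfolded isCont_def]] lt0 lam_pos by (intro order_tendstoD(1)) auto
  ultimately have "eventually (\<lambda>t. N t \<noteq> 0 \<and> Re (lt t) > 0) (at 0)" by (rule eventually_conj)
  then obtain e where e: "e > 0" "\<And>t. t \<noteq> 0 \<Longrightarrow> \<bar>t\<bar> < e \<Longrightarrow> N t \<noteq> 0 \<and> Re (lt t) > 0"
    unfolding eventually_at by (auto simp: dist_real_def)
  have good: "N t \<noteq> 0" "Re (lt t) > 0" if "\<bar>t\<bar> < e" for t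
    using e(2)[of t] that N0 lt0 lam_pos by (cases "t = 0"; simp)+
  define t0 where "t0 = min d e"
  have bct': "bc G (\<lambda>m. \<rho> m t * l m) (lt t) (\<alpha> t) (\<beta> t)" "outgoing G (\<beta> t)" if "\<bar>t\<bar> < t0" for t
    using bct that by (auto simp: t0_def \<rho>_def)
  have nz: "lt t \<noteq> 0" "Re (lt t) \<noteq> 0" if "\<bar>t\<bar> < t0" for t
    using good(2)[of t] that by (auto simp: t0_def)
  have sm': "smooth_on {-t0<..<t0} lt"
    using sm unfolding smooth_on_def t0_def by auto
  \<comment> \<open>Conjugating the eigenfunction exchanges its amplitudes, hence the source
    coefficients \<open>cnj (\<beta>0 m)\<close> and \<open>cnj (\<alpha>0 m)\<close> in this
    order.\<close>
  have res: "lt t \<in> Res G (\<lambda>m. exp (- a m t) * l m)" if t: "\<bar>t\<bar> < t0" for t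
    using outgoing_state_resonance[OF wft nz(1)[OF t] bct'[OF t] outgoing_cnj[OF out0(1)] outgoing_cnj[OF outa], of lam]
      good(1)[of t] t unfolding Neq by (simp add: t0_def \<rho>_def)
  have second: "Im (vderivs 2 lt 0) = - (\<Sum>m=1..nL G. (cmod (c m))\<^sup>2)"
  proof (rule second_derivative_of_quadratic_bound[OF _ sm' _ \<alpha>d \<alpha>0 _ mslim])
    show "t0 > 0" using d e(1) by (simp add: t0_def)
    show "Im (lt 0) = 0" using lt0 by simp
    show "(\<Sum>m=1..nL G. (cmod (\<alpha> t m))\<^sup>2) = - 2 * Im (lt t) * ms t" if "\<bar>t\<bar> < t0" for t
      unfolding ms_def by (rule flux_identity(2)[OF wft nz(1)[OF that] bct'[OF that] nz(2)[OF that]])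
  qed

  \<comment> \<open>Bundles the properties of both amplitude families so that they can be chosen
    together for each \<open>k\<close>.\<close>
  define scat where "scat k A B \<longleftrightarrow> bc G l ?lam A B \<and> (\<forall>m\<in>{1..nL G}. B m = (if m = k then 1 else 0)) \<and>
    (\<forall>m\<in>edges G. \<forall>x\<in>eI G l m. E ?lam k m x = ew ?lam (A m) (B m) x) \<and>
    (\<Sum>m\<in>fin_edges G. integral {0..l m} (\<lambda>x. ew ?lam (\<alpha>0 m) (\<beta>0 m) x * ew ?lam (cnj (B m)) (cnj (A m)) x)) = 0"
    for k A B
  have "\<exists>A B. scat k A B" if k: "k \<in> {1..nL G}" for k
    unfolding scat_def
    by (rule gen_eigfun_at_eigenvalue[OF wf lam_pos E_gen k bc0 outa out0(1)]) blast
  then obtain A B where scat: "\<And>k. k \<in> {1..nL G} \<Longrightarrow> scat k (A k) (B k)" by metis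
  have AB: "bc G l ?lam (A k) (B k)" "\<forall>m\<in>{1..nL G}. B k m = (if m = k then 1 else 0)"
    "\<forall>m\<in>edges G. \<forall>x\<in>eI G l m. E ?lam k m x = ew ?lam (A k m) (B k m) x"
    "(\<Sum>m\<in>fin_edges G. integral {0..l m} (\<lambda>x.
        ew ?lam (\<alpha>0 m) (\<beta>0 m) x * ew ?lam (cnj (B k m)) (cnj (A k m)) x)) = 0"
    if "k \<in> {1..nL G}" for k
    using scat[OF that] unfolding scat_def by blast+
  have uc': "\<forall>m\<in>edges G. \<forall>x\<in>eI G l m. u m x = ew ?lam (\<alpha> 0 m) (\<beta> 0 m) x"
    using uc at0 by simp
  have F: "Fcoef G l a lam u E k = \<i> * (\<Sum>m=1..nL G. c m * cnj (A k m))" if k: "k \<in> {1..nL G}" for k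
  proof -
    have "(\<Sum>m\<in>fin_edges G. integral {0..l m} (\<lambda>x.
        ew ?lam (\<alpha> 0 m) (\<beta> 0 m) x * ew ?lam (cnj (B k m)) (cnj (A k m)) x)) = 0"
      using AB(4)[OF k] at0 fin_edges_subset by simp
    from lead_coefficient_derivative[OF wf lam_pos a_smooth a_zero d lt0 ltd bct \<alpha>c \<beta>c \<alpha>d \<alpha>0 AB(1)[OF k] this]
      Fcoef_coefficients[where E = E and k = k and a = a and u = u, OF wf lam_pos uc' AB(3)[OF k]]
    show ?thesis by simp
  qed
  have "(\<Sum>k=1..nL G. (cmod (Fcoef G l a lam u E k))\<^sup>2) = (\<Sum>k=1..nL G. (cmod (\<Sum>m=1..nL G. c m * cnj (A k m)))\<^sup>2)"
    by (intro sum.cong refl) (simp add: F norm_mult)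
  also have "\<dots> = (\<Sum>m=1..nL G. (cmod (c m))\<^sup>2)"
  proof (rule unitary_norm)
    have lamne: "lam \<noteq> 0" using lam_pos by simp
    show "A k m = A m k" if "k \<in> {1..nL G}" "m \<in> {1..nL G}" for k m
      by (rule scattering_relations(1)[OF wf lamne AB(1) _ that]) (use AB(2) in blast)+
    show "(\<Sum>m=1..nL G. A k m * cnj (A j m)) = (if k = j then 1 else 0)" if "k \<in> {1..nL G}" "j \<in> {1..nL G}" for k j
      by (rule scattering_relations(2)[OF wf lamne AB(1) _ that]) (use AB(2) in blast)+
  qed simp
  finally show ?thesis
    using second sm' lt0 res d e(1) by (intro exI[of _ t0] conjI exI[of _ lt]) (auto simp: t0_def)
qed

end
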